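(* Let $n\to\infty$ and let $m=m(n)$ be integers with $\alpha:=m/n$ satisfying \[ \alpha= \frac{6}{\pi^2}\left( \log n +\frac{1}{2}\log\log n+ \frac{1}{2}\log (12/\pi)-\frac{\pi^2}{12}+\mu_n\right), \] where $|\mu_n|=o(\log\log\log n)$. Let $C(\boldsymbol\sigma(n,m))$ be the number of connected components of the permutation graph $G_{\boldsymbol\sigma(n,m)}$. Then $C(\boldsymbol\sigma(n,m))-1$ is asymptotic in distribution to a Poisson random variable with mean $e^{-\mu_n}$; more precisely, \[ d_{\mathrm{TV}}\bigl[C(\boldsymbol\sigma(n,m))-1,\mathrm{Poisson}(\lambda_n)\bigr]\le (\log n)^{-1+\varepsilon}\quad\text{for every }\varepsilon>0 \text{ (and all large } n), \] where \[ \lambda_n= n\prod_{j=1}^{\infty} \left( 1-\frac{\alpha^j}{(\alpha+1)^j}\right) =\exp\left[ -\mu_n+O\left(\frac{\log\log n}{\log n}\right)\right]. \]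
   Context: For a permutation $\boldsymbol\sigma$ of $[n]=\{1,\dots,n\}$, an inversion is a pair $i<j$ of values with $\boldsymbol\sigma^{-1}(i)>\boldsymbol\sigma^{-1}(j)$. The permutation graph $G_{\boldsymbol\sigma}$ has vertex set $[n]$ and an edge $\{i,j\}$ for each inversion. $\boldsymbol\sigma(n,m)$ denotes a permutation chosen uniformly at random among all permutations of $[n]$ with exactly $m$ inversions. $d_{\mathrm{TV}}(X,Y)$ is the total variation distance between the distributions of integer-valued random variables $X$ and $Y$. *)

theory Defs
  imports "HOL-Probability.Probability" "HOL-Combinatorics.Permutations"
    "HOL-Library.Landau_Symbols"
begin

(* Pairs of values: i < j, and j occurs at an earlier position than i. *)
definition inversions :: "nat \<Rightarrow> (nat \<Rightarrow> nat) \<Rightarrow> (nat \<times> nat) set" where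
  "inversions n \<sigma> = {(i, j). i \<in> {1..n} \<and> j \<in> {1..n} \<and> i < j \<and> inv \<sigma> i > inv \<sigma> j}"

definition perm_graph_edges :: "nat \<Rightarrow> (nat \<Rightarrow> nat) \<Rightarrow> nat set set" where
  "perm_graph_edges n \<sigma> = {{i, j} | i j. (i, j) \<in> inversions n \<sigma>}"

(* Vertex sets of the components of the simple graph with vertex set V and edge set E. *)
definition graph_components :: "'a set \<Rightarrow> 'a set set \<Rightarrow> 'a set set" where
  "graph_components V E = V // {(u, v) \<in> V \<times> V. (u, v) \<in> {(x, y). {x, y} \<in> E}\<^sup>*}"

definition num_components :: "nat \<Rightarrow> (nat \<Rightarrow> nat) \<Rightarrow> nat" where
  "num_components n \<sigma> = card (graph_components {1..n} (perm_graph_edges n \<sigma>))"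

definition perms_with_inversions :: "nat \<Rightarrow> nat \<Rightarrow> (nat \<Rightarrow> nat) set" where
  "perms_with_inversions n m = {\<sigma>. \<sigma> permutes {1..n} \<and> card (inversions n \<sigma>) = m}"

(* Meaningful only for m \<le> n choose 2, when perms_with_inversions n m is nonempty. *)
definition random_perm :: "nat \<Rightarrow> nat \<Rightarrow> (nat \<Rightarrow> nat) pmf" where
  "random_perm n m = pmf_of_set (perms_with_inversions n m)"

definition total_variation :: "int pmf \<Rightarrow> int pmf \<Rightarrow> real" where
  "total_variation p q = (SUP A. \<bar>measure_pmf.prob p A - measure_pmf.prob q A\<bar>)"

(* The law of C - 1; subtraction in int, so nothing is truncated. *)
definition excess_components_pmf :: "nat \<Rightarrow> nat \<Rightarrow> int pmf" where
  "excess_components_pmf n m = map_pmf (\<lambda>\<sigma>. int (num_components n \<sigma>) - 1) (random_perm n m)"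

end

theory Submission
  imports Defs "HOL-Computational_Algebra.Formal_Power_Series" "HOL-Real_Asymp.Real_Asymp"
begin

text \<open>
  The components of a permutation graph are the blocks between the cuts \<open>t\<close> across which there is no
  inversion. In terms of the inversion table \<open>x\<close> a cut at \<open>t\<close> means \<open>x (t + i) < i\<close> for all \<open>i\<close>, so the
  permutations with \<open>m\<close> inversions that are cut at all points of \<open>T\<close> correspond to weak compositions of
  \<open>m\<close> whose parts respect certain caps. Up to a relative error that is polynomially small in \<open>n\<close>, a few
  bounded parts of a uniform weak composition of \<open>m\<close> into \<open>n\<close> parts are independent geometric variables
  with ratio \<open>q = m / (n + m)\<close>, and each gap \<open>g\<close> between consecutive cuts contributes the factor
  \<open>(1 - q) \<cdots> (1 - q\<^sup>g)\<close>. This factor equals \<open>\<lambda> / n\<close> to high accuracy for long gaps, while the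
  total weight of the short gaps is only of order \<open>1 / log n\<close>; summing over \<open>T\<close> with a generating
  function therefore shows that the \<open>k\<close>-th factorial moment of the number of cuts is close to
  \<open>\<lambda>\<^sup>k\<close>, and truncated Bonferroni inequalities turn this into a total variation bound. The
  accumulated factor \<open>exp (O(\<lambda>))\<close> stays below every power \<open>(log n)\<^sup>\<epsilon>\<close> because \<open>\<mu>\<close> is \<open>o(log log log n)\<close>.
  The asymptotics of \<open>\<lambda>\<close> come from the trapezoidal rule for \<open>log (1 - exp (- x))\<close> with the singular
  part \<open>log x\<close> summed by Stirling's formula.
\<close>

section \<open>Cuts and inversion tables\<close>

text \<open>The delicate choice is the length \<open>L\<close> up to which caps are enforced. The
  longer caps must be negligible even after a union bound over n parts, so n q^L has to be tiny; yet
  fixing about k L parts of size up to L must be cheap in a uniform composition, so (k L^2)^2 has to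
  stay far below n. As 1 - q is of order 1 / log n, L = (log n)^3 meets both demands. k cuts leave k
  + 1 gaps, hence k + 1 factors \<lambda> / n. One of them cancels against the count of all
  permutations with m inversions, and the roughly n^k / k! cut sets turn the others into \<lambda>^k
  / k!. The error 1 / log n stems from gaps of length one, whose factor is 1 - q instead of
  \<lambda> / n. The k-th moment enters the Bonferroni sums with weight 2^k, so all errors are
  multiplied by exp (O(\<lambda>)). Since |\<mu>| is eventually at most half of log log log n,
  \<lambda> is O(sqrt (log log n)), which makes this factor (log n)^o(1). The window comes from log
  (prod (1 - q^j)) = - pi^2 / (6 z) + log (2 pi / z) / 2 + O(z) for q = exp (- z).\<close>

definition cut_points :: "nat \<Rightarrow> (nat \<Rightarrow> nat) \<Rightarrow> nat set" where
  "cut_points n \<sigma> = {t \<in> {1..<n}. \<forall>i\<in>{1..t}. \<forall>j\<in>{t<..n}. inv \<sigma> i < inv \<sigma> j}"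

lemma inv_neq:
  assumes "\<sigma> permutes {1..n}" "i \<noteq> j"
  shows "inv \<sigma> i \<noteq> inv \<sigma> j"
  using assms by (metis permutes_inverses(1))

lemma edge_iff_inversion:
  "{i, j} \<in> perm_graph_edges n \<sigma> \<longleftrightarrow> (i, j) \<in> inversions n \<sigma> \<or> (j, i) \<in> inversions n \<sigma>"
proof -
  have "{i, j} \<in> perm_graph_edges n \<sigma> \<longleftrightarrow> (\<exists>a b. {i, j} = {a, b} \<and> (a, b) \<in> inversions n \<sigma>)"
    by (simp add: perm_graph_edges_def)
  then show ?thesis by (metis doubleton_eq_iff)
qed

text \<open>As b stands before a, every value x strictly between them stands after b or before a. In
  the first case x is adjacent to b, in the second to a, so one inversion connects the whole
  interval.\<close>

lemma crossing_edge_connects: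
  assumes "\<sigma> permutes {1..n}" "(a, b) \<in> inversions n \<sigma>" "x \<in> {a..b}"
  shows "(a, x) \<in> {(x, y). {x, y} \<in> perm_graph_edges n \<sigma>}\<^sup>*"
proof -
  let ?R = "{(x, y). {x, y} \<in> perm_graph_edges n \<sigma>}"
  have e: "(i, j) \<in> ?R \<and> (j, i) \<in> ?R" if "(i, j) \<in> inversions n \<sigma>" for i j
    using that by (simp add: edge_iff_inversion)
  have ab: "a \<in> {1..n}" "b \<in> {1..n}" "a < b" "inv \<sigma> b < inv \<sigma> a"
    using assms(2) by (auto simp: inversions_def)
  consider "x = a" | "x = b" | "a < x" "x < b" using assms(3) by fastforce
  then show ?thesis
  proof cases
    case 1 then show ?thesis by simp
  next
    case 2 then show ?thesis using e[OF assms(2)] by blast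
  next
    case 3
    show ?thesis
    proof (cases "inv \<sigma> b < inv \<sigma> x")
      case True
      then have "(x, b) \<in> inversions n \<sigma>" using 3 ab by (auto simp: inversions_def)
      then show ?thesis using e[OF assms(2)] e by (meson converse_rtrancl_into_rtrancl r_into_rtrancl)
    next
      case False
      then have "inv \<sigma> x < inv \<sigma> a" using ab by linarith
      then have "(a, x) \<in> inversions n \<sigma>" using 3 ab by (auto simp: inversions_def)
      then show ?thesis using e by blast
    qed
  qed
qed

text \<open>No edge straddles a cut, so cuts separate. Conversely, a point i that is not a cut is
  straddled by an inversion (a, b), and i and i + 1 both lie in the interval from a to b, all of
  which is connected to a.\<close>

lemma connected_iff_no_cut_between:
  assumes "\<sigma> permutes {1..n}" "u \<in> {1..n}" "v \<in> {1..n}" "u \<le> v"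
  shows "(u, v) \<in> {(x, y). {x, y} \<in> perm_graph_edges n \<sigma>}\<^sup>* \<longleftrightarrow> cut_points n \<sigma> \<inter> {u..<v} = {}"
proof
  let ?R = "{(x, y). {x, y} \<in> perm_graph_edges n \<sigma>}"
  have inR: "i \<le> t \<longleftrightarrow> j \<le> t" if ij: "(i, j) \<in> ?R" and t: "t \<in> cut_points n \<sigma>" for i j t
  proof -
    have "a \<le> t \<longleftrightarrow> b \<le> t" if ab: "(a, b) \<in> inversions n \<sigma>" for a b
    proof -
      have "\<not> (a \<le> t \<and> t < b)"
      proof
        assume "a \<le> t \<and> t < b"
        then have "a \<in> {1..t}" "b \<in> {t<..n}" using ab by (auto simp: inversions_def)
        then have "inv \<sigma> a < inv \<sigma> b" using t unfolding cut_points_def by blast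
        then show False using ab by (simp add: inversions_def)
      qed
      moreover have "a < b" using ab by (simp add: inversions_def)
      ultimately show ?thesis by linarith
    qed
    then show ?thesis using ij by (auto simp: edge_iff_inversion)
  qed
  assume "(u, v) \<in> ?R\<^sup>*"
  then have "\<forall>t \<in> cut_points n \<sigma>. u \<le> t \<longleftrightarrow> v \<le> t"
    by (induction rule: rtrancl_induct) (use inR in auto)
  then show "cut_points n \<sigma> \<inter> {u..<v} = {}" by fastforce
next
  let ?R = "{(x, y). {x, y} \<in> perm_graph_edges n \<sigma>}"
  have symR: "sym ?R" by (auto simp: sym_def edge_iff_inversion)
  have step: "(i, Suc i) \<in> ?R\<^sup>*" if i: "i \<in> {1..<n}" "i \<notin> cut_points n \<sigma>" for i
  proof -
    obtain a b where ab: "a \<in> {1..i}" "b \<in> {i<..n}" "\<not> inv \<sigma> a < inv \<sigma> b"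
      using i by (auto simp: cut_points_def)
    have "inv \<sigma> a \<noteq> inv \<sigma> b" using ab by (intro inv_neq[OF assms(1)]) auto
    then have "(a, b) \<in> inversions n \<sigma>" using ab i by (auto simp: inversions_def)
    note c = crossing_edge_connects[OF assms(1) this]
    have "(a, i) \<in> ?R\<^sup>*" "(a, Suc i) \<in> ?R\<^sup>*" using ab by (auto intro!: c)
    moreover have "sym (?R\<^sup>*)" by (rule sym_rtrancl[OF symR])
    ultimately show ?thesis by (meson rtrancl_trans symD)
  qed
  note step' = this
  assume "cut_points n \<sigma> \<inter> {u..<v} = {}"
  with assms(4,3) show "(u, v) \<in> ?R\<^sup>*"
  proof (induction v rule: dec_induct)
    case base then show ?case by simp
  next
    case (step w)
    have "w \<in> {1..<n}" "w \<notin> cut_points n \<sigma>" using step.hyps step.prems assms(2) by auto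
    then have "(w, Suc w) \<in> ?R\<^sup>*" by (rule step')
    moreover have "(u, w) \<in> ?R\<^sup>*"
    proof (rule step.IH)
      show "w \<in> {1..n}" using step.hyps step.prems assms(2) by auto
      have "{u..<w} \<subseteq> {u..<Suc w}" by auto
      then show "cut_points n \<sigma> \<inter> {u..<w} = {}" using step.prems by blast
    qed
    ultimately show ?case by (rule rtrancl_trans[rotated])
  qed
qed

text \<open>The number of cuts below a vertex is a complete invariant of its component. It starts at
  0, grows by at most one from a vertex to the next and ends at the number of cuts, so it takes
  every value in between.\<close>

lemma num_components_eq:
  assumes "\<sigma> permutes {1..n}" "n \<ge> 1"
  shows "num_components n \<sigma> = Suc (card (cut_points n \<sigma>))"
proof -
  let ?R = "{(x, y). {x, y} \<in> perm_graph_edges n \<sigma>}"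
  define f where "f i = card (cut_points n \<sigma> \<inter> {..<i})" for i
  have fin: "finite (cut_points n \<sigma>)" by (auto simp: cut_points_def)
  have feq: "f u = f v \<longleftrightarrow> cut_points n \<sigma> \<inter> {u..<v} = {}" if "u \<le> v" for u v
  proof -
    have "cut_points n \<sigma> \<inter> {..<v} = (cut_points n \<sigma> \<inter> {..<u}) \<union> (cut_points n \<sigma> \<inter> {u..<v})"
      using that by auto
    moreover have "card ((cut_points n \<sigma> \<inter> {..<u}) \<union> (cut_points n \<sigma> \<inter> {u..<v})) =
        card (cut_points n \<sigma> \<inter> {..<u}) + card (cut_points n \<sigma> \<inter> {u..<v})"
      by (rule card_Un_disjoint) (use fin in auto)
    ultimately have "f v = f u + card (cut_points n \<sigma> \<inter> {u..<v})"
      unfolding f_def by metis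
    then show ?thesis using fin by simp
  qed
  have symR: "sym (?R\<^sup>*)" by (intro sym_rtrancl) (auto simp: sym_def edge_iff_inversion)
  have rel: "(u, v) \<in> ?R\<^sup>* \<longleftrightarrow> f u = f v" if "u \<in> {1..n}" "v \<in> {1..n}" for u v
  proof (cases "u \<le> v")
    case True
    then show ?thesis using connected_iff_no_cut_between[OF assms(1) that True] feq[OF True] by simp
  next
    case False
    then have "v \<le> u" by simp
    then show ?thesis
      using connected_iff_no_cut_between[OF assms(1) that(2,1)] feq[of v u] symR
      by (metis symD)
  qed
  have E: "{(u, v) \<in> {1..n} \<times> {1..n}. (u, v) \<in> ?R\<^sup>*} = {(u, v). u \<in> {1..n} \<and> v \<in> {1..n} \<and> f u = f v}"
    using rel by auto
  have cl: "{(u, v). u \<in> {1..n} \<and> v \<in> {1..n} \<and> f u = f v} `` {u} = {1..n} \<inter> f -` {f u}"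
    if "u \<in> {1..n}" for u using that by auto
  have "graph_components {1..n} (perm_graph_edges n \<sigma>) = (\<lambda>y. {1..n} \<inter> f -` {y}) ` f ` {1..n}"
    unfolding graph_components_def E quotient_def using cl by (auto simp: image_image)
  moreover have "inj_on (\<lambda>y. {1..n} \<inter> f -` {y}) (f ` {1..n})"
    by (rule inj_onI) blast
  ultimately have "num_components n \<sigma> = card (f ` {1..n})"
    unfolding num_components_def by (simp add: card_image)
  also have "f ` {1..n} = {..card (cut_points n \<sigma>)}"
  proof
    show "f ` {1..n} \<subseteq> {..card (cut_points n \<sigma>)}"
      using fin by (auto simp: f_def intro!: card_mono)
    have step: "f (Suc i) \<le> Suc (f i)" for i
    proof -
      have "cut_points n \<sigma> \<inter> {..<Suc i} \<subseteq> insert i (cut_points n \<sigma> \<inter> {..<i})" by auto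
      then have "f (Suc i) \<le> card (insert i (cut_points n \<sigma> \<inter> {..<i}))"
        unfolding f_def using fin by (intro card_mono) auto
      also have "\<dots> \<le> Suc (f i)" unfolding f_def by (simp add: fin card_insert_if)
      finally show ?thesis .
    qed
    have f1: "f 1 = 0" by (auto simp: f_def cut_points_def)
    have fn: "f n = card (cut_points n \<sigma>)"
      unfolding f_def by (rule arg_cong[where f = card]) (auto simp: cut_points_def)
    have "{..f v} \<subseteq> f ` {1..v}" if "v \<ge> 1" for v
      using that
    proof (induction v rule: dec_induct)
      case base then show ?case using f1 by force
    next
      case (step v)
      have "{..f (Suc v)} \<subseteq> insert (f (Suc v)) {..f v}"
        using \<open>\<And>i. f (Suc i) \<le> Suc (f i)\<close>[of v] by auto
      also have "\<dots> \<subseteq> f ` {1..Suc v}" using step by (auto simp: atLeastAtMostSuc_conv)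
      finally show ?case .
    qed
    from this[OF assms(2)] show "{..card (cut_points n \<sigma>)} \<subseteq> f ` {1..n}" unfolding fn .
  qed
  finally show ?thesis by simp
qed

section \<open>Inversion tables as a bijection between permutations and bounded sequences\<close>

definition inversion_table :: "nat \<Rightarrow> (nat \<Rightarrow> nat) \<Rightarrow> nat \<Rightarrow> nat" where
  "inversion_table n \<sigma> = restrict (\<lambda>j. card {i \<in> {1..<j}. inv \<sigma> j < inv \<sigma> i}) {1..n}"

lemma card_inversions:
  "card (inversions n \<sigma>) = (\<Sum>j\<in>{1..n}. inversion_table n \<sigma> j)"
proof -
  have "inversions n \<sigma> = prod.swap ` (SIGMA j:{1..n}. {i \<in> {1..<j}. inv \<sigma> j < inv \<sigma> i})"
    by (auto simp: inversions_def image_iff)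
  then have "card (inversions n \<sigma>) = card (SIGMA j:{1..n}. {i \<in> {1..<j}. inv \<sigma> j < inv \<sigma> i})"
    by (simp add: card_image)
  then show ?thesis by (simp add: inversion_table_def)
qed

text \<open>The values that are placed to the right of \<open>j\<close> form an up-set of known size among the smaller
  values, so the table determines the relative order of positions.\<close>
lemma inversion_table_inj:
  "inj_on (inversion_table n) {\<sigma>. \<sigma> permutes {1..n}}"
proof (rule inj_onI)
  fix \<sigma> \<tau> assume "\<sigma> \<in> {\<sigma>. \<sigma> permutes {1..n}}" "\<tau> \<in> {\<sigma>. \<sigma> permutes {1..n}}"
    and eq: "inversion_table n \<sigma> = inversion_table n \<tau>"
  then have s: "\<sigma> permutes {1..n}" and t: "\<tau> permutes {1..n}" by simp_all
  \<comment> \<open>The two sets are nested, so comparing their cardinalities decides which of i and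
    j comes first. The table gives the cardinality for j, and the order of the values below j gives
    the one for i.\<close>
  have key: "inv r j < inv r i \<longleftrightarrow>
      card {k \<in> {1..<j}. inv r i < inv r k} < card {k \<in> {1..<j}. inv r j < inv r k}"
    if r: "r permutes {1..n}" and ij: "i \<in> {1..<j}" for r i j
  proof
    assume "inv r j < inv r i"
    then show "card {k \<in> {1..<j}. inv r i < inv r k} < card {k \<in> {1..<j}. inv r j < inv r k}"
      using ij by (intro psubset_card_mono) auto
  next
    assume *: "card {k \<in> {1..<j}. inv r i < inv r k} < card {k \<in> {1..<j}. inv r j < inv r k}"
    show "inv r j < inv r i"
    proof (rule ccontr)
      assume "\<not> ?thesis"
      then have "{k \<in> {1..<j}. inv r j < inv r k} \<subseteq> {k \<in> {1..<j}. inv r i < inv r k}" by auto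
      from card_mono[OF _ this] * show False by simp
    qed
  qed
  have tab: "card {k \<in> {1..<j}. inv \<sigma> j < inv \<sigma> k} = card {k \<in> {1..<j}. inv \<tau> j < inv \<tau> k}"
    if "j \<in> {1..n}" for j
    using fun_cong[OF eq, of j] that by (simp add: inversion_table_def)
  have ord: "j \<le> n \<Longrightarrow> \<forall>i\<in>{1..j}. \<forall>k\<in>{1..j}. inv \<sigma> i < inv \<sigma> k \<longleftrightarrow> inv \<tau> i < inv \<tau> k" for j
  proof (induction j)
    case 0 then show ?case by simp
  next
    case (Suc j)
    then have IH: "inv \<sigma> i < inv \<sigma> k \<longleftrightarrow> inv \<tau> i < inv \<tau> k" if "i \<in> {1..j}" "k \<in> {1..j}" for i k
      using that by auto
    have new: "inv \<sigma> (Suc j) < inv \<sigma> i \<longleftrightarrow> inv \<tau> (Suc j) < inv \<tau> i" if i: "i \<in> {1..j}" for i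
    proof -
      have "{k \<in> {1..<Suc j}. inv \<sigma> i < inv \<sigma> k} = {k \<in> {1..<Suc j}. inv \<tau> i < inv \<tau> k}"
        using IH i by auto
      then show ?thesis using key[OF s, of i "Suc j"] key[OF t, of i "Suc j"] i tab[of "Suc j"] Suc.prems
        by simp
    qed
    have new': "inv \<sigma> i < inv \<sigma> (Suc j) \<longleftrightarrow> inv \<tau> i < inv \<tau> (Suc j)" if i: "i \<in> {1..j}" for i
      using new[OF i] inv_neq[OF s, of i "Suc j"] inv_neq[OF t, of i "Suc j"] i
      by (metis atLeastAtMost_iff linorder_less_linear not_less_eq_eq order_less_imp_not_less order_refl)
    show ?case using IH new new' by (auto simp: atLeastAtMostSuc_conv)
  qed
  have rank: "inv r i = card {k \<in> {1..n}. inv r k < inv r i} + 1" if r: "r permutes {1..n}" and i: "i \<in> {1..n}" for r i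
  proof -
    have p: "inv r permutes {1..n}" using r by (rule permutes_inv)
    have ri: "inv r i \<in> {1..n}" using permutes_in_image[OF p] i by simp
    have "inv r ` {k \<in> {1..n}. inv r k < inv r i} = {1..<inv r i}"
    proof
      show "inv r ` {k \<in> {1..n}. inv r k < inv r i} \<subseteq> {1..<inv r i}"
      proof clarify
        fix k assume "k \<in> {1..n}" "inv r k < inv r i"
        then show "inv r k \<in> {1..<inv r i}" using permutes_in_image[OF p, of k] by simp
      qed
      show "{1..<inv r i} \<subseteq> inv r ` {k \<in> {1..n}. inv r k < inv r i}"
      proof
        fix y assume y: "y \<in> {1..<inv r i}"
        then have "y \<in> {1..n}" using ri by auto
        then have ry: "r y \<in> {1..n}" using permutes_in_image[OF r, of y] by simp
        have inv: "inv r (r y) = y" using r by (rule permutes_inverses(2))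
        have "r y \<in> {k \<in> {1..n}. inv r k < inv r i}" using ry inv y by simp
        then show "y \<in> inv r ` {k \<in> {1..n}. inv r k < inv r i}" by (intro image_eqI[where x = "r y"]) (rule inv[symmetric])
      qed
    qed
    moreover have "inj_on (inv r) {k \<in> {1..n}. inv r k < inv r i}"
      using permutes_inj[OF p] by (rule inj_on_subset) simp
    ultimately have "card {k \<in> {1..n}. inv r k < inv r i} = card {1..<inv r i}"
      using card_image[of "inv r" "{k \<in> {1..n}. inv r k < inv r i}"] by simp
    then show ?thesis using ri by simp
  qed
  have "inv \<sigma> i = inv \<tau> i" for i
  proof (cases "i \<in> {1..n}")
    case True
    have "{k \<in> {1..n}. inv \<sigma> k < inv \<sigma> i} = {k \<in> {1..n}. inv \<tau> k < inv \<tau> i}"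
      using ord[of n] True by auto
    then show ?thesis using rank[OF s True] rank[OF t True] by simp
  next
    case False
    then show ?thesis
      using permutes_not_in[OF permutes_inv[OF s]] permutes_not_in[OF permutes_inv[OF t]] by simp
  qed
  then have "inv \<sigma> = inv \<tau>" by (rule ext)
  then have "inv (inv \<sigma>) = inv (inv \<tau>)" by (rule arg_cong)
  then show "\<sigma> = \<tau>" by (simp only: permutes_inv_inv[OF s] permutes_inv_inv[OF t])
qed

text \<open>Surjectivity follows by counting: both sides have n! elements, so no permutation has to
  be rebuilt from its table.\<close>

lemma inversion_table_bij:
  "bij_betw (inversion_table n) {\<sigma>. \<sigma> permutes {1..n}} (PiE {1..n} (\<lambda>j. {..<j}))"
proof -
  have sub: "inversion_table n ` {\<sigma>. \<sigma> permutes {1..n}} \<subseteq> PiE {1..n} (\<lambda>j. {..<j})"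
  proof clarify
    fix \<sigma> :: "nat \<Rightarrow> nat"
    have "card {i \<in> {1..<j}. inv \<sigma> j < inv \<sigma> i} < j" if "j \<in> {1..n}" for j
    proof -
      have "card {i \<in> {1..<j}. inv \<sigma> j < inv \<sigma> i} \<le> card {1..<j}" by (rule card_mono) auto
      also have "card {1..<j} < j" using that by simp
      finally show ?thesis .
    qed
    then show "inversion_table n \<sigma> \<in> PiE {1..n} (\<lambda>j. {..<j})"
      unfolding inversion_table_def restrict_PiE_iff by simp
  qed
  have "card (inversion_table n ` {\<sigma>. \<sigma> permutes {1..n}}) = card {\<sigma>. \<sigma> permutes {1..n}}"
    by (rule card_image[OF inversion_table_inj])
  also have "\<dots> = card (PiE {1..n} (\<lambda>j. {..<j}))"
    by (simp add: card_permutations[of _ n] card_PiE fact_prod)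
  finally show ?thesis
    using card_subset_eq[OF _ sub] inversion_table_inj by (auto simp: bij_betw_def finite_PiE)
qed

text \<open>Across a cut t, the smaller values to the right of j > t all exceed t, and there are at
  most j - t - 1 of those. Conversely, by induction on j: if some a \<le> t stood to the right of j,
  the values between t and j, which stand to the right of a by the induction hypothesis, would also
  be to the right of j, and together with a they number j - t.\<close>

lemma cut_point_iff_table:
  assumes "\<sigma> permutes {1..n}" "t \<in> {1..<n}"
  shows "t \<in> cut_points n \<sigma> \<longleftrightarrow> (\<forall>j\<in>{t<..n}. inversion_table n \<sigma> j < j - t)"
proof
  assume t: "t \<in> cut_points n \<sigma>"
  show "\<forall>j\<in>{t<..n}. inversion_table n \<sigma> j < j - t"
  proof
    fix j assume j: "j \<in> {t<..n}"
    have "{i \<in> {1..<j}. inv \<sigma> j < inv \<sigma> i} \<subseteq> {t<..<j}"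
    proof
      fix i assume i: "i \<in> {i \<in> {1..<j}. inv \<sigma> j < inv \<sigma> i}"
      have "\<not> i \<le> t"
      proof
        assume "i \<le> t"
        then have "inv \<sigma> i < inv \<sigma> j" using t i j by (simp add: cut_points_def)
        then show False using i by simp
      qed
      then show "i \<in> {t<..<j}" using i by simp
    qed
    then have "card {i \<in> {1..<j}. inv \<sigma> j < inv \<sigma> i} \<le> card {t<..<j}" by (intro card_mono) auto
    then show "inversion_table n \<sigma> j < j - t" using j assms(2) by (auto simp: inversion_table_def)
  qed
next
  assume *: "\<forall>j\<in>{t<..n}. inversion_table n \<sigma> j < j - t"
  have "\<forall>i\<in>{1..t}. t < j \<longrightarrow> j \<le> n \<longrightarrow> inv \<sigma> i < inv \<sigma> j" for j
  proof (induction j rule: less_induct)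
    case (less j)
    show ?case
    proof (intro ballI impI, rule ccontr)
      fix a assume a: "a \<in> {1..t}" and j: "t < j" "j \<le> n" and n: "\<not> inv \<sigma> a < inv \<sigma> j"
      have aj: "inv \<sigma> j < inv \<sigma> a" using n inv_neq[OF assms(1), of a j] a j by auto
      have "inv \<sigma> j < inv \<sigma> i" if "i \<in> {t<..<j}" for i
        using less.IH[of i] a that j aj by fastforce
      then have "insert a {t<..<j} \<subseteq> {i \<in> {1..<j}. inv \<sigma> j < inv \<sigma> i}" using a j aj by auto
      then have "card (insert a {t<..<j}) \<le> card {i \<in> {1..<j}. inv \<sigma> j < inv \<sigma> i}"
        by (intro card_mono) auto
      moreover have "card (insert a {t<..<j}) = j - t" using a j by (auto simp: card_insert_if)
      moreover have "card {i \<in> {1..<j}. inv \<sigma> j < inv \<sigma> i} < j - t"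
        using * j assms(2) by (auto simp: inversion_table_def)
      ultimately show False by linarith
    qed
  qed
  then show "t \<in> cut_points n \<sigma>" using assms(2) by (auto simp: cut_points_def)
qed

text \<open>The strict bound that cuts at all points of \<open>T\<close> impose on the \<open>j\<close>-th entry of the inversion table.\<close>
definition cap :: "nat set \<Rightarrow> nat \<Rightarrow> nat" where
  "cap T j = j - Max (insert 0 {t \<in> T. t < j})"

text \<open>Only the largest t below j matters; the element 0 inserted into \<open>Max\<close>
  stands for the constraint x < j, which every inversion table satisfies.\<close>

lemma less_cap_iff:
  assumes "finite T"
  shows "x < cap T j \<longleftrightarrow> x < j \<and> (\<forall>t\<in>T. t < j \<longrightarrow> x < j - t)"
proof -
  let ?M = "Max (insert 0 {t \<in> T. t < j})"
  have fin: "finite (insert 0 {t \<in> T. t < j})" using assms by simp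
  have Min: "?M \<in> insert 0 {t \<in> T. t < j}" by (rule Max_in) (use fin in auto)
  have le: "t \<le> ?M" if "t \<in> T" "t < j" for t using fin that by (intro Max_ge) auto
  from Min have "?M = 0 \<or> ?M \<in> {t \<in> T. t < j}" unfolding insert_iff .
  then have "?M = 0 \<or> ?M \<in> T \<and> ?M < j" unfolding mem_Collect_eq .
  then consider "?M = 0" | "?M \<in> T" "?M < j" by metis
  then show ?thesis
  proof cases
    case 1
    then have "\<forall>t\<in>T. t < j \<longrightarrow> t = 0" using le by fastforce
    then show ?thesis unfolding cap_def 1 by auto
  next
    case 2
    have "x < j - ?M \<longleftrightarrow> x < j \<and> (\<forall>t\<in>T. t < j \<longrightarrow> x < j - t)"
    proof
      assume x: "x < j - ?M"
      have "x < j - t" if "t \<in> T" "t < j" for t using le[OF that] x by linarith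
      then show "x < j \<and> (\<forall>t\<in>T. t < j \<longrightarrow> x < j - t)" using x by auto
    qed (use 2 in blast)
    then show ?thesis unfolding cap_def .
  qed
qed

definition cap_count :: "nat \<Rightarrow> nat \<Rightarrow> nat set \<Rightarrow> nat" where
  "cap_count n m T = card {x \<in> PiE {1..n} (\<lambda>j. {..<cap T j}). sum x {1..n} = m}"

text \<open>In terms of the table, prescribed cuts become separate upper bounds on the entries,
  which are then coupled only through their sum.\<close>

lemma card_perms_with_cuts:
  assumes T: "T \<subseteq> {1..<n}"
  shows "card {\<sigma> \<in> perms_with_inversions n m. T \<subseteq> cut_points n \<sigma>} = cap_count n m T"
proof -
  have finT: "finite T" using T by (rule finite_subset) simp
  let ?A = "{\<sigma> \<in> perms_with_inversions n m. T \<subseteq> cut_points n \<sigma>}"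
  let ?B = "{x \<in> PiE {1..n} (\<lambda>j. {..<cap T j}). sum x {1..n} = m}"
  have iff: "T \<subseteq> cut_points n \<sigma> \<longleftrightarrow> (\<forall>j\<in>{1..n}. inversion_table n \<sigma> j < cap T j)"
    if s: "\<sigma> permutes {1..n}" for \<sigma>
  proof -
    have tab: "inversion_table n \<sigma> j < j" if "j \<in> {1..n}" for j
      using bij_betwE[OF inversion_table_bij[of n]] s that by (auto dest!: spec[of _ \<sigma>] PiE_mem)
    have "T \<subseteq> cut_points n \<sigma> \<longleftrightarrow> (\<forall>t\<in>T. \<forall>j\<in>{t<..n}. inversion_table n \<sigma> j < j - t)"
      using cut_point_iff_table[OF s] T by (auto simp: subset_iff)
    also have "\<dots> \<longleftrightarrow> (\<forall>j\<in>{1..n}. \<forall>t\<in>T. t < j \<longrightarrow> inversion_table n \<sigma> j < j - t)"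
      by fastforce
    finally show ?thesis using tab by (auto simp: less_cap_iff[OF finT])
  qed
  have "bij_betw (inversion_table n) ?A ?B"
  proof (rule bij_betw_subset[OF inversion_table_bij])
    show "?A \<subseteq> {\<sigma>. \<sigma> permutes {1..n}}" by (auto simp: perms_with_inversions_def)
    show "inversion_table n ` ?A = ?B"
    proof
      show "inversion_table n ` ?A \<subseteq> ?B"
        using inversion_table_bij[of n] iff
        by (auto simp: perms_with_inversions_def card_inversions PiE_iff bij_betw_def
            inversion_table_def extensional_def)
      show "?B \<subseteq> inversion_table n ` ?A"
      proof
        fix x assume x: "x \<in> ?B"
        then have "x \<in> PiE {1..n} (\<lambda>j. {..<j})" by (auto simp: PiE_iff less_cap_iff[OF finT])
        then have "x \<in> inversion_table n ` {\<sigma>. \<sigma> permutes {1..n}}"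
          using inversion_table_bij[of n] by (simp add: bij_betw_def)
        then obtain \<sigma> where "\<sigma> permutes {1..n}" "inversion_table n \<sigma> = x" by blast
        then show "x \<in> inversion_table n ` ?A"
          using x iff[of \<sigma>] by (auto simp: perms_with_inversions_def card_inversions PiE_iff)
      qed
    qed
  qed
  then show ?thesis unfolding cap_count_def by (rule bij_betw_same_card)
qed

section \<open>Weak compositions with capped parts\<close>

text \<open>Stated for arbitrary sets of admissible values, since capped parts \<open>{..<c}\<close>
  and free parts \<open>UNIV\<close> occur in the same composition.\<close>

definition sol_count :: "('a \<Rightarrow> nat set) \<Rightarrow> 'a set \<Rightarrow> nat \<Rightarrow> nat" where
  "sol_count F A m = card {x \<in> PiE A F. sum x A = m}"

lemma finite_solutions:
  assumes "finite A"
  shows "finite {x \<in> PiE A F. sum x A = (m :: nat)}"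
proof (rule finite_subset)
  show "{x \<in> PiE A F. sum x A = m} \<subseteq> PiE A (\<lambda>_. {..m})"
  proof
    fix x assume x: "x \<in> {x \<in> PiE A F. sum x A = m}"
    then have "x i \<le> m" if "i \<in> A" for i
      using member_le_sum[of i A x] that assms by auto
    then show "x \<in> PiE A (\<lambda>_. {..m})" using x by (auto simp: PiE_iff)
  qed
  show "finite (PiE A (\<lambda>_. {..m}))" using assms by (intro finite_PiE) auto
qed

lemma sol_count_empty: "sol_count F {} m = (if m = 0 then 1 else 0)"
proof -
  have "{x \<in> PiE {} F. sum x {} = m} = (if m = 0 then {\<lambda>_. undefined} else {})" by auto
  then show ?thesis by (simp add: sol_count_def)
qed

lemma sol_count_insert:
  assumes "finite A" "i \<notin> A"
  shows "sol_count F (insert i A) m = (\<Sum>v\<in>F i \<inter> {..m}. sol_count F A (m - v))"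
proof -
  let ?S = "\<lambda>v. {x \<in> PiE A F. sum x A = m - v}"
  have "{x \<in> PiE (insert i A) F. sum x (insert i A) = m} =
      (\<lambda>(v, x). x(i := v)) ` (SIGMA v:F i \<inter> {..m}. ?S v)"
  proof (intro equalityI subsetI)
    fix x assume x: "x \<in> {x \<in> PiE (insert i A) F. sum x (insert i A) = m}"
    define y where "y = x(i := undefined)"
    have y: "y \<in> PiE A F" using x assms(2) by (auto simp: y_def PiE_iff extensional_def)
    have s: "sum y A = sum x A" using assms(2) by (intro sum.cong) (auto simp: y_def)
    have "x i + sum x A = m" using x assms by simp
    then have "(x i, y) \<in> (SIGMA v:F i \<inter> {..m}. ?S v)" using x y s by auto
    moreover have "x = (\<lambda>(v, x). x(i := v)) (x i, y)" by (auto simp: y_def)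
    ultimately show "x \<in> (\<lambda>(v, x). x(i := v)) ` (SIGMA v:F i \<inter> {..m}. ?S v)" by blast
  next
    fix z assume "z \<in> (\<lambda>(v, x). x(i := v)) ` (SIGMA v:F i \<inter> {..m}. ?S v)"
    then obtain v x where v: "v \<in> F i" "v \<le> m" and x: "x \<in> PiE A F" "sum x A = m - v"
      and z: "z = x(i := v)" by auto
    have "sum z A = sum x A" using assms(2) unfolding z by (intro sum.cong) auto
    then have "sum z (insert i A) = m" using assms v x z by simp
    moreover have "z \<in> PiE (insert i A) F" using v x unfolding z by (simp add: PiE_fun_upd)
    ultimately show "z \<in> {x \<in> PiE (insert i A) F. sum x (insert i A) = m}" by simp
  qed
  moreover have "inj_on (\<lambda>(v, x). x(i := v)) (SIGMA v:F i \<inter> {..m}. ?S v)"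
  proof (rule inj_onI, clarify)
    fix v v' x x'
    assume x: "x \<in> PiE A F" "x' \<in> PiE A F" and e: "x(i := v) = x'(i := v')"
    have "x j = x' j" for j
    proof (cases "j = i")
      case True
      then show ?thesis using PiE_arb[OF x(1) assms(2)] PiE_arb[OF x(2) assms(2)] by simp
    next
      case False
      then show ?thesis using fun_cong[OF e, of j] by simp
    qed
    then have "x = x'" by (rule ext)
    then show "v = v' \<and> x = x'" using fun_cong[OF e, of i] by simp
  qed
  ultimately have "sol_count F (insert i A) m = card (SIGMA v:F i \<inter> {..m}. ?S v)"
    unfolding sol_count_def by (simp add: card_image)
  also have "\<dots> = (\<Sum>v\<in>F i \<inter> {..m}. card (?S v))"
    by (rule card_SigmaI) (auto intro: finite_solutions[OF assms(1)])
  finally show ?thesis unfolding sol_count_def .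
qed

lemma sol_count_cong:
  assumes "\<And>i. i \<in> A \<Longrightarrow> F i = G i"
  shows "sol_count F A m = sol_count G A m"
proof -
  have "PiE A F = PiE A G" using assms by (rule PiE_cong)
  then show ?thesis unfolding sol_count_def by simp
qed

lemma sol_count_UNIV:
  assumes "finite A"
  shows "sol_count (\<lambda>_. UNIV) A m = (card A + m - 1) choose m"
  using assms
proof (induction A arbitrary: m rule: finite_induct)
  case empty
  then show ?case by (cases m) (auto simp: sol_count_empty)
next
  case (insert i A)
  have "sol_count (\<lambda>_. UNIV) (insert i A) m = (\<Sum>v\<le>m. (card A + (m - v) - 1) choose (m - v))"
    using insert by (simp add: sol_count_insert)
  also have "\<dots> = (\<Sum>v\<le>m. (card A + v - 1) choose v)"
    by (rule sum.reindex_bij_witness[of _ "\<lambda>v. m - v" "\<lambda>v. m - v"]) auto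
  also have "\<dots> = (card A + m) choose m"
  \<comment> \<open>With a single part in \<open>insert i A\<close>, truncated subtraction gives (v
    - 1) choose v, which is 1 for v = 0 and 0 otherwise, as required.\<close>
  proof (cases "card A = 0")
    case True
    have "(\<Sum>v\<le>m. (card A + v - 1) choose v) = (\<Sum>v\<in>{0}. (card A + v - 1) choose v)"
      by (rule sum.mono_neutral_right) (auto simp: True binomial_eq_0)
    then show ?thesis using True by simp
  next
    case False
    then obtain r where r: "card A = Suc r" by (cases "card A") auto
    have "(\<Sum>v\<le>m. (card A + v - 1) choose v) = (\<Sum>v\<le>m. (r + v) choose v)" by (simp add: r)
    also have "\<dots> = Suc (r + m) choose m" by (rule sum_choose_lower)
    finally show ?thesis by (simp add: r)
  qed
  finally show ?case using insert by simp
qed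

section \<open>Ratios of composition counts compared with geometric parts\<close>

definition weak_comps :: "nat \<Rightarrow> nat \<Rightarrow> real" where
  "weak_comps N s = real ((N + s - 1) choose s)"

lemma weak_comps_Suc_sum:
  assumes "N \<ge> 1"
  shows "weak_comps N (Suc s) * real (Suc s) = weak_comps N s * real (N + s)"
proof -
  obtain r where r: "N = Suc r" using assms by (cases N) auto
  have "(Suc (r + s) choose Suc s) * Suc s = Suc (r + s) * (r + s choose s)"
    by (metis Suc_times_binomial mult.commute)
  then have "real (Suc (r + s) choose Suc s) * real (Suc s) = real (r + s choose s) * real (Suc (r + s))"
    by (metis mult.commute of_nat_mult)
  then show ?thesis by (simp add: weak_comps_def r)
qed

lemma weak_comps_Suc_parts:
  assumes "N \<ge> 1"
  shows "weak_comps (Suc N) s * real N = weak_comps N s * real (N + s)"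
proof -
  obtain r where r: "N = Suc r" using assms by (cases N) auto
  have "Suc r * (Suc (r + s) choose Suc r) = Suc (r + s) * (r + s choose r)"
    by (rule Suc_times_binomial)
  moreover have "Suc (r + s) choose Suc r = Suc (r + s) choose s" "r + s choose r = r + s choose s"
    using binomial_symmetric[of "Suc r" "Suc (r + s)"] binomial_symmetric[of r "r + s"] by auto
  ultimately have "real (Suc r) * real (Suc (r + s) choose s) = real (Suc (r + s)) * real (r + s choose s)"
    by (metis of_nat_mult)
  then show ?thesis by (simp add: weak_comps_def r algebra_simps)
qed

lemma weak_comps_pos: "N \<ge> 1 \<Longrightarrow> weak_comps N s > 0"
  by (auto simp: weak_comps_def)

text \<open>Fixing \<open>r\<close> parts of total size \<open>s\<close> in a uniform weak composition of \<open>m\<close> into \<open>n\<close> parts costs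
  about as much as for independent geometric parts of success probability \<open>n / (n + m)\<close>.\<close>
lemma weak_comps_ratio_upper:
  fixes n m Q :: nat
  assumes "r + s \<le> Q" "Q < n" "Q \<le> m"
  shows "weak_comps (n - r) (m - s) \<le>
    weak_comps n m * (n / (n + m - Q)) ^ r * (m / (n + m - Q)) ^ s"
  using assms(1)
proof (induction r)
  case 0
  then show ?case
  proof (induction s)
    case 0 then show ?case by simp
  next
    case (Suc s)
    define M where "M = m - Suc s"
    have M: "m - s = Suc M" "Suc M \<le> m" using Suc.prems assms by (auto simp: M_def)
    have "weak_comps n M * real (n + M) = weak_comps n (Suc M) * real (Suc M)"
      using weak_comps_Suc_sum[of n M] assms by simp
    then have "weak_comps n M = weak_comps n (Suc M) * (real (Suc M) / real (n + M))"
      using assms by (simp add: field_simps)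
    \<comment> \<open>Lowering the sum by one costs (M + 1) / (n + M). Here M + 1 is at most m, and
      at most Q units have been removed in total, so the denominator is at least n + m - Q.\<close>
    also have "\<dots> \<le> weak_comps n (Suc M) * (m / (n + m - Q))"
      using weak_comps_pos[of n "Suc M"] assms M Suc.prems
      by (intro mult_left_mono frac_le) (auto simp: M_def)
    also have "\<dots> \<le> (weak_comps n m * (m / (n + m - Q)) ^ s) * (m / (n + m - Q))"
      using Suc M assms by (intro mult_right_mono) auto
    finally show ?case using M_def by (simp add: mult_ac)
  qed
next
  case (Suc r)
  define N where "N = n - Suc r"
  have N: "n - r = Suc N" "Suc N \<le> n" "N \<ge> 1" using Suc.prems assms by (auto simp: N_def)
  have "weak_comps N (m - s) * real (N + (m - s)) = weak_comps (Suc N) (m - s) * real N"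
    using weak_comps_Suc_parts[of N "m - s"] N by simp
  then have "weak_comps N (m - s) = weak_comps (Suc N) (m - s) * (real N / real (N + (m - s)))"
    using N by (simp add: field_simps)
  also have "\<dots> \<le> weak_comps (Suc N) (m - s) * (n / (n + m - Q))"
    using weak_comps_pos[of "Suc N" "m - s"] assms N Suc.prems
    by (intro mult_left_mono frac_le) (auto simp: N_def)
  also have "\<dots> \<le> (weak_comps n m * (n / (n + m - Q)) ^ r * (m / (n + m - Q)) ^ s) * (n / (n + m - Q))"
    using Suc N assms by (intro mult_right_mono) auto
  finally show ?case using N_def by (simp add: mult_ac)
qed

lemma weak_comps_ratio_lower:
  fixes n m Q :: nat
  assumes "r + s \<le> Q" "Q < n" "Q \<le> m"
  shows "weak_comps (n - r) (m - s) \<ge>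
    weak_comps n m * ((n - Q) / (n + m)) ^ r * ((m - Q) / (n + m)) ^ s"
  using assms(1)
proof (induction r)
  case 0
  then show ?case
  proof (induction s)
    case 0 then show ?case by simp
  next
    case (Suc s)
    define M where "M = m - Suc s"
    have M: "m - s = Suc M" "Suc M \<le> m" using Suc.prems assms by (auto simp: M_def)
    have "weak_comps n M * real (n + M) = weak_comps n (Suc M) * real (Suc M)"
      using weak_comps_Suc_sum[of n M] assms by simp
    then have e: "weak_comps n M = weak_comps n (Suc M) * (real (Suc M) / real (n + M))"
      using assms by (simp add: field_simps)
    have "(weak_comps n m * ((m - Q) / (n + m)) ^ s) * ((m - Q) / (n + m))
        \<le> weak_comps n (Suc M) * ((m - Q) / (n + m))"
      using Suc M assms by (intro mult_right_mono) auto
    also have "\<dots> \<le> weak_comps n (Suc M) * (real (Suc M) / real (n + M))"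
      using weak_comps_pos[of n "Suc M"] assms M Suc.prems
      by (intro mult_left_mono frac_le) (auto simp: M_def)
    finally show ?case using M_def e by (simp add: mult_ac)
  qed
next
  case (Suc r)
  define N where "N = n - Suc r"
  have N: "n - r = Suc N" "Suc N \<le> n" "N \<ge> 1" using Suc.prems assms by (auto simp: N_def)
  have "weak_comps N (m - s) * real (N + (m - s)) = weak_comps (Suc N) (m - s) * real N"
    using weak_comps_Suc_parts[of N "m - s"] N by simp
  then have e: "weak_comps N (m - s) = weak_comps (Suc N) (m - s) * (real N / real (N + (m - s)))"
    using N by (simp add: field_simps)
  have "(weak_comps n m * ((n - Q) / (n + m)) ^ r * ((m - Q) / (n + m)) ^ s) * ((n - Q) / (n + m))
      \<le> weak_comps (Suc N) (m - s) * ((n - Q) / (n + m))"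
    using Suc N assms by (intro mult_right_mono) auto
  also have "\<dots> \<le> weak_comps (Suc N) (m - s) * (real N / real (N + (m - s)))"
    using weak_comps_pos[of "Suc N" "m - s"] assms N Suc.prems
    by (intro mult_left_mono frac_le) (auto simp: N_def)
  finally show ?case using N_def e by (simp add: mult_ac)
qed

section \<open>Removing the capped parts one at a time\<close>

lemma geometric_cap_sum:
  fixes q :: real
  assumes "q \<noteq> 1"
  shows "(\<Sum>v<c. (1 - q) * q ^ v) = 1 - q ^ c"
proof -
  have "(\<Sum>v<c. (1 - q) * q ^ v) = (1 - q) * (\<Sum>v<c. q ^ v)" by (simp only: sum_distrib_left)
  also have "\<dots> = 1 - q ^ c" using assms by (simp add: sum_gp_strict)
  finally show ?thesis .
qed

text \<open>A capped part of size v moves (r, s) to (r + 1, s + v) and contributes p q^v; summing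
  over v < c gives 1 - q^c. The approximation is made only once, by \<open>base\<close> after all
  capped parts are gone, so the error contained in H does not accumulate along the
  induction.\<close>

lemma sol_count_caps_upper:
  fixes p q D H :: real
  assumes fin: "finite I" "finite J" and disj: "I \<inter> J = {}"
    and F: "\<And>i. i \<in> I \<Longrightarrow> F i = {..<c i}" "\<And>j. j \<in> J \<Longrightarrow> F j = UNIV"
    and base: "\<And>r s. \<lbrakk>r \<le> R; s \<le> S\<rbrakk> \<Longrightarrow> weak_comps (n - r) (m - s) \<le> H * p ^ r * q ^ s"
    and pq: "p = 1 - q" "q \<noteq> 1" and "S \<le> m"
    and "card J + card I + r = n" "r + card I \<le> R" "s + sum c I \<le> S"
  shows "real (sol_count F (I \<union> J) (m - s)) \<le> H * p ^ r * q ^ s * (\<Prod>i\<in>I. 1 - q ^ c i)"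
  using fin(1) disj F(1) assms(10-)
proof (induction I arbitrary: r s rule: finite_induct)
  case empty
  have "sol_count F J (m - s) = sol_count (\<lambda>_. UNIV) J (m - s)"
    by (rule sol_count_cong) (use F(2) in auto)
  moreover have "card J = n - r" using empty by simp
  ultimately show ?case using base[of r s] empty sol_count_UNIV[OF fin(2), of "m - s"]
    by (simp add: weak_comps_def)
next
  case (insert i I)
  have fi: "F i = {..<c i}" using insert by auto
  have cS: "s + c i \<le> m" using insert assms(9) by simp
  have "sol_count F (insert i (I \<union> J)) (m - s) = (\<Sum>v\<in>F i \<inter> {..m - s}. sol_count F (I \<union> J) (m - s - v))"
    using insert fin(2) by (intro sol_count_insert) auto
  \<comment> \<open>The total never runs out: s + c i \<le> S \<le> m, so the cap alone restricts v
    and the full geometric sum appears.\<close>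
  also have "F i \<inter> {..m - s} = {..<c i}" unfolding fi using cS by (intro Int_absorb2 subsetI) simp
  finally have "real (sol_count F (insert i I \<union> J) (m - s)) = (\<Sum>v<c i. real (sol_count F (I \<union> J) (m - (s + v))))"
    by (simp add: diff_diff_left)
  also have "\<dots> \<le> (\<Sum>v<c i. H * p ^ Suc r * q ^ (s + v) * (\<Prod>i\<in>I. 1 - q ^ c i))"
  proof (intro sum_mono insert.IH)
    fix v assume v: "v \<in> {..<c i}"
    show "I \<inter> J = {}" "\<And>k. k \<in> I \<Longrightarrow> F k = {..<c k}" using insert.prems by auto
    show "card J + card I + Suc r = n" "Suc r + card I \<le> R" "s + v + sum c I \<le> S"
      using insert.prems insert.hyps v by auto
  qed
  also have "\<dots> = (\<Sum>v<c i. (1 - q) * q ^ v) * (H * p ^ r * q ^ s * (\<Prod>i\<in>I. 1 - q ^ c i))"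
    unfolding sum_distrib_right pq(1) by (intro sum.cong) (auto simp: power_add)
  also have "\<dots> = H * p ^ r * q ^ s * (\<Prod>i\<in>insert i I. 1 - q ^ c i)"
    using insert unfolding geometric_cap_sum[OF pq(2)] by simp
  finally show ?case .
qed

lemma sol_count_caps_lower:
  fixes p q D H :: real
  assumes fin: "finite I" "finite J" and disj: "I \<inter> J = {}"
    and F: "\<And>i. i \<in> I \<Longrightarrow> F i = {..<c i}" "\<And>j. j \<in> J \<Longrightarrow> F j = UNIV"
    and base: "\<And>r s. \<lbrakk>r \<le> R; s \<le> S\<rbrakk> \<Longrightarrow> H * p ^ r * q ^ s \<le> weak_comps (n - r) (m - s)"
    and pq: "p = 1 - q" "q \<noteq> 1" and "S \<le> m"
    and "card J + card I + r = n" "r + card I \<le> R" "s + sum c I \<le> S"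
  shows "H * p ^ r * q ^ s * (\<Prod>i\<in>I. 1 - q ^ c i) \<le> real (sol_count F (I \<union> J) (m - s))"
  using fin(1) disj F(1) assms(10-)
proof (induction I arbitrary: r s rule: finite_induct)
  case empty
  have "sol_count F J (m - s) = sol_count (\<lambda>_. UNIV) J (m - s)"
    by (rule sol_count_cong) (use F(2) in auto)
  moreover have "card J = n - r" using empty by simp
  ultimately show ?case using base[of r s] empty sol_count_UNIV[OF fin(2), of "m - s"]
    by (simp add: weak_comps_def)
next
  case (insert i I)
  have fi: "F i = {..<c i}" using insert by auto
  have cS: "s + c i \<le> m" using insert assms(9) by simp
  have "sol_count F (insert i (I \<union> J)) (m - s) = (\<Sum>v\<in>F i \<inter> {..m - s}. sol_count F (I \<union> J) (m - s - v))"
    using insert fin(2) by (intro sol_count_insert) auto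
  also have "F i \<inter> {..m - s} = {..<c i}" unfolding fi using cS by (intro Int_absorb2 subsetI) simp
  finally have *: "real (sol_count F (insert i I \<union> J) (m - s)) = (\<Sum>v<c i. real (sol_count F (I \<union> J) (m - (s + v))))"
    by (simp add: diff_diff_left)
  have "H * p ^ r * q ^ s * (\<Prod>i\<in>insert i I. 1 - q ^ c i) =
      (\<Sum>v<c i. (1 - q) * q ^ v) * (H * p ^ r * q ^ s * (\<Prod>i\<in>I. 1 - q ^ c i))"
    using insert unfolding geometric_cap_sum[OF pq(2)] by simp
  also have "\<dots> = (\<Sum>v<c i. H * p ^ Suc r * q ^ (s + v) * (\<Prod>i\<in>I. 1 - q ^ c i))"
    unfolding sum_distrib_right pq(1) by (intro sum.cong) (auto simp: power_add)
  also have "\<dots> \<le> (\<Sum>v<c i. real (sol_count F (I \<union> J) (m - (s + v))))"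
  proof (intro sum_mono insert.IH)
    fix v assume v: "v \<in> {..<c i}"
    show "I \<inter> J = {}" "\<And>k. k \<in> I \<Longrightarrow> F k = {..<c k}" using insert.prems by auto
    show "card J + card I + Suc r = n" "Suc r + card I \<le> R" "s + v + sum c I \<le> S"
      using insert.prems insert.hyps v by auto
  qed
  finally show ?case unfolding * .
qed


text \<open>Lowering the large part by L is injective and lands in the compositions of m - L. It
  stays inside the family because part i is free.\<close>

lemma card_large_part_le:
  assumes fin: "finite A" and i: "i \<in> A" "F i = UNIV" and L: "L \<le> m"
  shows "card {x \<in> PiE A F. sum x A = m \<and> L \<le> x i} \<le> sol_count F A (m - L)"
  unfolding sol_count_def
proof (rule card_inj_on_le)
  let ?g = "\<lambda>x. x(i := x i - L)"
  show "inj_on ?g {x \<in> PiE A F. sum x A = m \<and> L \<le> x i}"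
  proof (rule inj_onI)
    fix x y assume x: "x \<in> {x \<in> PiE A F. sum x A = m \<and> L \<le> x i}"
      and y: "y \<in> {x \<in> PiE A F. sum x A = m \<and> L \<le> x i}" and e: "?g x = ?g y"
    have "x j = y j" for j
    proof (cases "j = i")
      case True
      have "x i - L = y i - L" using fun_cong[OF e, of i] by simp
      moreover have "L \<le> x i" "L \<le> y i" using x y by auto
      ultimately have "x i = y i" by linarith
      then show ?thesis using True by simp
    next
      case False
      then show ?thesis using fun_cong[OF e, of j] by simp
    qed
    then show "x = y" by (rule ext)
  qed
  show "?g ` {x \<in> PiE A F. sum x A = m \<and> L \<le> x i} \<subseteq> {x \<in> PiE A F. sum x A = m - L}"
  proof clarify
    fix x assume x: "x \<in> PiE A F" "m = sum x A" "L \<le> x i"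
    have "sum (?g x) (A - {i}) = sum x (A - {i})" by (intro sum.cong) auto
    then have "sum (?g x) A = sum x A - L"
      using x(3) by (simp add: sum.remove[OF fin i(1)])
    moreover have "?g x \<in> PiE A F"
      using x(1) i by (auto simp: PiE_iff extensional_def)
    ultimately show "?g x \<in> PiE A F \<and> sum (?g x) A = sum x A - L" by simp
  qed
  show "finite {x \<in> PiE A F. sum x A = m - L}" by (rule finite_solutions[OF fin])
qed

text \<open>Both estimates rest on Bernoulli's inequality; the factor 2 comes from 1 / (1 - y) \<le>
  1 + 2 y for 0 \<le> y \<le> 1/2.\<close>

lemma power_one_minus_bounds:
  fixes x :: real
  assumes "0 \<le> x" "k \<le> Q" "1 \<le> Q" "real Q * x \<le> 1 / 2"
  shows "1 - real Q * x \<le> (1 - x) ^ k" "(1 / (1 - x)) ^ k \<le> 1 + 2 * (real Q * x)"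
proof -
  have "1 * x \<le> real Q * x" using assms(1,3) by (intro mult_right_mono) auto
  then have x1: "x \<le> 1 / 2" using assms(4) by linarith
  have "1 + real k * (- x) \<le> (1 + (- x)) ^ k" by (rule Bernoulli_inequality) (use x1 in auto)
  moreover have kQ: "real k * x \<le> real Q * x" using assms(1,2) by (intro mult_right_mono) auto
  ultimately show *: "1 - real Q * x \<le> (1 - x) ^ k" by simp
  let ?y = "real Q * x"
  have y: "0 \<le> ?y" using assms by simp
  have "(1 / (1 - x)) ^ k = 1 / (1 - x) ^ k" by (simp add: power_divide)
  also have "\<dots> \<le> 1 / (1 - ?y)" using * assms(4) by (intro divide_left_mono mult_pos_pos) auto
  also have "\<dots> \<le> 1 + 2 * ?y"
  proof -
    have "?y * ?y \<le> ?y * (1/2)" using assms(4) y by (intro mult_left_mono) auto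
    then have "1 \<le> (1 + 2 * ?y) * (1 - ?y)" by (simp add: algebra_simps)
    then show ?thesis using assms(4) by (simp add: divide_simps)
  qed
  finally show "(1 / (1 - x)) ^ k \<le> 1 + 2 * (real Q * x)" .
qed

context
  fixes n m Q :: nat and p q :: real
  assumes nm: "n \<le> m" and Q: "1 \<le> Q" "2 * Q\<^sup>2 \<le> n"
  defines "q \<equiv> m / (n + m)" and "p \<equiv> 1 - q"
begin

lemma param_bounds: "Q < n" "Q \<le> m" "(real Q)\<^sup>2 / n \<le> 1 / 2" "n > 0"
proof -
  have "Q * 1 \<le> Q * Q" using Q by (intro mult_left_mono) auto
  then show "Q < n" using Q unfolding power2_eq_square by linarith
  then show "n > 0" "Q \<le> m" using nm by auto
  have "real (2 * Q\<^sup>2) \<le> real n" using Q(2) by (simp only: of_nat_le_iff)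
  then show "(real Q)\<^sup>2 / n \<le> 1 / 2" using \<open>n > 0\<close> by (simp add: field_simps)
qed

lemma success_prob_eq: "p = n / (n + m)"
  using param_bounds unfolding p_def q_def by (simp add: field_simps)

lemma success_prob_range: "0 \<le> p" "0 \<le> q" "q < 1"
  using param_bounds unfolding success_prob_eq unfolding q_def by (auto simp: field_simps)

text \<open>The exact ratios differ from p and q by factors of the form 1 - O(Q / n), and r + s
  \<le> Q of them change the product by O(Q^2 / n). For the lower bound, (m - Q) / (n + m) \<ge> q
  (1 - Q / n) uses n \<le> m.\<close>

lemma weak_comps_ratio_geometric:
  assumes "r + s \<le> Q"
  shows "weak_comps (n - r) (m - s) \<le> (1 + 2 * ((real Q)\<^sup>2 / n)) * weak_comps n m * p ^ r * q ^ s"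
    and "(1 - (real Q)\<^sup>2 / n) * weak_comps n m * p ^ r * q ^ s \<le> weak_comps (n - r) (m - s)"
proof -
  have W: "weak_comps n m \<ge> 0" using weak_comps_pos[of n m] param_bounds by simp
  have Qn: "real Q * (Q / n) = (real Q)\<^sup>2 / n" by (simp add: power2_eq_square)
  have x: "0 \<le> real Q / (n + m)" "real Q * (Q / (n + m)) \<le> 1 / 2"
       "real Q * (Q / (n + m)) \<le> (real Q)\<^sup>2 / n"
  proof -
    show "real Q * (Q / (n + m)) \<le> (real Q)\<^sup>2 / n"
      using param_bounds by (auto simp: power2_eq_square intro!: divide_left_mono mult_pos_pos)
    then show "real Q * (Q / (n + m)) \<le> 1 / 2" using param_bounds by linarith
  qed simp
  let ?K = "1 / (1 - real Q / (n + m))"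
  have K: "n / real (n + m - Q) = p * ?K" "m / real (n + m - Q) = q * ?K"
  proof -
    have "1 - real Q / (n + m) = real (n + m - Q) / real (n + m)"
      using param_bounds by (simp add: field_simps of_nat_diff)
    then have "?K = real (n + m) / real (n + m - Q)" by simp
    then show "n / real (n + m - Q) = p * ?K" "m / real (n + m - Q) = q * ?K"
      using param_bounds unfolding success_prob_eq unfolding q_def by simp_all
  qed
  have "weak_comps (n - r) (m - s) \<le> weak_comps n m * (p * ?K) ^ r * (q * ?K) ^ s"
    using weak_comps_ratio_upper[OF assms param_bounds(1,2)] unfolding K .
  also have "\<dots> = (weak_comps n m * p ^ r * q ^ s) * ?K ^ (r + s)"
    by (simp only: power_mult_distrib power_add mult_ac)
  also have "\<dots> \<le> (weak_comps n m * p ^ r * q ^ s) * (1 + 2 * ((real Q)\<^sup>2 / n))"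
  proof (rule mult_left_mono)
    have "?K ^ (r + s) \<le> 1 + 2 * (real Q * (Q / (n + m)))"
      by (rule power_one_minus_bounds(2)[OF x(1) assms Q(1) x(2)])
    then show "?K ^ (r + s) \<le> 1 + 2 * ((real Q)\<^sup>2 / n)" using x(3) by linarith
    show "0 \<le> weak_comps n m * p ^ r * q ^ s" using W success_prob_range by simp
  qed
  finally show "weak_comps (n - r) (m - s) \<le> (1 + 2 * ((real Q)\<^sup>2 / n)) * weak_comps n m * p ^ r * q ^ s"
    by (simp only: mult_ac)
  let ?k = "1 - real Q / n"
  have k: "real (n - Q) / real (n + m) = p * ?k" "q * ?k \<le> real (m - Q) / real (n + m)" "0 \<le> ?k"
  proof -
    show "real (n - Q) / real (n + m) = p * ?k"
    proof -
      have "1 - real Q / n = real (n - Q) / n" using param_bounds by (simp add: field_simps of_nat_diff)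
      then show ?thesis using param_bounds unfolding success_prob_eq by simp
    qed
    show "0 \<le> ?k" using param_bounds by simp
    have "real m * (1 - real Q / n) \<le> real m - Q"
    proof -
      have "real n * Q \<le> real m * Q" using nm by (intro mult_right_mono) auto
      then show ?thesis using param_bounds by (simp add: field_simps)
    qed
    then show "q * ?k \<le> real (m - Q) / real (n + m)"
      using param_bounds unfolding q_def by (simp add: divide_right_mono of_nat_diff)
  qed
  have "(1 - (real Q)\<^sup>2 / n) * (weak_comps n m * p ^ r * q ^ s) \<le> ?k ^ (r + s) * (weak_comps n m * p ^ r * q ^ s)"
    using power_one_minus_bounds(1)[of "real Q / n" "r + s" Q] assms Q param_bounds Qn W success_prob_range
    by (intro mult_right_mono) auto
  also have "\<dots> = weak_comps n m * (p * ?k) ^ r * (q * ?k) ^ s"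
    by (simp only: power_mult_distrib power_add mult_ac)
  also have "\<dots> \<le> weak_comps n m * (real (n - Q) / real (n + m)) ^ r * (real (m - Q) / real (n + m)) ^ s"
    unfolding k(1) using k W success_prob_range by (intro mult_left_mono power_mono mult_nonneg_nonneg) auto
  also have "\<dots> \<le> weak_comps (n - r) (m - s)"
    by (rule weak_comps_ratio_lower[OF assms param_bounds(1,2)])
  finally show "(1 - (real Q)\<^sup>2 / n) * weak_comps n m * p ^ r * q ^ s \<le> weak_comps (n - r) (m - s)"
    by (simp only: mult_ac)
qed

text \<open>Caps above \<open>L\<close> are dropped: a part reaches \<open>L\<close> with probability about \<open>q ^ L\<close>.\<close>
lemma capped_solutions_bounds:
  fixes c :: "nat \<Rightarrow> nat" and L :: nat
  assumes I: "I = {j \<in> {1..n}. c j \<le> L}" and cI: "card I * Suc L + L \<le> Q"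
  defines "P \<equiv> \<Prod>i\<in>I. 1 - q ^ c i"
  shows "real (sol_count (\<lambda>j. {..<c j}) {1..n} m) \<le> (1 + 2 * ((real Q)\<^sup>2 / n)) * weak_comps n m * P"
    and "(1 - ((real Q)\<^sup>2 / n + 2 * n * q ^ L)) * weak_comps n m * P \<le> real (sol_count (\<lambda>j. {..<c j}) {1..n} m)"
proof -
  define J where "J = {1..n} - I"
  define F where "F i = (if i \<in> I then {..<c i} else UNIV)" for i
  \<comment> \<open>The extra L in the budget pays for the second use of the estimate, with m - L in
    place of m.\<close>
  define S where "S = L * card I + L"
  have IJ: "I \<union> J = {1..n}" "I \<inter> J = {}" and fin: "finite I" "finite J"
    unfolding J_def I by auto
  have F: "F i = {..<c i}" if "i \<in> I" for i using that by (simp add: F_def)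
  have FJ: "F j = UNIV" if "j \<in> J" for j using that IJ by (auto simp: F_def)
  have RS: "r + s \<le> Q" if "r \<le> card I" "s \<le> S" for r s
    using that cI unfolding S_def by (simp add: algebra_simps)
  have SQ: "S \<le> m" using RS[of 0 S] param_bounds by simp
  have "card J + card I = card (I \<union> J)" using card_Un_disjoint[OF fin IJ(2)] by simp
  then have cJ: "card J + card I + 0 = n" using IJ(1) by simp
  have "sum c I \<le> card I * L" using sum_bounded_above[of I c L] by (auto simp: I)
  then have cS: "0 + sum c I \<le> S" "L + sum c I \<le> S" unfolding S_def by (auto simp: mult.commute)
  have q1: "q \<noteq> 1" using success_prob_range by simp
  have W: "weak_comps n m \<ge> 0" using weak_comps_pos[of n m] param_bounds by simp
  have q_le: "q ^ k \<le> 1" for k using success_prob_range by (simp add: power_le_one)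
  have P: "0 \<le> P" unfolding P_def using q_le by (intro prod_nonneg) simp
  note up = sol_count_caps_upper[OF fin IJ(2) F FJ weak_comps_ratio_geometric(1)[OF RS] p_def[THEN meta_eq_to_obj_eq] q1 SQ cJ, simplified]
  note lo = sol_count_caps_lower[OF fin IJ(2) F FJ weak_comps_ratio_geometric(2)[OF RS] p_def[THEN meta_eq_to_obj_eq] q1 SQ cJ, simplified]
  let ?C = "{x \<in> PiE {1..n} (\<lambda>j. {..<c j}). sum x {1..n} = m}"
  let ?U = "{x \<in> PiE {1..n} F. sum x {1..n} = m}"
  have fU: "finite ?U" by (rule finite_solutions) simp
  have u0: "real (sol_count F {1..n} m) \<le> (1 + 2 * ((real Q)\<^sup>2 / n)) * weak_comps n m * P"
    using up[where s = 0] cS(1) IJ(1) unfolding P_def by simp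
  have l0: "(1 - (real Q)\<^sup>2 / n) * weak_comps n m * P \<le> real (sol_count F {1..n} m)"
    using lo[where s = 0] cS(1) IJ(1) unfolding P_def by simp
  have uL: "real (sol_count F {1..n} (m - L)) \<le> (1 + 2 * ((real Q)\<^sup>2 / n)) * weak_comps n m * q ^ L * P"
    using up[where s = L] cS(2) IJ(1) unfolding P_def by simp
  have sub: "?C \<subseteq> ?U" by (auto simp: PiE_iff F_def)
  then have "sol_count (\<lambda>j. {..<c j}) {1..n} m \<le> sol_count F {1..n} m"
    unfolding sol_count_def by (intro card_mono fU)
  then show "real (sol_count (\<lambda>j. {..<c j}) {1..n} m) \<le> (1 + 2 * ((real Q)\<^sup>2 / n)) * weak_comps n m * P"
    using u0 by linarith
  let ?V = "\<lambda>i. {x \<in> PiE {1..n} F. sum x {1..n} = m \<and> L \<le> x i}"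
  have finV: "finite (?V i)" for i by (rule finite_subset[OF _ fU]) auto
  \<comment> \<open>A composition that respects the enforced caps but not all caps violates a
    dropped one; dropped caps exceed L, so this part is free and at least L.\<close>
  have "?U \<subseteq> ?C \<union> (\<Union>i\<in>J. ?V i)"
  proof
    fix x assume x: "x \<in> ?U"
    show "x \<in> ?C \<union> (\<Union>i\<in>J. ?V i)"
    proof (cases "\<exists>i\<in>J. L \<le> x i")
      case True then show ?thesis using x by blast
    next
      case False
      have "x i < c i" if i: "i \<in> {1..n}" for i
      proof (cases "i \<in> I")
        case True
        have "x i \<in> F i" using x i by (auto simp: PiE_iff)
        then show ?thesis using F[OF True] by simp
      next
        case F: False
        then have "L < c i" using i unfolding I by auto
        moreover have "x i < L" using False F i unfolding J_def by (meson DiffI not_le)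
        ultimately show ?thesis by simp
      qed
      then show ?thesis using x by (auto simp: PiE_iff)
    qed
  qed
  then have "card ?U \<le> card (?C \<union> (\<Union>i\<in>J. ?V i))"
    by (rule card_mono[OF finite_UnI[OF finite_subset[OF sub fU] finite_UN_I[OF fin(2) finV]]])
  also have "\<dots> \<le> card ?C + card (\<Union>i\<in>J. ?V i)" by (rule card_Un_le)
  also have "card (\<Union>i\<in>J. ?V i) \<le> (\<Sum>i\<in>J. card (?V i))" by (rule card_UN_le[OF fin(2)])
  also have "\<dots> \<le> (\<Sum>i\<in>J. sol_count F {1..n} (m - L))"
    using FJ IJ cS(2) SQ by (intro sum_mono card_large_part_le) auto
  also have "\<dots> \<le> n * sol_count F {1..n} (m - L)" using cJ by simp
  finally have "sol_count F {1..n} m \<le> sol_count (\<lambda>j. {..<c j}) {1..n} m + n * sol_count F {1..n} (m - L)"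
    unfolding sol_count_def by simp
  then have "real (sol_count F {1..n} m) \<le> real (sol_count (\<lambda>j. {..<c j}) {1..n} m + n * sol_count F {1..n} (m - L))"
    by (simp only: of_nat_le_iff)
  then have "real (sol_count F {1..n} m) \<le> real (sol_count (\<lambda>j. {..<c j}) {1..n} m) + n * real (sol_count F {1..n} (m - L))"
    by simp
  also have "\<dots> \<le> real (sol_count (\<lambda>j. {..<c j}) {1..n} m) + n * (2 * weak_comps n m * q ^ L * P)"
  proof (intro add_left_mono mult_left_mono)
    have "(1 + 2 * ((real Q)\<^sup>2 / n)) * (weak_comps n m * q ^ L * P) \<le> 2 * (weak_comps n m * q ^ L * P)"
      using param_bounds W P success_prob_range by (intro mult_right_mono) auto
    then show "real (sol_count F {1..n} (m - L)) \<le> 2 * weak_comps n m * q ^ L * P"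
      using uL by (simp only: mult.assoc)
  qed simp
  finally show "(1 - ((real Q)\<^sup>2 / n + 2 * n * q ^ L)) * weak_comps n m * P \<le> real (sol_count (\<lambda>j. {..<c j}) {1..n} m)"
    using l0 by (simp add: algebra_simps)
qed

end

section \<open>Generating function of the cut sets\<close>

unbundle no vec_syntax
unbundle fps_syntax

text \<open>The finite q-Pochhammer symbol (q; q)_g, which is the factor of a gap of length
  g.\<close>

definition qpoch :: "real \<Rightarrow> nat \<Rightarrow> real" where
  "qpoch q g = (\<Prod>i\<in>{1..g}. 1 - q ^ i)"

text \<open>The probability that independent geometric variables respect the caps, when only caps up to \<open>L\<close>
  are enforced.\<close>
definition cap_weight :: "real \<Rightarrow> nat \<Rightarrow> nat \<Rightarrow> nat set \<Rightarrow> real" where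
  "cap_weight q L n T = (\<Prod>j\<in>{1..n}. if cap T j \<le> L then 1 - q ^ cap T j else 1)"

lemma qpoch_pos: "0 \<le> q \<Longrightarrow> q < 1 \<Longrightarrow> 0 < qpoch q g"
  unfolding qpoch_def by (intro prod_pos) (auto simp: power_less_one_iff power_strict_decreasing)

lemma qpoch_Suc: "qpoch q (Suc g) = qpoch q g * (1 - q ^ Suc g)"
  by (simp add: qpoch_def prod.nat_ivl_Suc')

lemma qpoch_0 [simp]: "qpoch q 0 = 1"
  by (simp add: qpoch_def)

lemma qpoch_antimono:
  assumes "0 \<le> q" "q < 1" "g \<le> h"
  shows "qpoch q h \<le> qpoch q g"
  using assms(3)
proof (induction h rule: dec_induct)
  case (step k)
  have "qpoch q (Suc k) \<le> qpoch q k * 1"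
    unfolding qpoch_Suc using assms qpoch_pos[OF assms(1,2), of k] by (intro mult_left_mono) auto
  then show ?case using step by linarith
qed simp

text \<open>A gap longer than L keeps only its first L caps, so its factor stabilises at
  \<open>qpoch q L\<close>.\<close>

lemma qpoch_min:
  "(\<Prod>j\<in>{1..g}. if j \<le> L then 1 - q ^ j else 1) = qpoch q (min g L)"
proof (induction g)
  case (Suc g)
  have "min (Suc g) L = L \<and> min g L = L" if "\<not> Suc g \<le> L" using that by auto
  then show ?case
    using Suc by (cases "Suc g \<le> L") (auto simp: prod.nat_ivl_Suc' qpoch_Suc min_absorb1 mult.commute)
qed simp

lemma cap_insert_below:
  assumes "T \<subseteq> {1..<t}" "j \<in> {1..t}"
  shows "cap (insert t T) j = cap T j"
proof -
  have "{s \<in> insert t T. s < j} = {s \<in> T. s < j}" using assms by auto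
  then show ?thesis by (simp add: cap_def)
qed

lemma cap_insert_above:
  assumes "T \<subseteq> {1..<t}" "t < j"
  shows "cap (insert t T) j = j - t"
proof -
  have "Max (insert 0 {s \<in> insert t T. s < j}) = t"
    using assms finite_subset[OF assms(1)] by (intro Max_eqI) auto
  then show ?thesis by (simp add: cap_def)
qed

text \<open>For t beyond all of T, the caps up to t do not see the new cut and those after t are
  counted from t, so the last gap splits off as a factor.\<close>

lemma cap_weight_insert:
  assumes "T \<subseteq> {1..<t}" "t < n"
  shows "cap_weight q L n (insert t T) = cap_weight q L t T * qpoch q (min (n - t) L)"
proof -
  let ?f = "\<lambda>T j. if cap T j \<le> L then 1 - q ^ cap T j else (1::real)"
  have "{1..n} = {1..t} \<union> {t<..n}" using assms by auto
  then have "cap_weight q L n (insert t T) = prod (?f (insert t T)) {1..t} * prod (?f (insert t T)) {t<..n}"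
    unfolding cap_weight_def by (simp only:) (intro prod.union_disjoint, auto)
  also have "prod (?f (insert t T)) {1..t} = cap_weight q L t T"
    unfolding cap_weight_def by (intro prod.cong) (auto simp: cap_insert_below[OF assms(1)])
  also have "prod (?f (insert t T)) {t<..n} = (\<Prod>j\<in>{1..n - t}. if j \<le> L then 1 - q ^ j else 1)"
    by (rule prod.reindex_bij_witness[of _ "\<lambda>i. i + t" "\<lambda>j. j - t"])
      (auto simp: cap_insert_above[OF assms(1)])
  also have "\<dots> = qpoch q (min (n - t) L)" by (rule qpoch_min)
  finally show ?thesis .
qed

definition cut_sum :: "real \<Rightarrow> nat \<Rightarrow> nat \<Rightarrow> nat \<Rightarrow> real" where
  "cut_sum q L k n = (\<Sum>T | T \<subseteq> {1..<n} \<and> card T = k. cap_weight q L n T)"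

lemma cut_sum_0: "cut_sum q L 0 n = qpoch q (min n L)"
proof -
  have "{T. T \<subseteq> {1..<n} \<and> card T = 0} = {{}}" by (auto dest: finite_subset)
  then have "cut_sum q L 0 n = cap_weight q L n {}" by (simp add: cut_sum_def)
  also have "\<dots> = (\<Prod>j\<in>{1..n}. if j \<le> L then 1 - q ^ j else 1)"
    unfolding cap_weight_def by (intro prod.cong) (auto simp: cap_def)
  finally show ?thesis by (simp only: qpoch_min)
qed

text \<open>Cut sets are classified by their largest element t: removing it leaves a cut set of
  \<open>{1..<t}\<close> and a last gap of length n - t. The recursion is a convolution, hence the
  formal power series below.\<close>

lemma cut_sum_Suc:
  "cut_sum q L (Suc k) n = (\<Sum>t\<in>{1..<n}. cut_sum q L k t * qpoch q (min (n - t) L))"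
proof -
  let ?S = "\<lambda>(n::nat) k. {T. T \<subseteq> {1..<n} \<and> card T = k}"
  have fin: "finite (?S n k)" for n k by (rule finite_subset[of _ "Pow {1..<n}"]) auto
  have "(\<Sum>t\<in>{1..<n}. cut_sum q L k t * qpoch q (min (n - t) L)) =
      (\<Sum>t\<in>{1..<n}. \<Sum>T\<in>?S t k. cap_weight q L n (insert t T))"
    unfolding cut_sum_def sum_distrib_right by (intro sum.cong refl) (simp add: cap_weight_insert)
  also have "\<dots> = (\<Sum>(t, T)\<in>(SIGMA t:{1..<n}. ?S t k). cap_weight q L n (insert t T))"
    by (rule sum.Sigma) (use fin in auto)
  also have "\<dots> = (\<Sum>T\<in>?S n (Suc k). cap_weight q L n T)"
  proof (rule sum.reindex_bij_witness[of _ "\<lambda>T. (Max T, T - {Max T})" "\<lambda>(t, T). insert t T"])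
    fix a assume a: "a \<in> (SIGMA t:{1..<n}. ?S t k)"
    obtain t T where tT: "a = (t, T)" by force
    have t: "t \<in> {1..<n}" "T \<subseteq> {1..<t}" "card T = k" using a tT by auto
    have fT: "finite T" by (rule finite_subset[OF t(2)]) simp
    have "t \<notin> T" using t by auto
    moreover have "Max (insert t T) = t" using t fT by (intro Max_eqI) auto
    ultimately show "(Max (case a of (t, T) \<Rightarrow> insert t T), (case a of (t, T) \<Rightarrow> insert t T) - {Max (case a of (t, T) \<Rightarrow> insert t T)}) = a"
      using tT by simp
    show "(case a of (t, T) \<Rightarrow> insert t T) \<in> ?S n (Suc k)"
      using tT t fT \<open>t \<notin> T\<close> by auto
    show "cap_weight q L n (case a of (t, T) \<Rightarrow> insert t T) = (case a of (t, T) \<Rightarrow> cap_weight q L n (insert t T))"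
      using tT by simp
  next
    fix T assume T: "T \<in> ?S n (Suc k)"
    have fT: "finite T" by (rule finite_subset[of _ "{1..<n}"]) (use T in auto)
    have ne: "T \<noteq> {}" using T by auto
    have M: "Max T \<in> T" using fT ne by (rule Max_in)
    show "(case (Max T, T - {Max T}) of (t, T) \<Rightarrow> insert t T) = T" using M by auto
    have "T - {Max T} \<subseteq> {1..<Max T}"
    proof
      fix x assume x: "x \<in> T - {Max T}"
      then have "x < Max T" using Max_ge[OF fT, of x] by force
      moreover have "x \<in> {1..<n}" using x T by blast
      ultimately show "x \<in> {1..<Max T}" by simp
    qed
    moreover have "card (T - {Max T}) = k" using T M fT by simp
    moreover have "Max T \<in> {1..<n}" using T M by auto
    ultimately show "(Max T, T - {Max T}) \<in> (SIGMA t:{1..<n}. ?S t k)" using T by auto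
  qed
  finally show ?thesis unfolding cut_sum_def by simp
qed

definition gap_fps :: "real \<Rightarrow> nat \<Rightarrow> real fps" where
  "gap_fps q L = Abs_fps (\<lambda>g. if g = 0 then 0 else qpoch q (min g L))"

text \<open>k cuts leave k + 1 gaps of total length n, whence the exponent \<open>Suc k\<close>; all
  gaps are positive, whence the zero constant coefficient of \<open>gap_fps\<close>.\<close>

lemma cut_sum_eq_fps:
  assumes "n \<ge> 1"
  shows "cut_sum q L k n = (gap_fps q L ^ Suc k) $ n"
  using assms
proof (induction k arbitrary: n)
  case 0 then show ?case by (simp add: cut_sum_0 gap_fps_def)
next
  case (Suc k)
  let ?V = "gap_fps q L"
  have V0: "(?V ^ Suc k) $ 0 = 0" by (simp add: gap_fps_def)
  have "(?V ^ Suc (Suc k)) $ n = (\<Sum>i=0..n. (?V ^ Suc k) $ i * ?V $ (n - i))"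
    by (subst power_Suc2) (rule fps_mult_nth)
  also have "\<dots> = (\<Sum>i\<in>{1..<n}. (?V ^ Suc k) $ i * ?V $ (n - i))"
  proof (rule sum.mono_neutral_right)
    show "\<forall>i\<in>{0..n} - {1..<n}. (?V ^ Suc k) $ i * ?V $ (n - i) = 0"
    proof
      fix i assume "i \<in> {0..n} - {1..<n}"
      then have "i = 0 \<or> i = n" by auto
      then show "(?V ^ Suc k) $ i * ?V $ (n - i) = 0"
        using V0 by (auto simp: gap_fps_def)
    qed
  qed auto
  also have "\<dots> = (\<Sum>i\<in>{1..<n}. cut_sum q L k i * qpoch q (min (n - i) L))"
    by (intro sum.cong refl) (simp add: Suc.IH gap_fps_def)
  finally show ?case by (simp only: cut_sum_Suc)
qed

text \<open>The series X / (1 - X). A multiple of it is what \<open>gap_fps\<close> would be if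
  every gap had the weight of a long one.\<close>

definition ones_fps :: "real fps" where
  "ones_fps = Abs_fps (\<lambda>g. if g = 0 then 0 else 1)"

lemma ones_fps_nth: "ones_fps $ g = (if g = 0 then 0 else 1)"
  by (simp add: ones_fps_def)

text \<open>The coefficients count compositions of n into j + 1 positive parts; the induction step
  is the hockey-stick identity.\<close>

lemma ones_fps_power: "(ones_fps ^ Suc j) $ n = (if n = 0 then 0 else real ((n - 1) choose j))"
proof (induction j arbitrary: n)
  case 0 then show ?case by (simp add: ones_fps_nth)
next
  case (Suc j)
  have "(ones_fps ^ Suc (Suc j)) $ n = (\<Sum>i=0..n. (ones_fps ^ Suc j) $ i * ones_fps $ (n - i))"
    by (subst power_Suc2) (rule fps_mult_nth)
  also have "\<dots> = (\<Sum>i\<in>{1..<n}. real ((i - 1) choose j))"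
    by (rule sum.mono_neutral_cong_right) (auto simp: Suc.IH ones_fps_nth simp del: power_Suc)
  also have "\<dots> = (if n = 0 then 0 else real ((n - 1) choose Suc j))"
  proof (cases n)
    case (Suc N)
    have "(\<Sum>i\<in>{1..<n}. (i - 1) choose j) = (\<Sum>i<N. i choose j)"
      unfolding Suc by (rule sum.reindex_bij_witness[of _ Suc "\<lambda>i. i - 1"]) auto
    also have "\<dots> = N choose Suc j"
    proof (cases N)
      case (Suc M)
      then show ?thesis using sum_choose_upper[of j M] by (simp add: lessThan_Suc_atMost)
    qed simp
    finally show ?thesis using Suc by (simp flip: of_nat_sum)
  qed simp
  finally show ?case .
qed

lemma ones_fps_power_le:
  assumes "i \<le> n"
  shows "(ones_fps ^ Suc j) $ i \<le> real n ^ j / fact j" "0 \<le> (ones_fps ^ Suc j) $ i"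
proof -
  have "real ((i - 1) choose j) \<le> real ((i - 1) ^ j) / fact j"
  proof -
    have "real (((i - 1) choose j) * fact j) \<le> real ((i - 1) ^ j)"
      using binomial_fact_pow[of "i - 1" j] by (simp only: of_nat_le_iff)
    then show ?thesis by (simp add: pos_le_divide_eq)
  qed
  also have "\<dots> \<le> real n ^ j / fact j"
    using assms by (auto intro!: divide_right_mono power_mono)
  finally show "(ones_fps ^ Suc j) $ i \<le> real n ^ j / fact j"
    unfolding ones_fps_power by simp
  show "0 \<le> (ones_fps ^ Suc j) $ i" unfolding ones_fps_power by simp
qed

lemma fps_power_nonneg:
  fixes W :: "real fps"
  assumes "\<And>i. 0 \<le> W $ i"
  shows "0 \<le> (W ^ r) $ i"
proof (induction r arbitrary: i)
  case (Suc r)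
  then show ?case unfolding power_Suc fps_mult_nth by (intro sum_nonneg mult_nonneg_nonneg assms) 
qed simp

text \<open>The index pairs with r + i \<le> N form a triangle inside a square.\<close>

lemma truncated_cauchy_product_le:
  fixes a b :: "nat \<Rightarrow> real"
  assumes "\<And>i. 0 \<le> a i" "\<And>i. 0 \<le> b i"
  shows "(\<Sum>k\<le>N. \<Sum>r\<le>k. a r * b (k - r)) \<le> (\<Sum>r\<le>N. a r) * (\<Sum>i\<le>N. b i)"
proof -
  have "(\<Sum>k\<le>N. \<Sum>r\<le>k. a r * b (k - r)) = (\<Sum>(r, i) \<in> {(r, i). r + i \<le> N}. a r * b i)"
    by (rule sum.triangle_reindex_eq[symmetric, unfolded])
  also have "\<dots> \<le> (\<Sum>(r, i) \<in> {..N} \<times> {..N}. a r * b i)"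
    using assms by (intro sum_mono2) auto
  also have "\<dots> = (\<Sum>r\<le>N. a r) * (\<Sum>i\<le>N. b i)"
    by (simp add: sum_product sum.cartesian_product)
  finally show ?thesis .
qed

lemma fps_power_partial_sum_le:
  fixes W :: "real fps"
  assumes "\<And>i. 0 \<le> W $ i" "\<And>N. (\<Sum>i\<le>N. W $ i) \<le> S"
  shows "(\<Sum>i\<le>N. (W ^ r) $ i) \<le> S ^ r"
proof (induction r)
  case 0
  show ?case by (simp add: fps_one_nth)
next
  case (Suc r)
  have S: "0 \<le> S" using assms(1)[of 0] assms(2)[of 0] by simp
  have "(\<Sum>i\<le>N. (W ^ Suc r) $ i) = (\<Sum>i\<le>N. \<Sum>j\<le>i. W $ j * (W ^ r) $ (i - j))"
    by (simp add: fps_mult_nth atLeast0AtMost)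
  also have "\<dots> \<le> (\<Sum>j\<le>N. W $ j) * (\<Sum>i\<le>N. (W ^ r) $ i)"
    by (intro truncated_cauchy_product_le assms(1) fps_power_nonneg)
  also have "\<dots> \<le> S * S ^ r"
    using assms Suc S fps_power_nonneg[of W, OF assms(1)] by (intro mult_mono sum_nonneg) auto
  finally show ?case by simp
qed

lemma fps_power_nth_eq_0:
  fixes W :: "real fps"
  assumes "\<And>i. i > L \<Longrightarrow> W $ i = 0"
  shows "i > r * L \<Longrightarrow> (W ^ r) $ i = 0"
proof (induction r arbitrary: i)
  case (Suc r)
  have "W $ j * (W ^ r) $ (i - j) = 0" if "j \<le> i" for j
    using assms[of j] Suc.IH[of "i - j"] Suc.prems by (cases "j > L") auto
  then show ?case unfolding power_Suc fps_mult_nth by (intro sum.neutral) auto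
qed simp

text \<open>Expanding in the number \<open>r\<close> of short gaps: the long gaps contribute the main
  term, and each short gap costs a factor \<open>S\<close>.\<close>
lemma cut_sum_bounds:
  fixes q S :: real and L k n :: nat
  assumes q: "0 \<le> q" "q < 1" and n: "n > Suc k * L" "n \<ge> 1"
  defines "a \<equiv> qpoch q L"
  assumes S: "(\<Sum>g\<in>{1..L}. qpoch q g) \<le> S"
  shows "a ^ Suc k * real ((n - 1) choose k) \<le> cut_sum q L k n"
    and "cut_sum q L k n \<le> a * ((real n * a) ^ k / fact k
       + (\<Sum>r=1..k. real (Suc k choose r) * S ^ r * ((real n * a) ^ (k - r) / fact (k - r))))"
proof -
  \<comment> \<open>The excess of the short gaps over the weight of a long one: it is nonnegative,
    vanishes from L on, and its coefficients sum to at most S.\<close>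
  define W where "W = gap_fps q L - fps_const a * ones_fps"
  have Wn: "W $ i = (if i = 0 then 0 else qpoch q (min i L) - a)" for i
    by (simp add: W_def gap_fps_def ones_fps_def)
  have a0: "0 \<le> a" unfolding a_def using qpoch_pos[OF q] by (simp add: less_imp_le)
  have W0: "0 \<le> W $ i" for i
    unfolding Wn a_def using qpoch_antimono[OF q, of "min i L" L] by simp
  have WL: "W $ i = 0" if "i > L" for i using that by (simp add: Wn a_def)
  have WS: "(\<Sum>i\<le>N. W $ i) \<le> S" for N
  proof -
    have "(\<Sum>i\<le>N. W $ i) \<le> (\<Sum>i\<le>max N L. W $ i)" using W0 by (intro sum_mono2) auto
    also have "\<dots> = (\<Sum>i\<in>{1..L}. W $ i)"
      by (rule sum.mono_neutral_right) (auto simp: Wn a_def not_le)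
    also have "\<dots> \<le> (\<Sum>g\<in>{1..L}. qpoch q g)" using a0 by (intro sum_mono) (auto simp: Wn)
    finally show ?thesis using S by linarith
  qed
  let ?A = "fps_const a * ones_fps"
  have An: "(?A ^ j) $ i = a ^ j * (ones_fps ^ j) $ i" for i j
    by (simp add: power_mult_distrib fps_const_power)
  have "gap_fps q L = W + ?A" by (simp add: W_def)
  then have "(gap_fps q L ^ Suc k) $ n = (\<Sum>r\<le>Suc k. (of_nat (Suc k choose r) * W ^ r * ?A ^ (Suc k - r)) $ n)"
    by (simp only: binomial_ring fps_sum_nth)
  also have "\<dots> = (\<Sum>r\<le>Suc k. real (Suc k choose r) * (W ^ r * ?A ^ (Suc k - r)) $ n)"
    by (simp add: fps_of_nat[symmetric] mult.assoc del: fps_of_nat binomial_Suc_Suc power_Suc)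
  finally have E: "cut_sum q L k n = (\<Sum>r\<le>Suc k. real (Suc k choose r) * (W ^ r * ?A ^ (Suc k - r)) $ n)"
    using cut_sum_eq_fps[OF n(2)] by simp
  have An0: "0 \<le> (?A ^ j) $ i" for i j
    unfolding An using a0 by (intro mult_nonneg_nonneg fps_power_nonneg) (auto simp: ones_fps_def)
  have nn: "0 \<le> (W ^ r * ?A ^ j) $ n" for r j
    unfolding fps_mult_nth using An0 fps_power_nonneg[OF W0] by (intro sum_nonneg mult_nonneg_nonneg) auto
  have "(\<Sum>r\<in>{0}. real (Suc k choose r) * (W ^ r * ?A ^ (Suc k - r)) $ n) \<le> cut_sum q L k n"
    unfolding E using nn by (intro sum_mono2) auto
  then show "a ^ Suc k * real ((n - 1) choose k) \<le> cut_sum q L k n"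
    using n(2) by (simp add: An ones_fps_power del: power_Suc)
  \<comment> \<open>If all k + 1 gaps were short, their total length could not reach n. This removes
    the only term without a factor a, so that a can be pulled out of the whole sum.\<close>
  have top: "(W ^ Suc k) $ n = 0" by (rule fps_power_nth_eq_0[OF WL n(1)])
  have trm: "(W ^ r * ?A ^ (Suc k - r)) $ n \<le> a * (S ^ r * ((real n * a) ^ (k - r) / fact (k - r)))"
    if r: "r \<le> k" for r
  proof -
    have "(W ^ r * ?A ^ (Suc k - r)) $ n = (\<Sum>i=0..n. (W ^ r) $ i * (a ^ Suc (k - r) * (ones_fps ^ Suc (k - r)) $ (n - i)))"
      using r by (simp only: fps_mult_nth An Suc_diff_le)
    also have "\<dots> \<le> (\<Sum>i=0..n. (W ^ r) $ i * (a ^ Suc (k - r) * (real n ^ (k - r) / fact (k - r))))"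
      using a0 fps_power_nonneg[OF W0] ones_fps_power_le[of _ n "k - r"]
      by (intro sum_mono mult_left_mono) auto
    also have "\<dots> = (\<Sum>i\<le>n. (W ^ r) $ i) * (a * ((real n * a) ^ (k - r) / fact (k - r)))"
      unfolding sum_distrib_right[symmetric] by (simp add: atLeast0AtMost power_mult_distrib)
    also have "\<dots> \<le> S ^ r * (a * ((real n * a) ^ (k - r) / fact (k - r)))"
      using fps_power_partial_sum_le[of W S r n] W0 WS a0 by (intro mult_right_mono) auto
    finally show ?thesis by (simp add: mult_ac)
  qed
  have "cut_sum q L k n = (\<Sum>r\<le>k. real (Suc k choose r) * (W ^ r * ?A ^ (Suc k - r)) $ n)"
    unfolding E using top by simp
  also have "\<dots> \<le> (\<Sum>r\<le>k. real (Suc k choose r) * (a * (S ^ r * ((real n * a) ^ (k - r) / fact (k - r)))))"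
    using trm by (intro sum_mono mult_left_mono) auto
  also have "\<dots> = (\<Sum>r\<le>k. a * (real (Suc k choose r) * S ^ r * ((real n * a) ^ (k - r) / fact (k - r))))"
    by (simp only: mult_ac)
  also have "\<dots> = a * (\<Sum>r\<le>k. real (Suc k choose r) * S ^ r * ((real n * a) ^ (k - r) / fact (k - r)))"
    by (simp only: sum_distrib_left)
  also have "(\<Sum>r\<le>k. real (Suc k choose r) * S ^ r * ((real n * a) ^ (k - r) / fact (k - r))) =
      (real n * a) ^ k / fact k + (\<Sum>r=1..k. real (Suc k choose r) * S ^ r * ((real n * a) ^ (k - r) / fact (k - r)))"
    by (simp add: sum.atMost_shift[of _ k] sum.atLeast1_atMost_eq del: binomial_Suc_Suc)
  finally show "cut_sum q L k n \<le> a * ((real n * a) ^ k / fact k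
       + (\<Sum>r=1..k. real (Suc k choose r) * S ^ r * ((real n * a) ^ (k - r) / fact (k - r))))" .
qed

section \<open>Total variation distance and factorial moments\<close>

lemma total_variation_map_int_le:
  assumes "\<And>A. \<bar>measure_pmf.prob X A - measure_pmf.prob Y A\<bar> \<le> b"
  shows "total_variation (map_pmf int X) (map_pmf int Y) \<le> b"
  unfolding total_variation_def by (rule cSUP_least) (simp_all add: assms)

text \<open>For N > 0 the partial sum equals (-1)^M ((N - 1) choose M), and Pascal's rule bounds the
  binomial by N choose (M + 1).\<close>

lemma alternating_binomial_remainder:
  fixes N M :: nat
  shows "\<bar>(if N = 0 then 1 else 0) - (\<Sum>i\<le>M. (-1) ^ i * real (N choose i))\<bar> \<le> real (N choose Suc M)"
proof (cases N)
  case 0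
  have "(\<Sum>i\<le>M. (-1) ^ i * real (0 choose i)) = (\<Sum>i\<in>{0::nat}. 1)"
    by (rule sum.mono_neutral_cong_right) (auto simp: binomial_eq_0)
  then show ?thesis using 0 by simp
next
  case (Suc K)
  have "(\<Sum>i\<le>M. (real N gchoose i) * (-1) ^ i) = (-1) ^ M * (real N - 1 gchoose M)"
    by (rule gbinomial_sum_lower_neg)
  also have "real N - 1 = real K" using Suc by simp
  finally have "(\<Sum>i\<le>M. (-1) ^ i * real (N choose i)) = (-1) ^ M * real (K choose M)"
    by (simp add: binomial_gbinomial mult.commute)
  moreover have "K choose M \<le> N choose Suc M" using Suc by simp
  ultimately show ?thesis using Suc by (simp add: abs_mult)
qed

text \<open>The identity (w choose k) (k choose j) = (w choose j) ((w - j) choose (k - j)) reduces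
  inclusion-exclusion for exactly j events to that for none among w - j.\<close>

lemma bonferroni_indicator:
  fixes w j M :: nat
  assumes "j < M"
  shows "\<bar>indicator {j} w - (\<Sum>k\<in>{j..<M}. (-1) ^ (k - j) * real (k choose j) * real (w choose k))\<bar>
    \<le> real (M choose j) * real (w choose M)"
proof (cases "j \<le> w")
  case False
  then have "(\<Sum>k\<in>{j..<M}. (-1) ^ (k - j) * real (k choose j) * real (w choose k)) = 0"
    by (intro sum.neutral) (auto simp: binomial_eq_0)
  then show ?thesis using False by simp
next
  case jw: True
  have prod: "real (k choose j) * real (w choose k) = real (w choose j) * real ((w - j) choose (k - j))"
    if "j \<le> k" for k
  proof (cases "k \<le> w")
    case True
    have "(w choose k) * (k choose j) = (w choose j) * ((w - j) choose (k - j))"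
      using choose_mult[OF that True] .
    then show ?thesis by (metis mult.commute of_nat_mult)
  next
    case False
    then have "w choose k = 0" "(w - j) choose (k - j) = 0"
      using that jw by (auto intro!: binomial_eq_0)
    then show ?thesis by (simp only: of_nat_0 mult_zero_right)
  qed
  define D where "D = M - Suc j"
  have M: "M = Suc (j + D)" using assms by (simp add: D_def)
  have "(\<Sum>k\<in>{j..<M}. (-1) ^ (k - j) * real (k choose j) * real (w choose k)) =
      (\<Sum>k\<in>{j..<M}. real (w choose j) * ((-1) ^ (k - j) * real ((w - j) choose (k - j))))"
    by (intro sum.cong refl) (simp add: prod mult.assoc mult.left_commute)
  also have "\<dots> = real (w choose j) * (\<Sum>i\<le>D. (-1) ^ i * real ((w - j) choose i))"
  proof -
    have "(\<Sum>k\<in>{j..<M}. (-1) ^ (k - j) * real ((w - j) choose (k - j))) =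
        (\<Sum>i\<le>D. (-1) ^ i * real ((w - j) choose i))"
      by (rule sum.reindex_bij_witness[of _ "\<lambda>i. i + j" "\<lambda>k. k - j"]) (auto simp: M)
    then show ?thesis by (simp only: sum_distrib_left[symmetric])
  qed
  finally have "indicator {j} w - (\<Sum>k\<in>{j..<M}. (-1) ^ (k - j) * real (k choose j) * real (w choose k)) =
      real (w choose j) * ((if w - j = 0 then 1 else 0) - (\<Sum>i\<le>D. (-1) ^ i * real ((w - j) choose i)))"
    using jw by (auto simp: algebra_simps indicator_def)
  also have "\<bar>\<dots>\<bar> = real (w choose j) * \<bar>(if w - j = 0 then 1 else 0) - (\<Sum>i\<le>D. (-1) ^ i * real ((w - j) choose i))\<bar>"
    by (simp only: abs_mult abs_of_nat)
  also have "\<dots> \<le> real (w choose j) * real ((w - j) choose Suc D)"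
    by (intro mult_left_mono alternating_binomial_remainder) simp
  also have "\<dots> = real (M choose j) * real (w choose M)"
    using prod[of M] M by simp
  finally show ?thesis .
qed

lemma pmf_bonferroni:
  fixes X :: "nat pmf"
  assumes fin: "finite (set_pmf X)" and "j < M"
  defines "B \<equiv> \<lambda>k. measure_pmf.expectation X (\<lambda>w. real (w choose k))"
  shows "\<bar>pmf X j - (\<Sum>k\<in>{j..<M}. (-1) ^ (k - j) * real (k choose j) * B k)\<bar> \<le> real (M choose j) * B M"
proof -
  have int: "integrable (measure_pmf X) f" for f :: "nat \<Rightarrow> real"
    by (rule integrable_measure_pmf_finite[OF fin])
  have "pmf X j = measure_pmf.expectation X (indicator {j})" by (simp add: pmf.rep_eq)
  define g where "g w = indicator {j} w - (\<Sum>k\<in>{j..<M}. (-1) ^ (k - j) * real (k choose j) * real (w choose k))" for w :: nat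
  have "pmf X j - (\<Sum>k\<in>{j..<M}. (-1) ^ (k - j) * real (k choose j) * B k) = measure_pmf.expectation X g"
    unfolding B_def g_def \<open>pmf X j = _\<close> by (simp add: int)
  then have "\<bar>pmf X j - (\<Sum>k\<in>{j..<M}. (-1) ^ (k - j) * real (k choose j) * B k)\<bar> = \<bar>measure_pmf.expectation X g\<bar>"
    by (rule arg_cong)
  also have "\<dots> \<le> measure_pmf.expectation X (\<lambda>w. \<bar>g w\<bar>)"
    by (rule integral_abs_bound)
  also have "\<dots> \<le> measure_pmf.expectation X (\<lambda>w. real (M choose j) * real (w choose M))"
  proof (rule integral_mono)
    fix w
    show "\<bar>g w\<bar> \<le> real (M choose j) * real (w choose M)"
      unfolding g_def by (rule bonferroni_indicator[OF assms(2)])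
  qed (rule int)+
  also have "\<dots> = real (M choose j) * B M" by (simp add: B_def)
  finally show ?thesis .
qed

text \<open>For the Poisson law the Bonferroni sum is \<nu>^j / j! times a Taylor polynomial of exp
  (- \<nu>), so the error is Lagrange's remainder; exp \<nu> bounds exp t at the intermediate point,
  of which only |t| \<le> \<nu> is known.\<close>

lemma poisson_bonferroni:
  fixes \<nu> :: real
  assumes "\<nu> > 0" "j < M"
  shows "\<bar>pmf (poisson_pmf \<nu>) j - (\<Sum>k\<in>{j..<M}. (-1) ^ (k - j) * real (k choose j) * (\<nu> ^ k / fact k))\<bar>
    \<le> real (M choose j) * (exp \<nu> * (\<nu> ^ M / fact M))"
proof -
  have ch: "real (k choose j) * (\<nu> ^ k / fact k) = \<nu> ^ j / fact j * (\<nu> ^ (k - j) / fact (k - j))"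
    if "j \<le> k" for k
    using that by (simp add: binomial_fact field_simps flip: power_add)
  obtain t where t: "\<bar>t\<bar> \<le> \<bar>- \<nu>\<bar>"
    "exp (- \<nu>) = (\<Sum>i<M - j. (- \<nu>) ^ i / fact i) + exp t / fact (M - j) * (- \<nu>) ^ (M - j)"
    using Maclaurin_exp_le[of "- \<nu>" "M - j"] by blast
  have "(\<Sum>k\<in>{j..<M}. (-1) ^ (k - j) * real (k choose j) * (\<nu> ^ k / fact k)) =
      (\<Sum>k\<in>{j..<M}. \<nu> ^ j / fact j * ((- \<nu>) ^ (k - j) / fact (k - j)))"
  proof (intro sum.cong refl)
    fix k assume "k \<in> {j..<M}"
    then have "real (k choose j) * (\<nu> ^ k / fact k) = \<nu> ^ j / fact j * (\<nu> ^ (k - j) / fact (k - j))"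
      by (intro ch) simp
    then show "(-1) ^ (k - j) * real (k choose j) * (\<nu> ^ k / fact k) =
        \<nu> ^ j / fact j * ((- \<nu>) ^ (k - j) / fact (k - j))"
      unfolding power_minus[of \<nu>] mult.assoc by simp
  qed
  also have "\<dots> = \<nu> ^ j / fact j * (\<Sum>i<M - j. (- \<nu>) ^ i / fact i)"
  proof -
    have "(\<Sum>k\<in>{j..<M}. (- \<nu>) ^ (k - j) / fact (k - j)) = (\<Sum>i<M - j. (- \<nu>) ^ i / fact i)"
      by (rule sum.reindex_bij_witness[of _ "\<lambda>i. i + j" "\<lambda>k. k - j"]) auto
    then show ?thesis by (simp only: sum_distrib_left[symmetric])
  qed
  finally have "pmf (poisson_pmf \<nu>) j - (\<Sum>k\<in>{j..<M}. (-1) ^ (k - j) * real (k choose j) * (\<nu> ^ k / fact k))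
     = \<nu> ^ j / fact j * (exp (- \<nu>) - (\<Sum>i<M - j. (- \<nu>) ^ i / fact i))"
    using assms(1) by (simp add: poisson_pmf.rep_eq algebra_simps)
  also have "\<dots> = \<nu> ^ j / fact j * (exp t / fact (M - j) * (- \<nu>) ^ (M - j))" using t(2) by simp
  also have "\<bar>\<dots>\<bar> = exp t * (\<nu> ^ j / fact j * (\<nu> ^ (M - j) / fact (M - j)))"
    using assms(1) by (simp add: abs_mult power_abs)
  also have "\<dots> = exp t * (real (M choose j) * (\<nu> ^ M / fact M))"
    using ch[of M] assms(2) by simp
  also have "\<dots> \<le> exp \<nu> * (real (M choose j) * (\<nu> ^ M / fact M))"
    using t(1) assms(1) by (intro mult_right_mono) auto
  finally show ?thesis by (simp add: mult_ac)
qed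

text \<open>Markov's inequality, as w choose M is at least 1 once w \<ge> M.\<close>

lemma prob_ge_le_factorial_moment:
  fixes X :: "nat pmf"
  assumes fin: "finite (set_pmf X)"
  shows "measure_pmf.prob X {M..} \<le> measure_pmf.expectation X (\<lambda>w. real (w choose M))"
proof -
  have int: "integrable (measure_pmf X) f" for f :: "nat \<Rightarrow> real"
    by (rule integrable_measure_pmf_finite[OF fin])
  have "measure_pmf.prob X {M..} = measure_pmf.expectation X (indicator {M..})" by simp
  also have "\<dots> \<le> measure_pmf.expectation X (\<lambda>w. real (w choose M))"
  proof (intro integral_mono int)
    fix w
    have "1 \<le> real (w choose M)" if "M \<le> w"
      using that by (metis One_nat_def Suc_leI of_nat_1 of_nat_mono zero_less_binomial)
    then show "indicator {M..} w \<le> real (w choose M)" by (auto simp: indicator_def)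
  qed
  finally show ?thesis .
qed

text \<open>No tail bound for Y is needed on the right: its tail is the complement of its head,
  hence at most the tail of X plus the head difference. This causes the factors 2.\<close>

lemma prob_diff_le_head_tail:
  fixes X Y :: "nat pmf"
  shows "\<bar>measure_pmf.prob X A - measure_pmf.prob Y A\<bar> \<le>
    2 * (\<Sum>j<M. \<bar>pmf X j - pmf Y j\<bar>) + 2 * measure_pmf.prob X {M..}"
proof -
  let ?D = "\<Sum>j<M. \<bar>pmf X j - pmf Y j\<bar>"
  have split: "measure_pmf.prob Z A = (\<Sum>j\<in>A \<inter> {..<M}. pmf Z j) + measure_pmf.prob Z (A \<inter> {M..})"
    for Z :: "nat pmf" and A
  proof -
    have "A = (A \<inter> {..<M}) \<union> (A \<inter> {M..})" by auto
    then have "measure_pmf.prob Z A = measure_pmf.prob Z (A \<inter> {..<M}) + measure_pmf.prob Z (A \<inter> {M..})"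
    proof -
      have "(A \<inter> {..<M}) \<inter> (A \<inter> {M..}) = {}" by auto
      from measure_pmf.finite_measure_Union[OF _ _ this, of Z] \<open>A = _\<close> show ?thesis by simp
    qed
    then show ?thesis by (simp add: measure_measure_pmf_finite)
  qed
  have head: "\<bar>(\<Sum>j\<in>A \<inter> {..<M}. pmf X j) - (\<Sum>j\<in>A \<inter> {..<M}. pmf Y j)\<bar> \<le> ?D" for A
  proof -
    have "\<bar>(\<Sum>j\<in>A \<inter> {..<M}. pmf X j) - (\<Sum>j\<in>A \<inter> {..<M}. pmf Y j)\<bar> \<le> (\<Sum>j\<in>A \<inter> {..<M}. \<bar>pmf X j - pmf Y j\<bar>)"
      unfolding sum_subtractf[symmetric] by (rule sum_abs)
    also have "\<dots> \<le> ?D" by (intro sum_mono2) auto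
    finally show ?thesis .
  qed
  have tail: "0 \<le> measure_pmf.prob Z (A \<inter> {M..})" "measure_pmf.prob Z (A \<inter> {M..}) \<le> measure_pmf.prob Z {M..}"
    for Z :: "nat pmf" by (auto intro: measure_pmf.finite_measure_mono)
  have "measure_pmf.prob Y {M..} \<le> measure_pmf.prob X {M..} + ?D"
    using split[of X UNIV] split[of Y UNIV] head[of UNIV] by simp
  then show ?thesis using split[of X A] split[of Y A] head[of A] tail[of X] tail[of Y]
    by linarith
qed

lemma sum_binomial_weights_triangle:
  fixes f :: "nat \<Rightarrow> real"
  shows "(\<Sum>j<M. \<Sum>k\<in>{j..<M}. real (k choose j) * f k) = (\<Sum>k<M. 2 ^ k * f k)"
proof -
  have "(\<Sum>j<M. \<Sum>k\<in>{j..<M}. real (k choose j) * f k) =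
      (\<Sum>(j, k)\<in>(SIGMA j:{..<M}. {j..<M}). real (k choose j) * f k)"
    by (rule sum.Sigma) auto
  also have "\<dots> = (\<Sum>(k, j)\<in>(SIGMA k:{..<M}. {..k}). real (k choose j) * f k)"
    by (rule sum.reindex_bij_witness[of _ prod.swap prod.swap]) auto
  also have "\<dots> = (\<Sum>k<M. \<Sum>j\<le>k. real (k choose j) * f k)"
    by (rule sum.Sigma[symmetric]) auto
  also have "\<dots> = (\<Sum>k<M. 2 ^ k * f k)"
  proof (intro sum.cong refl)
    fix k
    have "(\<Sum>j\<le>k. real (k choose j)) = 2 ^ k"
      using choose_row_sum[of k] by (metis (mono_tags, lifting) of_nat_numeral of_nat_power of_nat_sum sum.cong)
    then show "(\<Sum>j\<le>k. real (k choose j) * f k) = 2 ^ k * f k"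
      by (simp flip: sum_distrib_right)
  qed
  finally show ?thesis .
qed

text \<open>Truncated Bonferroni at level \<open>M\<close>; the factor \<open>2 ^ k\<close> is the number of ways in which the
  \<open>k\<close>-th factorial moment enters the point probabilities.\<close>
lemma total_variation_poisson_factorial_moments:
  fixes X :: "nat pmf" and \<nu> :: real
  assumes fin: "finite (set_pmf X)" and nu: "\<nu> > 0"
  defines "B \<equiv> \<lambda>k. measure_pmf.expectation X (\<lambda>w. real (w choose k))"
  shows "total_variation (map_pmf int X) (map_pmf int (poisson_pmf \<nu>)) \<le>
    4 * (\<Sum>k\<le>M. 2 ^ k * \<bar>B k - \<nu> ^ k / fact k\<bar>) + 6 * exp \<nu> * ((2 * \<nu>) ^ M / fact M)"
proof (rule total_variation_map_int_le)
  fix A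
  define \<Delta> where "\<Delta> k = \<bar>B k - \<nu> ^ k / fact k\<bar>" for k
  define \<beta> where "\<beta> = \<nu> ^ M / fact M"
  let ?P = "poisson_pmf \<nu>"
  have \<beta>: "0 \<le> \<beta>" using nu by (simp add: \<beta>_def)
  have point: "\<bar>pmf X j - pmf ?P j\<bar> \<le> (\<Sum>k\<in>{j..<M}. real (k choose j) * \<Delta> k) + real (M choose j) * (B M + exp \<nu> * \<beta>)"
    if j: "j < M" for j
  proof -
    let ?s = "\<lambda>k. (-1) ^ (k - j) * real (k choose j)"
    have "\<bar>(\<Sum>k\<in>{j..<M}. ?s k * B k) - (\<Sum>k\<in>{j..<M}. ?s k * (\<nu> ^ k / fact k))\<bar>
        \<le> (\<Sum>k\<in>{j..<M}. \<bar>?s k * B k - ?s k * (\<nu> ^ k / fact k)\<bar>)"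
      unfolding sum_subtractf[symmetric] by (rule sum_abs)
    also have "\<dots> = (\<Sum>k\<in>{j..<M}. real (k choose j) * \<Delta> k)"
      unfolding right_diff_distrib[symmetric] by (simp add: \<Delta>_def abs_mult)
    finally have "\<bar>(\<Sum>k\<in>{j..<M}. ?s k * B k) - (\<Sum>k\<in>{j..<M}. ?s k * (\<nu> ^ k / fact k))\<bar>
        \<le> (\<Sum>k\<in>{j..<M}. real (k choose j) * \<Delta> k)" .
    moreover have "\<bar>pmf X j - (\<Sum>k\<in>{j..<M}. ?s k * B k)\<bar> \<le> real (M choose j) * B M"
      using pmf_bonferroni[OF fin j] by (simp only: B_def)
    moreover have "\<bar>pmf ?P j - (\<Sum>k\<in>{j..<M}. ?s k * (\<nu> ^ k / fact k))\<bar> \<le> real (M choose j) * (exp \<nu> * \<beta>)"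
      using poisson_bonferroni[OF nu j] by (simp only: \<beta>_def)
    ultimately show ?thesis unfolding distrib_left by linarith
  qed
  have BM: "0 \<le> B M" unfolding B_def by simp
  have D0: "0 \<le> \<Delta> k" for k by (simp add: \<Delta>_def)
  have row: "(\<Sum>j<M. real (M choose j)) \<le> 2 ^ M"
  proof -
    have "(\<Sum>j<M. real (M choose j)) \<le> (\<Sum>j\<le>M. real (M choose j))" by (intro sum_mono2) auto
    also have "\<dots> = 2 ^ M"
      using choose_row_sum[of M] by (metis (mono_tags, lifting) of_nat_numeral of_nat_power of_nat_sum sum.cong)
    finally show ?thesis .
  qed
  have "(\<Sum>j<M. \<bar>pmf X j - pmf ?P j\<bar>) \<le>
      (\<Sum>j<M. (\<Sum>k\<in>{j..<M}. real (k choose j) * \<Delta> k) + real (M choose j) * (B M + exp \<nu> * \<beta>))"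
    by (intro sum_mono point) simp
  also have "\<dots> = (\<Sum>k<M. 2 ^ k * \<Delta> k) + (\<Sum>j<M. real (M choose j)) * (B M + exp \<nu> * \<beta>)"
    by (simp only: sum.distrib sum_binomial_weights_triangle sum_distrib_right)
  also have "\<dots> \<le> (\<Sum>k<M. 2 ^ k * \<Delta> k) + 2 ^ M * (B M + exp \<nu> * \<beta>)"
    using row BM \<beta> by (intro add_left_mono mult_right_mono) auto
  finally have h: "(\<Sum>j<M. \<bar>pmf X j - pmf ?P j\<bar>) \<le> (\<Sum>k<M. 2 ^ k * \<Delta> k) + 2 ^ M * B M + 2 ^ M * (exp \<nu> * \<beta>)"
    by (simp add: algebra_simps)
  have BD: "B M \<le> \<Delta> M + \<beta>" by (simp add: \<Delta>_def \<beta>_def)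
  have "2 ^ M * B M \<le> 2 ^ M * (\<Delta> M + \<beta>)" using BD by (intro mult_left_mono) auto
  then have B2: "2 ^ M * B M \<le> 2 ^ M * \<Delta> M + 2 ^ M * \<beta>" by (simp add: algebra_simps)
  have "1 * B M \<le> 2 ^ M * B M" using BM by (intro mult_right_mono) auto
  then have tail: "measure_pmf.prob X {M..} \<le> 2 ^ M * B M"
    using prob_ge_le_factorial_moment[OF fin, of M] unfolding B_def by simp
  have "1 * \<beta> \<le> exp \<nu> * \<beta>" using nu \<beta> by (intro mult_right_mono) auto
  then have "2 ^ M * \<beta> \<le> 2 ^ M * (exp \<nu> * \<beta>)" by (intro mult_left_mono) auto
  moreover have "(\<Sum>k<M. 2 ^ k * \<Delta> k) + 2 ^ M * \<Delta> M = (\<Sum>k\<le>M. 2 ^ k * \<Delta> k)"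
    by (simp flip: lessThan_Suc_atMost)
  moreover have "0 \<le> (\<Sum>k<M. 2 ^ k * \<Delta> k)" using D0 by (intro sum_nonneg) auto
  \<comment> \<open>The moment of level M occurs twice, in the Bonferroni remainder of the head and
    in Markov's bound for the tail; doubling gives 4. Replacing it by its Poisson value adds 4 to
    the 2 of the Poisson remainder, which makes 6.\<close>
  ultimately have "\<bar>measure_pmf.prob X A - measure_pmf.prob ?P A\<bar> \<le>
      4 * (\<Sum>k\<le>M. 2 ^ k * \<Delta> k) + 6 * (2 ^ M * (exp \<nu> * \<beta>))"
    using prob_diff_le_head_tail[of X A ?P M] h B2 tail D0[of M] by linarith
  then show "\<bar>measure_pmf.prob X A - measure_pmf.prob ?P A\<bar> \<le>
      4 * (\<Sum>k\<le>M. 2 ^ k * \<bar>B k - \<nu> ^ k / fact k\<bar>) + 6 * exp \<nu> * ((2 * \<nu>) ^ M / fact M)"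
    by (simp add: \<Delta>_def \<beta>_def power_mult_distrib mult_ac)
qed

section \<open>Asymptotics of the Euler product\<close>

definition stirling_err :: "nat \<Rightarrow> real" where
  "stirling_err n = ln (fact n) - (real n + 1 / 2) * ln (real n) + real n"

lemma stirling_err_convergent: "convergent stirling_err"
proof -
  let ?d = "\<lambda>n. stirling_err (Suc (Suc n)) - stirling_err (Suc n)"
  have d: "?d n = 1 - (real n + 3 / 2) * (ln (real n + 2) - ln (real n + 1))" for n
  proof -
    have "ln (fact (Suc (Suc n)) :: real) = ln (real n + 2) + ln (fact (Suc n))"
      by (subst fact_Suc) (simp add: ln_mult add.commute del: fact_Suc)
    then show ?thesis
      by (simp add: stirling_err_def algebra_simps del: fact_Suc)
  qed
  have "(\<lambda>n. 1 - (real n + 3 / 2) * (ln (real n + 2) - ln (real n + 1))) \<in> O(\<lambda>n. 1 / real (Suc n) ^ 2)"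
    by real_asymp
  moreover have "summable (\<lambda>n. norm (1 / real (Suc n) ^ 2))"
    using inverse_squares_sums by (simp add: sums_iff add.commute)
  ultimately have "summable ?d" unfolding d by (rule summable_comparison_test_bigo[rotated])
  then have "convergent (\<lambda>n. \<Sum>i<n. ?d i)" by (simp add: summable_iff_convergent)
  moreover have "(\<Sum>i<n. ?d i) = stirling_err (Suc n) - stirling_err 1" for n
    by (subst sum_lessThan_telescope) simp
  ultimately have "convergent (\<lambda>n. stirling_err (Suc n) - stirling_err 1)" by simp
  then have "convergent (\<lambda>n. stirling_err (Suc n))"
    by (simp add: convergent_diff_const_right_iff)
  then show ?thesis by (simp only: convergent_Suc_iff)
qed

lemma wallis_prod_fact:
  "(\<Prod>k=1..n. (4 * real k ^ 2) / (4 * real k ^ 2 - 1)) = 2 ^ (4 * n) * fact n ^ 4 / (fact (2 * n) ^ 2 * (2 * real n + 1))"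
proof (induction n)
  case (Suc n)
  have f: "fact (2 * Suc n) = (2 * real n + 2) * (2 * real n + 1) * (fact (2 * n) :: real)"
    by (simp add: algebra_simps)
  have "(\<Prod>k=1..Suc n. (4 * real k ^ 2) / (4 * real k ^ 2 - 1)) =
     (2 ^ (4 * n) * fact n ^ 4 / (fact (2 * n) ^ 2 * (2 * real n + 1))) * (4 * real (Suc n) ^ 2 / (4 * real (Suc n) ^ 2 - 1))"
    by (simp only: Suc.IH prod.nat_ivl_Suc' mult.commute)
  also have "4 * real (Suc n) ^ 2 - 1 = (2 * real n + 1) * (2 * real n + 3)"
    by (simp add: power2_eq_square algebra_simps)
  also have "(2 ^ (4 * n) * fact n ^ 4 / (fact (2 * n) ^ 2 * (2 * real n + 1))) * (4 * real (Suc n) ^ 2 / ((2 * real n + 1) * (2 * real n + 3)))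
    = 2 ^ (4 * Suc n) * fact (Suc n) ^ 4 / (fact (2 * Suc n) ^ 2 * (2 * real (Suc n) + 1))"
  proof -
    define x where "x = real n + 1"
    have x: "real (Suc n) = x" "2 * real n + 2 = 2 * x" "2 * real n + 1 = 2 * x - 1" "2 * real n + 3 = 2 * x + 1"
      "2 * real (Suc n) + 1 = 2 * x + 1" "x \<ge> 1"
      by (auto simp: x_def)
    have "fact (Suc n) = x * (fact n :: real)" by (simp add: x_def)
    then show ?thesis unfolding f x(1-5) using x(6)
      by (simp add: divide_simps) (simp add: power_add power_mult_distrib power2_eq_square power4_eq_xxxx algebra_simps)
  qed
  finally show ?case .
qed simp

text \<open>Up to elementary terms the logarithm of Wallis' product is 4
  \<open>stirling_err n\<close> - 2 \<open>stirling_err (2 * n)\<close>. Both sequences have the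
  same limit c, so 2 c is determined by the value pi / 2 of the product.\<close>

lemma stirling_err_limit: "stirling_err \<longlonglongrightarrow> ln (2 * pi) / 2"
proof -
  obtain c where c: "stirling_err \<longlonglongrightarrow> c" using stirling_err_convergent by (auto simp: convergent_def)
  let ?W = "\<lambda>n. \<Prod>k=1..n. (4 * real k ^ 2) / (4 * real k ^ 2 - 1)"
  have "(\<lambda>n. ln (?W n)) \<longlonglongrightarrow> ln (pi / 2)"
    by (intro tendsto_ln wallis) simp
  moreover have "\<forall>\<^sub>F n in sequentially. ln (?W n) =
     4 * stirling_err n - 2 * stirling_err (2 * n) + (ln (real n) - ln 2 - ln (2 * real n + 1))"
    using eventually_gt_at_top[of 0]
  proof eventually_elim
    case (elim n)
    have p: "2 * real n + 1 > 0" by simp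
    have "ln (?W n) = 4 * real n * ln 2 + 4 * ln (fact n) - 2 * ln (fact (2 * n)) - ln (2 * real n + 1)"
      unfolding wallis_prod_fact using p
      by (simp add: ln_div ln_mult ln_realpow)
    then show ?case using elim by (simp add: stirling_err_def ln_mult algebra_simps)
  qed
  ultimately have "(\<lambda>n. 4 * stirling_err n - 2 * stirling_err (2 * n) + (ln (real n) - ln 2 - ln (2 * real n + 1))) \<longlonglongrightarrow> ln (pi / 2)"
    by (rule Lim_transform_eventually)
  moreover have "(\<lambda>n. 4 * stirling_err n - 2 * stirling_err (2 * n) + (ln (real n) - ln 2 - ln (2 * real n + 1)))
    \<longlonglongrightarrow> 4 * c - 2 * c + (- 2 * ln 2)"
  proof (intro tendsto_intros c)
    show "(\<lambda>n. stirling_err (2 * n)) \<longlonglongrightarrow> c"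
      using LIMSEQ_subseq_LIMSEQ[OF c, of "\<lambda>n. 2 * n"] by (simp add: strict_mono_def o_def)
    show "(\<lambda>n. ln (real n) - ln 2 - ln (2 * real n + 1)) \<longlonglongrightarrow> - 2 * ln 2" by real_asymp
  qed
  ultimately have "ln (pi / 2) = 4 * c - 2 * c + (- 2 * ln 2)" by (rule LIMSEQ_unique)
  then have "c = ln (2 * pi) / 2" by (simp add: ln_div ln_mult)
  with c show ?thesis by (simp only:)
qed

text \<open>The dilogarithm Li_2 as a power series. Its value pi^2 / 6 at 1 is the source of the
  factor 6 / pi^2 in the critical window.\<close>

definition dilog :: "real \<Rightarrow> real" where
  "dilog t = (\<Sum>k. 1 / real (Suc k) ^ 2 * t ^ Suc k)"

lemma summable_inverse_squares: "summable (\<lambda>k. 1 / real (Suc k) ^ 2)"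
  using inverse_squares_sums by (simp add: sums_iff add.commute)

lemma dilog_1: "dilog 1 = pi\<^sup>2 / 6"
  unfolding dilog_def using inverse_squares_sums by (simp add: sums_iff add.commute)

lemma dilog_0: "dilog 0 = 0"
  by (simp add: dilog_def)

text \<open>The M-test with 1 / k^2 works up to the endpoint 1, which the derivative formula does
  not reach.\<close>

lemma continuous_on_dilog: "continuous_on {0..1} dilog"
proof -
  have "uniform_limit {0..1} (\<lambda>n x. \<Sum>i<n. 1 / real (Suc i) ^ 2 * x ^ Suc i) dilog sequentially"
    unfolding dilog_def
  proof (rule Weierstrass_m_test[OF _ summable_inverse_squares])
    fix n and x :: real assume "x \<in> {0..1}"
    then have "0 \<le> x ^ Suc n" "x ^ Suc n \<le> 1" by (auto intro: power_le_one simp del: power_Suc)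
    then show "norm (1 / real (Suc n) ^ 2 * x ^ Suc n) \<le> 1 / real (Suc n) ^ 2"
      by (simp add: abs_mult divide_right_mono del: power_Suc of_nat_Suc)
  qed
  then show ?thesis
    by (rule uniform_limit_theorem[rotated]) (auto intro!: always_eventually continuous_intros)
qed

lemma dilog_deriv:
  assumes "0 < t" "t < 1"
  shows "(dilog has_real_derivative (- ln (1 - t) / t)) (at t)"
proof -
  have s: "summable (\<lambda>n. 1 / real (Suc n) ^ 2 * real (Suc n) * x ^ n)" if "x \<in> {-1<..<1}" for x :: real
  proof (rule summable_comparison_test')
    show "summable (\<lambda>n. \<bar>x\<bar> ^ n)" using that by (intro summable_geometric) auto
    fix n
    have "1 / real (Suc n) ^ 2 * real (Suc n) = 1 / real (Suc n)"
      by (simp add: power2_eq_square del: of_nat_Suc)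
    also have "\<dots> \<le> 1" by simp
    finally have "1 / real (Suc n) ^ 2 * real (Suc n) * \<bar>x\<bar> ^ n \<le> 1 * \<bar>x\<bar> ^ n"
      by (intro mult_right_mono) auto
    then show "norm (1 / real (Suc n) ^ 2 * real (Suc n) * x ^ n) \<le> \<bar>x\<bar> ^ n"
      by (simp add: abs_mult power_abs del: of_nat_Suc)
  qed
  have "(dilog has_real_derivative (\<Sum>n. 1 / real (Suc n) ^ 2 * real (Suc n) * t ^ n)) (at t)"
    unfolding dilog_def[abs_def] by (rule DERIV_power_series'[of 1, OF s]) (use assms in auto)
  moreover have "(\<Sum>n. 1 / real (Suc n) ^ 2 * real (Suc n) * t ^ n) = - ln (1 - t) / t"
  proof -
    have "ln (1 - t) = (\<Sum>n. (- 1) ^ n * (1 / real (n + 1)) * (1 - t - 1) ^ Suc n)"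
      by (rule ln_series) (use assms in auto)
    also have "\<dots> = (\<Sum>n. - t * (1 / real (Suc n) ^ 2 * real (Suc n) * t ^ n))"
    proof (rule suminf_cong)
      fix n
      have "(- 1) ^ n * (- t) ^ n = t ^ n" by (simp flip: power_mult_distrib)
      moreover have "(1 - t - 1) ^ Suc n = - t * (- t) ^ n" by simp
      moreover have "1 / real (Suc n) ^ 2 * real (Suc n) = 1 / real (n + 1)"
        by (simp add: power2_eq_square del: of_nat_Suc)
      moreover have "(- 1) ^ n * (1 / real (n + 1)) * (- t * (- t) ^ n) = - t * (1 / real (n + 1) * ((- 1) ^ n * (- t) ^ n))"
        by (simp only: mult_ac)
      ultimately show "(- 1) ^ n * (1 / real (n + 1)) * (1 - t - 1) ^ Suc n = - t * (1 / real (Suc n) ^ 2 * real (Suc n) * t ^ n)"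
        by (simp only:)
    qed
    also have "\<dots> = - t * (\<Sum>n. 1 / real (Suc n) ^ 2 * real (Suc n) * t ^ n)"
      by (rule suminf_mult) (use s[of t] assms in auto)
    finally show ?thesis using assms by (simp add: field_simps)
  qed
  ultimately show ?thesis by simp
qed

text \<open>The logarithm of a factor 1 - exp (- x) with its singularity at 0 divided out, so that
  the derivative stays bounded and the trapezoidal rule is accurate near 0.\<close>

definition log_factor :: "real \<Rightarrow> real" where
  "log_factor x = ln (1 - exp (- x)) - ln x"

definition log_factor_deriv :: "real \<Rightarrow> real" where
  "log_factor_deriv x = exp (- x) / (1 - exp (- x)) - 1 / x"

text \<open>An antiderivative of \<open>log_factor\<close>: the dilogarithm integrates log (1 - exp
  (- x)), the other terms integrate - log x.\<close>

definition log_factor_prim :: "real \<Rightarrow> real" where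
  "log_factor_prim x = dilog (exp (- x)) - x * ln x + x"

section \<open>The trapezoidal rule for the regularised logarithm\<close>

lemma log_factor_bounds:
  assumes "0 < x"
  shows "- x \<le> log_factor x" "log_factor x \<le> 0"
proof -
  have e: "1 - exp (- x) > 0" using assms by simp
  have "1 + (- x) \<le> exp (- x)" by (rule exp_ge_add_one_self)
  then have "ln (1 - exp (- x)) \<le> ln x" using e assms by (subst ln_le_cancel_iff) auto
  then show "log_factor x \<le> 0" by (simp add: log_factor_def)
  have "x * exp (- x) \<le> 1 - exp (- x)"
  proof -
    have "(1 + x) * exp (- x) \<le> exp x * exp (- x)" by (intro mult_right_mono exp_ge_add_one_self) simp
    then show ?thesis by (simp add: algebra_simps flip: exp_add)
  qed
  then have "ln (x * exp (- x)) \<le> ln (1 - exp (- x))" using e assms by (subst ln_le_cancel_iff) auto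
  then show "- x \<le> log_factor x" using assms by (simp add: log_factor_def ln_mult)
qed

lemma log_factor_DERIV:
  assumes "0 < x"
  shows "(log_factor has_real_derivative log_factor_deriv x) (at x)"
  unfolding log_factor_def[abs_def] log_factor_deriv_def
  using assms by (auto intro!: derivative_eq_intros simp: field_simps)

lemma log_factor_prim_DERIV:
  assumes "0 < x"
  shows "(log_factor_prim has_real_derivative log_factor x) (at x)"
proof -
  have "((\<lambda>x. exp (- x)) has_real_derivative - exp (- x)) (at x)"
    by (auto intro!: derivative_eq_intros)
  moreover have "(dilog has_real_derivative - ln (1 - exp (- x)) / exp (- x)) (at (exp (- x)))"
    using assms by (intro dilog_deriv) auto
  ultimately have "((\<lambda>x. dilog (exp (- x))) has_real_derivative (- ln (1 - exp (- x)) / exp (- x)) * (- exp (- x))) (at x)"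
    by (rule DERIV_chain')
  then have d: "((\<lambda>x. dilog (exp (- x))) has_real_derivative ln (1 - exp (- x))) (at x)" by simp
  show ?thesis unfolding log_factor_prim_def[abs_def] log_factor_def
    by (rule derivative_eq_intros d refl assms | simp)+ (use assms in \<open>auto simp: field_simps\<close>)
qed

lemma log_factor_deriv_eq: "0 < x \<Longrightarrow> log_factor_deriv x = 1 / (exp x - 1) - 1 / x"
  by (simp add: log_factor_deriv_def exp_minus field_simps)

text \<open>These bounds limit the total increase of the derivative to 1 over any number of grid
  cells, which makes the accumulated quadrature error uniform in N.\<close>

lemma log_factor_deriv_bounds:
  assumes "0 < x"
  shows "- 1 \<le> log_factor_deriv x" "log_factor_deriv x \<le> 0"
proof -
  have e: "x \<le> exp x - 1" using exp_ge_add_one_self[of x] by linarith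
  then have "1 / (exp x - 1) \<le> 1 / x" using assms by (intro divide_left_mono mult_pos_pos) auto
  then show "log_factor_deriv x \<le> 0" using log_factor_deriv_eq[OF assms] by simp
  show "- 1 \<le> log_factor_deriv x"
  proof (cases "x \<le> 1")
    case True
    have "exp x - 1 \<le> x + x\<^sup>2" using exp_bound[of x] assms True by simp
    then have "1 / (x + x\<^sup>2) \<le> 1 / (exp x - 1)"
      using assms e by (intro divide_left_mono mult_pos_pos) auto
    moreover have "1 / x - 1 \<le> 1 / (x + x\<^sup>2)"
    proof -
      have "(1 - x) * (1 + x) \<le> 1" by (simp add: algebra_simps)
      then have "1 - x \<le> 1 / (1 + x)" using assms by (simp add: pos_le_divide_eq)
      then have "(1 - x) / x \<le> (1 / (1 + x)) / x" using assms by (intro divide_right_mono) auto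
      then show ?thesis using assms by (simp add: diff_divide_distrib power2_eq_square algebra_simps)
    qed
    ultimately show ?thesis using log_factor_deriv_eq[OF assms] by linarith
  next
    case False
    then have "1 / x \<le> 1" "0 \<le> 1 / (exp x - 1)" by auto
    then show ?thesis using log_factor_deriv_eq[OF assms] by linarith
  qed
qed

lemma two_sinh_ge:
  fixes y :: real
  assumes "0 \<le> y"
  shows "2 * y \<le> exp y - exp (- y)"
proof -
  let ?h = "\<lambda>y::real. exp y - exp (- y) - 2 * y"
  have "?h 0 \<le> ?h y"
  proof (rule DERIV_nonneg_imp_nondecreasing[OF assms])
    fix x :: real
    have "(?h has_real_derivative (exp x + exp (- x) - 2)) (at x)"
      by (auto intro!: derivative_eq_intros)
    moreover have "0 \<le> exp x + exp (- x) - 2"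
    proof -
      have "0 \<le> (exp (x / 2) - exp (- x / 2))\<^sup>2" by simp
      also have "\<dots> = exp x + exp (- x) - 2"
        by (simp add: power2_eq_square algebra_simps flip: exp_add exp_double)
      finally show ?thesis .
    qed
    ultimately show "\<exists>d. (?h has_real_derivative d) (at x) \<and> 0 \<le> d" by blast
  qed
  then show ?thesis by simp
qed

text \<open>\<open>log_factor\<close> is convex: its second derivative 1 / t^2 - exp (- t) / (1 -
  exp (- t))^2 is nonnegative because t \<le> 2 sinh (t / 2).\<close>

lemma log_factor_deriv_mono:
  assumes "0 < x" "x \<le> y"
  shows "log_factor_deriv x \<le> log_factor_deriv y"
proof (rule DERIV_nonneg_imp_nondecreasing[OF assms(2)])
  fix t assume "x \<le> t" "t \<le> y"
  then have t: "0 < t" using assms by simp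
  have e: "1 - exp (- t) > 0" using t by simp
  have "(log_factor_deriv has_real_derivative (- exp (- t) / (1 - exp (- t))\<^sup>2 + 1 / t\<^sup>2)) (at t)"
  proof -
    have 1: "((\<lambda>x. exp (- x)) has_real_derivative - exp (- t)) (at t)"
      by (auto intro!: derivative_eq_intros)
    have 2: "((\<lambda>x. 1 - exp (- x)) has_real_derivative exp (- t)) (at t)"
      by (auto intro!: derivative_eq_intros)
    have 3: "((\<lambda>x. 1 / x) has_real_derivative - 1 / t\<^sup>2) (at t)"
      using t by (auto intro!: derivative_eq_intros simp: power2_eq_square)
    have "(- exp (- t) * (1 - exp (- t)) - exp (- t) * exp (- t)) / ((1 - exp (- t)) * (1 - exp (- t))) - - 1 / t\<^sup>2
      = - exp (- t) / (1 - exp (- t))\<^sup>2 + 1 / t\<^sup>2"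
      by (simp add: power2_eq_square algebra_simps)
    then show ?thesis
      using DERIV_diff[OF DERIV_divide[OF 1 2] 3] e unfolding log_factor_deriv_def[abs_def] by simp
  qed
  moreover have "exp (- t) / (1 - exp (- t))\<^sup>2 \<le> 1 / t\<^sup>2"
  proof -
    have "t \<le> exp (t / 2) - exp (- (t / 2))" using two_sinh_ge[of "t / 2"] t by simp
    then have "t * exp (- (t / 2)) \<le> (exp (t / 2) - exp (- (t / 2))) * exp (- (t / 2))"
      by (intro mult_right_mono) auto
    also have "\<dots> = 1 - exp (- t)" by (simp add: algebra_simps flip: exp_add)
    finally have "(t * exp (- (t / 2)))\<^sup>2 \<le> (1 - exp (- t))\<^sup>2" using t by (intro power_mono) auto
    then have "t\<^sup>2 * exp (- t) \<le> (1 - exp (- t))\<^sup>2"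
      by (simp add: power_mult_distrib flip: exp_double)
    then show ?thesis using t e by (simp add: divide_simps mult.commute)
  qed
  ultimately show "\<exists>d. (log_factor_deriv has_real_derivative d) (at t) \<and> 0 \<le> d"
    by (intro exI[of _ "- exp (- t) / (1 - exp (- t))\<^sup>2 + 1 / t\<^sup>2"]) auto
qed

text \<open>As a function of the step t the defect vanishes at 0, and by the mean value theorem its
  derivative is t (h (x + t) - h \<xi>) / 2 with \<xi> between x and x + t. Monotonicity of h gives
  the sign and a bound by an increment of h, which telescopes over consecutive cells.\<close>

lemma trapezoid_error:
  fixes g h G :: "real \<Rightarrow> real"
  assumes "0 < z"
    and G: "\<And>t. x \<le> t \<Longrightarrow> t \<le> x + z \<Longrightarrow> (G has_real_derivative g t) (at t)"
    and g: "\<And>t. x \<le> t \<Longrightarrow> t \<le> x + z \<Longrightarrow> (g has_real_derivative h t) (at t)"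
    and h: "\<And>s t. x \<le> s \<Longrightarrow> s \<le> t \<Longrightarrow> t \<le> x + z \<Longrightarrow> h s \<le> h t"
  shows "0 \<le> z / 2 * (g x + g (x + z)) - (G (x + z) - G x)"
    and "z / 2 * (g x + g (x + z)) - (G (x + z) - G x) \<le> z\<^sup>2 / 2 * (h (x + z) - h x)"
proof -
  define \<psi> where "\<psi> t = t / 2 * (g x + g (x + t)) - (G (x + t) - G x)" for t
  define \<psi>' where "\<psi>' t = (g x - g (x + t) + t * h (x + t)) / 2" for t
  have D: "(\<psi> has_real_derivative \<psi>' t) (at t)" if "0 \<le> t" "t \<le> z" for t
  proof -
    have 1: "((\<lambda>t. g (x + t)) has_real_derivative h (x + t)) (at t)"
      using g[of "x + t"] that by (simp add: DERIV_shift add.commute)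
    have 2: "((\<lambda>t. G (x + t)) has_real_derivative g (x + t)) (at t)"
      using G[of "x + t"] that by (simp add: DERIV_shift add.commute)
    show ?thesis unfolding \<psi>_def[abs_def] \<psi>'_def
      by (rule derivative_eq_intros 1 2 refl | simp add: field_simps)+
  qed
  have b: "0 \<le> \<psi>' t \<and> \<psi>' t \<le> z / 2 * (h (x + z) - h x)" if t: "0 \<le> t" "t \<le> z" for t
  proof (cases "t = 0")
    case True
    then show ?thesis using assms(1) h[of x "x + z"] by (simp add: \<psi>'_def)
  next
    case False
    then have "0 < t" using t by simp
    obtain \<xi> where xi: "x < \<xi>" "\<xi> < x + t" "g (x + t) - g x = (x + t - x) * h \<xi>"
      using MVT2[of x "x + t" g h] g \<open>0 < t\<close> t by force
    have "\<psi>' t = t * (h (x + t) - h \<xi>) / 2" using xi(3) by (simp add: \<psi>'_def algebra_simps)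
    moreover have "0 \<le> h (x + t) - h \<xi>" using h[of \<xi> "x + t"] xi t by simp
    moreover have "h (x + t) - h \<xi> \<le> h (x + z) - h x"
      using h[of "x + t" "x + z"] h[of x \<xi>] xi t by simp
    moreover from calculation(2) have "0 \<le> t * (h (x + t) - h \<xi>)"
      using t(1) by (rule mult_nonneg_nonneg[rotated])
    moreover from calculation(2,3) have "t * (h (x + t) - h \<xi>) \<le> z * (h (x + z) - h x)"
      using t assms(1) by (intro mult_mono) auto
    ultimately show ?thesis by simp
  qed
  obtain \<xi> where xi: "0 < \<xi>" "\<xi> < z" "\<psi> z - \<psi> 0 = (z - 0) * \<psi>' \<xi>"
    using MVT2[of 0 z \<psi> \<psi>'] D assms(1) by force
  have e: "\<psi> z = z * \<psi>' \<xi>" using xi(3) by (simp add: \<psi>_def)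
  have b\<xi>: "0 \<le> \<psi>' \<xi>" "\<psi>' \<xi> \<le> z / 2 * (h (x + z) - h x)" using b[of \<xi>] xi by auto
  show "0 \<le> z / 2 * (g x + g (x + z)) - (G (x + z) - G x)"
    using e b\<xi>(1) assms(1) unfolding \<psi>_def by simp
  have "z * \<psi>' \<xi> \<le> z * (z / 2 * (h (x + z) - h x))" using b\<xi>(2) assms(1) by (intro mult_left_mono) auto
  also have "\<dots> = z\<^sup>2 / 2 * (h (x + z) - h x)" by (simp add: power2_eq_square)
  finally show "z / 2 * (g x + g (x + z)) - (G (x + z) - G x) \<le> z\<^sup>2 / 2 * (h (x + z) - h x)"
    using e unfolding \<psi>_def by simp
qed

lemma dilog_exp_at_0: "((\<lambda>x. dilog (exp (- x))) \<longlongrightarrow> pi\<^sup>2 / 6) (at_right 0)"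
proof -
  have "(dilog \<longlongrightarrow> dilog 1) (at 1 within {0..1})"
    using continuous_on_dilog by (auto simp: continuous_on_def)
  moreover have "filterlim (\<lambda>x::real. exp (- x)) (at 1 within {0..1}) (at_right 0)"
    unfolding filterlim_at
  proof
    show "\<forall>\<^sub>F x in at_right 0. exp (- x) \<in> {0..1} \<and> exp (- x) \<noteq> (1 :: real)"
      using eventually_at_right_less[of 0] by eventually_elim auto
    show "((\<lambda>x::real. exp (- x)) \<longlongrightarrow> 1) (at_right 0)" by real_asymp
  qed
  ultimately show ?thesis unfolding dilog_1 by (rule filterlim_compose)
qed

text \<open>The limit at 0 from the right is Li_2 (1) = pi^2 / 6, and on (0, z) the integrand lies
  between - z and 0.\<close>

lemma log_factor_prim_bounds:
  assumes "0 < z"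
  shows "pi\<^sup>2 / 6 - z\<^sup>2 \<le> log_factor_prim z" "log_factor_prim z \<le> pi\<^sup>2 / 6"
proof -
  have lim: "(log_factor_prim \<longlongrightarrow> pi\<^sup>2 / 6) (at_right 0)"
  proof -
    have "((\<lambda>x::real. - x * ln x + x) \<longlongrightarrow> 0) (at_right 0)" by real_asymp
    from tendsto_add[OF dilog_exp_at_0 this]
    have "((\<lambda>x. dilog (exp (- x)) + (- x * ln x + x)) \<longlongrightarrow> pi\<^sup>2 / 6) (at_right 0)" by simp
    moreover have "(\<lambda>x. dilog (exp (- x)) + (- x * ln x + x)) = log_factor_prim"
      by (simp add: log_factor_prim_def fun_eq_iff)
    ultimately show ?thesis by (simp only:)
  qed
  have b: "log_factor_prim e - z\<^sup>2 \<le> log_factor_prim z \<and> log_factor_prim z \<le> log_factor_prim e"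
    if e: "0 < e" "e < z" for e
  proof -
    obtain \<xi> where xi: "e < \<xi>" "\<xi> < z" "log_factor_prim z - log_factor_prim e = (z - e) * log_factor \<xi>"
      using MVT2[of e z log_factor_prim log_factor] log_factor_prim_DERIV e by force
    have g: "- z \<le> log_factor \<xi>" "log_factor \<xi> \<le> 0" using log_factor_bounds[of \<xi>] xi e by auto
    have "(z - e) * (- log_factor \<xi>) \<le> z * z" using g e by (intro mult_mono) auto
    moreover have "0 \<le> (z - e) * (- log_factor \<xi>)" using g e by (intro mult_nonneg_nonneg) auto
    ultimately show ?thesis using xi(3) by (simp add: power2_eq_square)
  qed
  have ev: "\<forall>\<^sub>F e in at_right 0. 0 < e \<and> e < z"
    using eventually_at_right_less[of 0] eventually_at_right_real[OF assms] by eventually_elim auto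
  show "log_factor_prim z \<le> pi\<^sup>2 / 6"
    by (rule tendsto_lowerbound[OF lim]) (use ev b in \<open>auto elim!: eventually_mono\<close>)
  have "pi\<^sup>2 / 6 \<le> log_factor_prim z + z\<^sup>2"
    by (rule tendsto_upperbound[OF lim]) (use ev b in \<open>auto elim!: eventually_mono simp: algebra_simps\<close>)
  then show "pi\<^sup>2 / 6 - z\<^sup>2 \<le> log_factor_prim z" by linarith
qed

text \<open>The errors of the cells telescope to z / 2 times the total increment of the derivative.
  The grid starts at z because the derivative formulas are available for positive arguments only;
  the cell from 0 to z is covered by the bounds on \<open>log_factor_prim\<close>.\<close>

lemma log_factor_sum_bounds:
  assumes z: "0 < z"
  defines "g \<equiv> \<lambda>j. log_factor (real j * z)"
  defines "E \<equiv> \<lambda>N. (\<Sum>j=1..N. g j) - (g 1 + g N) / 2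
     - (log_factor_prim (real N * z) - log_factor_prim z) / z"
  assumes "1 \<le> N"
  shows "0 \<le> E N" "E N \<le> z / 2"
proof -
  have "0 \<le> E N \<and> E N \<le> z / 2 * (log_factor_deriv (real N * z) - log_factor_deriv z)"
    using \<open>1 \<le> N\<close>
  proof (induction N rule: dec_induct)
    case base
    then show ?case by (simp add: E_def)
  next
    case (step N)
    let ?x = "real N * z"
    have x: "0 < ?x" "?x + z = real (Suc N) * z" using step z by (auto simp: algebra_simps)
    note t = trapezoid_error[of z ?x log_factor_prim log_factor log_factor_deriv, unfolded x(2)]
    have D: "(log_factor_prim has_real_derivative log_factor t) (at t)"
      "(log_factor has_real_derivative log_factor_deriv t) (at t)" if "?x \<le> t" for t
      using log_factor_prim_DERIV log_factor_DERIV x(1) that by auto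
    have m: "log_factor_deriv s \<le> log_factor_deriv t" if "?x \<le> s" "s \<le> t" for s t
      using log_factor_deriv_mono x(1) that by auto
    let ?e = "z / 2 * (g N + g (Suc N)) - (log_factor_prim (real (Suc N) * z) - log_factor_prim ?x)"
    have e: "0 \<le> ?e" "?e \<le> z\<^sup>2 / 2 * (log_factor_deriv (real (Suc N) * z) - log_factor_deriv ?x)"
      using t[OF z D(1) D(2) m] unfolding g_def by auto
    have eq: "E (Suc N) = E N + ?e / z"
    proof -
      have "(\<Sum>j=1..Suc N. g j) = (\<Sum>j=1..N. g j) + g (Suc N)" by simp
      then show ?thesis unfolding E_def using z
        by (simp only:) (simp add: diff_divide_distrib add_divide_distrib algebra_simps)
    qed
    have "0 \<le> ?e / z" using e(1) z by simp
    moreover have "?e / z \<le> z\<^sup>2 / 2 * (log_factor_deriv (real (Suc N) * z) - log_factor_deriv ?x) / z"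
      using e(2) z by (intro divide_right_mono) auto
    moreover have "z\<^sup>2 / 2 * (log_factor_deriv (real (Suc N) * z) - log_factor_deriv ?x) / z
      = z / 2 * (log_factor_deriv (real (Suc N) * z) - log_factor_deriv ?x)"
      using z by (simp add: power2_eq_square)
    moreover have "z / 2 * (log_factor_deriv ?x - log_factor_deriv z)
       + z / 2 * (log_factor_deriv (real (Suc N) * z) - log_factor_deriv ?x)
       = z / 2 * (log_factor_deriv (real (Suc N) * z) - log_factor_deriv z)"
      by (simp add: right_diff_distrib)
    ultimately show ?case unfolding eq using step.IH by linarith
  qed
  moreover have "log_factor_deriv (real N * z) - log_factor_deriv z \<le> 1"
    using log_factor_deriv_bounds[of "real N * z"] log_factor_deriv_bounds[of z] z assms(4) by auto
  then have "z / 2 * (log_factor_deriv (real N * z) - log_factor_deriv z) \<le> z / 2 * 1"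
    using z by (intro mult_left_mono) auto
  ultimately show "0 \<le> E N" "E N \<le> z / 2" by auto
qed

section \<open>Euler's infinite product near q = 1\<close>

lemma qprod_LIMSEQ:
  fixes q :: real
  assumes "0 \<le> q" "q < 1"
  shows "(\<lambda>N. \<Prod>j=1..N. 1 - q ^ j) \<longlonglongrightarrow> (\<Prod>j. 1 - q ^ Suc j)" "0 < (\<Prod>j. 1 - q ^ Suc j)"
proof -
  have "summable (\<lambda>j. q ^ j)" using assms by (intro summable_geometric) simp
  then have "summable (\<lambda>j. q ^ Suc j)" unfolding power_Suc by (rule summable_mult)
  then have "summable (\<lambda>j. norm ((1 - q ^ Suc j) - 1))" using assms by simp
  then have c: "convergent_prod (\<lambda>j. 1 - q ^ Suc j)"
    by (intro abs_convergent_prod_imp_convergent_prod summable_imp_abs_convergent_prod)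
  have pos: "0 < 1 - q ^ Suc j" for j
    using assms by (simp add: power_less_one_iff del: power_Suc)
  from convergent_prod_LIMSEQ[OF c] have "(\<lambda>N. \<Prod>j<N. 1 - q ^ Suc j) \<longlonglongrightarrow> (\<Prod>j. 1 - q ^ Suc j)"
    by (simp only: LIMSEQ_lessThan_iff_atMost)
  moreover have "(\<Prod>j<N. 1 - q ^ Suc j) = (\<Prod>j=1..N. 1 - q ^ j)" for N
    by (rule prod.reindex_bij_witness[of _ "\<lambda>j. j - 1" Suc]) auto
  ultimately show l: "(\<lambda>N. \<Prod>j=1..N. 1 - q ^ j) \<longlonglongrightarrow> (\<Prod>j. 1 - q ^ Suc j)" by simp
  show "0 < (\<Prod>j. 1 - q ^ Suc j)" using c pos by (rule less_0_prodinf)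
qed

text \<open>This is the classical behaviour of Euler's function. The modular transformation of the
  eta function would give the error z / 24 up to exponentially small terms; an error O(z) suffices
  here and follows from real analysis alone.\<close>

theorem ln_qprod_asymp:
  assumes z: "0 < z"
  shows "\<bar>ln (\<Prod>j. 1 - exp (- z) ^ Suc j) - (- pi\<^sup>2 / (6 * z) + ln (2 * pi / z) / 2)\<bar> \<le> 2 * z"
proof -
  let ?q = "exp (- z)"
  let ?P = "\<Prod>j. 1 - ?q ^ Suc j"
  have q: "0 \<le> ?q" "?q < 1" using z by auto
  \<comment> \<open>Writing log (1 - q^j) as \<open>log_factor (j z)\<close> + log j + log z
    produces log N! and N log z. The terms of order N log N and N cancel between Stirling's formula
    and the antiderivative at N z, so R converges.\<close>
  define R where "R N = stirling_err N + ln (1 - exp (- (real N * z))) / 2 + dilog (exp (- (real N * z))) / z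
     - ln z / 2 + log_factor z / 2 - log_factor_prim z / z" for N
  define S where "S N = (\<Sum>j=1..N. ln (1 - ?q ^ j))" for N
  have SR: "R N \<le> S N \<and> S N \<le> R N + z / 2" if N: "1 \<le> N" for N
  proof -
    have qj: "?q ^ j = exp (- (real j * z))" for j by (simp add: exp_of_nat_mult[symmetric])
    have "S N = (\<Sum>j=1..N. log_factor (real j * z) + (ln (real j) + ln z))"
      unfolding S_def by (intro sum.cong refl) (use z in \<open>simp add: qj log_factor_def ln_mult\<close>)
    also have "\<dots> = (\<Sum>j=1..N. log_factor (real j * z)) + (\<Sum>j=1..N. ln (real j)) + real N * ln z"
      by (simp add: sum.distrib)
    also have "(\<Sum>j=1..N. ln (real j)) = ln (fact N)"
    proof -
      have "ln (\<Prod>j=1..N. real j) = (\<Sum>j=1..N. ln (real j))" by (rule ln_prod) auto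
      then show ?thesis by (simp add: fact_prod)
    qed
    finally have S: "S N = (\<Sum>j=1..N. log_factor (real j * z)) + ln (fact N) + real N * ln z" .
    have "(log_factor_prim (real N * z)) / z = dilog (exp (- (real N * z))) / z - real N * (ln (real N) + ln z) + real N"
      using z N by (simp add: log_factor_prim_def ln_mult add_divide_distrib diff_divide_distrib)
    moreover have "log_factor (real N * z) = ln (1 - exp (- (real N * z))) - (ln (real N) + ln z)"
      using z N by (simp add: log_factor_def ln_mult)
    ultimately show ?thesis
      using log_factor_sum_bounds[OF z N] unfolding S R_def stirling_err_def
        diff_divide_distrib add_divide_distrib distrib_left distrib_right of_nat_1 mult_1
      by linarith
  qed
  have fs: "filterlim (\<lambda>N. real N * z) at_top sequentially" using z by real_asymp
  have e0: "(\<lambda>N. exp (- (real N * z))) \<longlonglongrightarrow> 0"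
    by (rule filterlim_compose[OF _ fs]) real_asymp
  have d0: "(\<lambda>N. dilog (exp (- (real N * z)))) \<longlonglongrightarrow> 0"
  proof -
    have "(dilog \<longlongrightarrow> dilog 0) (at 0 within {0..1})"
      using continuous_on_dilog by (auto simp: continuous_on_def)
    moreover have "filterlim (\<lambda>N. exp (- (real N * z))) (at 0 within {0..1}) sequentially"
      unfolding filterlim_at using e0 z by (auto intro!: always_eventually)
    ultimately show ?thesis unfolding dilog_0 by (rule filterlim_compose)
  qed
  define R' where "R' = ln (2 * pi) / 2 - ln z / 2 + log_factor z / 2 - log_factor_prim z / z"
  have "R \<longlonglongrightarrow> ln (2 * pi) / 2 + ln (1 - 0) / 2 + 0 / z - ln z / 2 + log_factor z / 2 - log_factor_prim z / z"
    unfolding R_def[abs_def] using z by (intro tendsto_intros stirling_err_limit e0 d0) auto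
  then have R: "R \<longlonglongrightarrow> R'" by (simp add: R'_def)
  have S: "S \<longlonglongrightarrow> ln ?P"
  proof -
    have "(\<lambda>N. ln (\<Prod>j=1..N. 1 - ?q ^ j)) \<longlonglongrightarrow> ln ?P"
      using qprod_LIMSEQ[OF q] by (intro tendsto_ln) auto
    moreover have "ln (\<Prod>j=1..N. 1 - ?q ^ j) = S N" for N
      unfolding S_def using z by (intro ln_prod) (simp_all add: exp_of_nat_mult[symmetric])
    ultimately show ?thesis by simp
  qed
  have "R' \<le> ln ?P"
    by (rule tendsto_le[OF _ S R]) (use SR in \<open>auto intro!: eventually_sequentiallyI[of 1]\<close>)
  moreover have "ln ?P \<le> R' + z / 2"
    by (rule tendsto_le[OF _ tendsto_add[OF R tendsto_const] S]) (use SR in \<open>auto intro!: eventually_sequentiallyI[of 1]\<close>)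
  moreover have "pi\<^sup>2 / (6 * z) - z \<le> log_factor_prim z / z" "log_factor_prim z / z \<le> pi\<^sup>2 / (6 * z)"
  proof -
    have "(pi\<^sup>2 / 6 - z\<^sup>2) / z \<le> log_factor_prim z / z" "log_factor_prim z / z \<le> (pi\<^sup>2 / 6) / z"
      by (rule divide_right_mono[OF log_factor_prim_bounds(1)[OF z]], use z in simp)
         (rule divide_right_mono[OF log_factor_prim_bounds(2)[OF z]], use z in simp)
    then show "pi\<^sup>2 / (6 * z) - z \<le> log_factor_prim z / z" "log_factor_prim z / z \<le> pi\<^sup>2 / (6 * z)"
      using z by (simp_all add: diff_divide_distrib power2_eq_square)
  qed
  moreover have "ln (2 * pi / z) = ln (2 * pi) - ln z" using z by (simp add: ln_div)
  ultimately show ?thesis using log_factor_bounds[OF z] z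
    unfolding R'_def by (simp add: abs_le_iff diff_divide_distrib)
qed

section \<open>Total variation bound for fixed parameters\<close>

text \<open>A cap of size at most L means that j lies within distance L of the last cut before it,
  or of 0.\<close>

lemma card_small_caps_le:
  assumes T: "T \<subseteq> {1..<n}"
  shows "card {j \<in> {1..n}. cap T j \<le> L} \<le> Suc (card T) * L"
proof -
  have fin: "finite T" using T by (rule finite_subset) simp
  have "{j \<in> {1..n}. cap T j \<le> L} \<subseteq> (\<Union>t\<in>insert 0 T. {t<..t + L})"
  proof
    fix j assume j: "j \<in> {j \<in> {1..n}. cap T j \<le> L}"
    let ?M = "Max (insert 0 {t \<in> T. t < j})"
    have "?M \<in> insert 0 {t \<in> T. t < j}" by (rule Max_in) (use fin in auto)
    then have "?M \<in> insert 0 T" "?M < j" using j by auto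
    moreover have "j \<le> ?M + L"
    proof -
      have "j - ?M \<le> L" using j unfolding cap_def by blast
      then show ?thesis by linarith
    qed
    ultimately show "j \<in> (\<Union>t\<in>insert 0 T. {t<..t + L})" by (intro UN_I[of ?M]) auto
  qed
  then have "card {j \<in> {1..n}. cap T j \<le> L} \<le> card (\<Union>t\<in>insert 0 T. {t<..t + L})"
    using fin by (intro card_mono) auto
  also have "\<dots> \<le> (\<Sum>t\<in>insert 0 T. card {t<..t + L})"
    using fin by (intro card_UN_le) auto
  also have "\<dots> = card (insert 0 T) * L" by simp
  also have "\<dots> \<le> Suc (card T) * L" using fin by (intro mult_right_mono card_insert_le_m1) (auto simp: card_insert_if)
  finally show ?thesis .
qed

lemma finite_perms_with_inversions: "finite (perms_with_inversions n m)"
  unfolding perms_with_inversions_def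
  by (rule finite_subset[OF _ finite_permutations[of "{1..n}"]]) auto

text \<open>Pairs of a permutation and a k-set of its cuts are counted in two ways; prescribing no
  cut gives the normalisation.\<close>

lemma expectation_binomial_cut_points:
  assumes "perms_with_inversions n m \<noteq> {}"
  shows "measure_pmf.expectation (random_perm n m) (\<lambda>\<sigma>. real (card (cut_points n \<sigma>) choose k)) =
    (\<Sum>T | T \<subseteq> {1..<n} \<and> card T = k. real (cap_count n m T)) / real (cap_count n m {})"
proof -
  let ?P = "perms_with_inversions n m" and ?T = "{T. T \<subseteq> {1..<n} \<and> card T = k}"
  have fP: "finite ?P" by (rule finite_perms_with_inversions)
  have fT: "finite ?T" by (rule finite_subset[of _ "Pow {1..<n}"]) auto
  have sub: "cut_points n \<sigma> \<subseteq> {1..<n}" for \<sigma> by (auto simp: cut_points_def)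
  have ch: "card (cut_points n \<sigma>) choose k = (\<Sum>T\<in>?T. if T \<subseteq> cut_points n \<sigma> then 1 else 0)" for \<sigma>
  proof -
    have "finite (cut_points n \<sigma>)" by (rule finite_subset[OF sub]) simp
    then have "card (cut_points n \<sigma>) choose k = card {T. T \<subseteq> cut_points n \<sigma> \<and> card T = k}"
      by (simp add: n_subsets)
    also have "{T. T \<subseteq> cut_points n \<sigma> \<and> card T = k} = {T \<in> ?T. T \<subseteq> cut_points n \<sigma>}" using sub by auto
    also have "card \<dots> = (\<Sum>T\<in>{T \<in> ?T. T \<subseteq> cut_points n \<sigma>}. 1)" by simp
    also have "\<dots> = (\<Sum>T\<in>?T. if T \<subseteq> cut_points n \<sigma> then 1 else 0)" by (rule sum.inter_filter[OF fT])
    finally show ?thesis .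
  qed
  have "(\<Sum>\<sigma>\<in>?P. card (cut_points n \<sigma>) choose k) = (\<Sum>T\<in>?T. \<Sum>\<sigma>\<in>?P. if T \<subseteq> cut_points n \<sigma> then 1 else 0)"
    unfolding ch by (rule sum.swap)
  also have "\<dots> = (\<Sum>T\<in>?T. cap_count n m T)"
  proof (intro sum.cong refl)
    fix T assume "T \<in> ?T"
    then have "cap_count n m T = card {\<sigma> \<in> ?P. T \<subseteq> cut_points n \<sigma>}"
      by (intro card_perms_with_cuts[symmetric]) simp
    also have "\<dots> = (\<Sum>\<sigma>\<in>{\<sigma> \<in> ?P. T \<subseteq> cut_points n \<sigma>}. 1)" by simp
    also have "\<dots> = (\<Sum>\<sigma>\<in>?P. if T \<subseteq> cut_points n \<sigma> then 1 else 0)" by (rule sum.inter_filter[OF fP])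
    finally show "(\<Sum>\<sigma>\<in>?P. if T \<subseteq> cut_points n \<sigma> then 1 else 0) = cap_count n m T" by simp
  qed
  finally have "(\<Sum>\<sigma>\<in>?P. real (card (cut_points n \<sigma>) choose k)) = (\<Sum>T\<in>?T. real (cap_count n m T))"
    by (simp flip: of_nat_sum)
  moreover have "card ?P = cap_count n m {}" using card_perms_with_cuts[of "{}" n m] by simp
  ultimately show ?thesis unfolding random_perm_def
    using assms fP by (simp add: integral_pmf_of_set)
qed

lemma excess_components_eq_cut_points:
  assumes "perms_with_inversions n m \<noteq> {}" "n \<ge> 1"
  shows "excess_components_pmf n m = map_pmf int (map_pmf (\<lambda>\<sigma>. card (cut_points n \<sigma>)) (random_perm n m))"
  unfolding excess_components_pmf_def map_pmf_comp
proof (rule map_pmf_cong[OF refl])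
  fix \<sigma> assume "\<sigma> \<in> set_pmf (random_perm n m)"
  moreover have "finite (perms_with_inversions n m)" by (rule finite_perms_with_inversions)
  ultimately have "\<sigma> permutes {1..n}"
    using assms(1) by (simp add: random_perm_def perms_with_inversions_def)
  then show "int (num_components n \<sigma>) - 1 = int (card (cut_points n \<sigma>))"
    using num_components_eq assms(2) by simp
qed

lemma sum_power_fact_le_exp:
  fixes x :: real
  assumes "0 \<le> x"
  shows "(\<Sum>k\<le>N. x ^ k / fact k) \<le> exp x"
proof -
  have "(\<lambda>k. x ^ k / fact k) sums exp x"
    using exp_converges[of x] by (simp add: divide_inverse mult.commute)
  then show ?thesis using assms by (intro sum_le_suminf[THEN order_trans, of _ "{..N}"]) (auto simp: sums_iff)
qed

text \<open>Bounding the binomial by 2^(k + 1) turns the weight 2^k into 2 * 4^r * 4^(k - r), so the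
  double sum becomes a Cauchy product of a geometric series in 4 S, of ratio at most 1/2, and the
  exponential series of 4 x.\<close>

lemma sum_short_gap_terms_le:
  fixes S x :: real
  assumes "0 \<le> S" "8 * S \<le> 1" "0 \<le> x"
  shows "(\<Sum>k\<le>M. 2 ^ k * (\<Sum>r=1..k. real (Suc k choose r) * S ^ r * (x ^ (k - r) / fact (k - r)))) \<le> 16 * S * exp (4 * x)"
proof -
  \<comment> \<open>The term r = 0 is left out, which is what retains the factor S in the
    result.\<close>
  define a where "a r = (if r = 0 then 0 else (4 * S) ^ r)" for r
  define b where "b j = (4 * x) ^ j / fact j" for j
  have a0: "0 \<le> a r" and b0: "0 \<le> b r" for r using assms by (auto simp: a_def b_def)
  have term_le: "2 ^ k * (\<Sum>r=1..k. real (Suc k choose r) * S ^ r * (x ^ (k - r) / fact (k - r))) \<le> 2 * (\<Sum>r\<le>k. a r * b (k - r))" for k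
  proof -
    have "2 ^ k * (\<Sum>r=1..k. real (Suc k choose r) * S ^ r * (x ^ (k - r) / fact (k - r)))
       = (\<Sum>r=1..k. 2 ^ k * (real (Suc k choose r) * (S ^ r * (x ^ (k - r) / fact (k - r)))))"
      by (simp only: sum_distrib_left mult.assoc)
    also have "\<dots> \<le> (\<Sum>r=1..k. 2 * (a r * b (k - r)))"
    proof (intro sum_mono)
      fix r assume r: "r \<in> {1..k}"
      have "real (Suc k choose r) \<le> real (2 ^ Suc k)"
        using binomial_le_pow2[of "Suc k" r] by (simp only: of_nat_le_iff)
      then have "2 ^ k * (real (Suc k choose r) * (S ^ r * (x ^ (k - r) / fact (k - r))))
        \<le> 2 ^ k * (2 ^ Suc k * (S ^ r * (x ^ (k - r) / fact (k - r))))"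
        using assms by (intro mult_left_mono mult_right_mono) auto
      also have "2 ^ k * (2 ^ Suc k * (S ^ r * (x ^ (k - r) / fact (k - r)))) = 2 * (4 ^ k * (S ^ r * (x ^ (k - r) / fact (k - r))))"
      proof -
        have "(4::real) ^ k = 2 ^ k * 2 ^ k" by (simp flip: power_mult_distrib)
        then show ?thesis by simp
      qed
      also have "(4::real) ^ k = 4 ^ r * 4 ^ (k - r)" using r by (simp flip: power_add)
      also have "2 * (4 ^ r * 4 ^ (k - r) * (S ^ r * (x ^ (k - r) / fact (k - r)))) = 2 * (a r * b (k - r))"
        using r by (simp add: a_def b_def power_mult_distrib)
      finally show "2 ^ k * (real (Suc k choose r) * (S ^ r * (x ^ (k - r) / fact (k - r)))) \<le> 2 * (a r * b (k - r))" .
    qed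
    also have "\<dots> \<le> (\<Sum>r\<le>k. 2 * (a r * b (k - r)))" using a0 b0 by (intro sum_mono2) auto
    finally show ?thesis by (simp add: sum_distrib_left)
  qed
  have asum: "(\<Sum>r\<le>M. a r) \<le> 8 * S"
  proof -
    have "(\<Sum>r\<le>M. a r) = (\<Sum>r=1..M. (4 * S) ^ r)"
      by (rule sum.mono_neutral_cong_right) (auto simp: a_def)
    also have "\<dots> = (\<Sum>r<M. (4 * S) ^ Suc r)"
      by (rule sum.reindex_bij_witness[of _ Suc "\<lambda>r. r - 1"]) auto
    also have "\<dots> \<le> (\<Sum>r<M. 4 * S * (1 / 2) ^ r)"
      using assms unfolding power_Suc by (intro sum_mono mult_left_mono power_mono) auto
    also have "\<dots> = 4 * S * (\<Sum>r<M. (1 / 2) ^ r)" by (simp only: sum_distrib_left)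
    also have "\<dots> \<le> 4 * S * 2"
      using assms by (intro mult_left_mono) (auto simp: sum_gp_strict)
    finally show ?thesis by simp
  qed
  have "(\<Sum>k\<le>M. 2 ^ k * (\<Sum>r=1..k. real (Suc k choose r) * S ^ r * (x ^ (k - r) / fact (k - r)))) \<le> (\<Sum>k\<le>M. 2 * (\<Sum>r\<le>k. a r * b (k - r)))"
    by (intro sum_mono term_le)
  also have "\<dots> = 2 * (\<Sum>k\<le>M. \<Sum>r\<le>k. a r * b (k - r))" by (simp only: sum_distrib_left)
  also have "\<dots> \<le> 2 * ((\<Sum>r\<le>M. a r) * (\<Sum>j\<le>M. b j))"
    using truncated_cauchy_product_le[OF a0 b0] by simp
  also have "\<dots> \<le> 2 * ((8 * S) * exp (4 * x))"
    using asum sum_power_fact_le_exp[of "4 * x" M] assms a0 b0 unfolding b_def[symmetric]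
    by (intro mult_left_mono mult_mono sum_nonneg) auto
  finally show ?thesis by simp
qed

text \<open>For k \<ge> n the left-hand side is not positive. Otherwise the k factors of the falling
  factorial are at least n - k, and Bernoulli's inequality applies to (1 - k / n)^k.\<close>

lemma binomial_ge_power_fact:
  assumes "n \<ge> 1"
  shows "(1 - real k ^ 2 / real n) * (real n ^ k / fact k) \<le> real ((n - 1) choose k)"
proof (cases "k < n")
  case False
  then have "real n * 1 \<le> real k * real k" using assms by (intro mult_mono) auto
  then have "1 - real k ^ 2 / real n \<le> 0" using assms by (simp add: power2_eq_square)
  then have "(1 - real k ^ 2 / real n) * (real n ^ k / fact k) \<le> 0" by (intro mult_nonpos_nonneg) auto
  then show ?thesis by (smt (verit) of_nat_0_le_iff)
next
  case True
  have "(1 - real k / n) ^ k \<ge> 1 - real k ^ 2 / n"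
    using Bernoulli_inequality[of "- (real k / n)" k] True by (simp add: power2_eq_square)
  then have "(1 - real k ^ 2 / real n) * (real n ^ k / fact k) \<le> (1 - real k / n) ^ k * (real n ^ k / fact k)"
    by (intro mult_right_mono) auto
  also have "\<dots> = (real n - real k) ^ k / fact k"
  proof -
    have "(1 - real k / n) ^ k * real n ^ k = ((1 - real k / n) * real n) ^ k" by (simp only: power_mult_distrib)
    also have "(1 - real k / n) * real n = real n - real k" using assms by (simp add: left_diff_distrib)
    finally show ?thesis by simp
  qed
  also have "\<dots> \<le> real ((n - 1) choose k)"
  proof -
    have "real ((n - 1) choose k) = (\<Prod>i = 0..<k. real (n - 1) - real i) / fact k"
      by (simp add: binomial_gbinomial gbinomial_prod_rev)
    moreover have "(real n - real k) ^ k \<le> (\<Prod>i = 0..<k. real (n - 1) - real i)"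
    proof -
      have "(\<Prod>i = 0..<k. real n - real k) \<le> (\<Prod>i = 0..<k. real (n - 1) - real i)"
        using True by (intro prod_mono) (auto simp: of_nat_diff)
      then show ?thesis by simp
    qed
    ultimately show ?thesis by (simp add: divide_right_mono)
  qed
  finally show ?thesis .
qed

lemma power_diff_le:
  fixes x y \<Lambda> :: real
  assumes "0 \<le> x" "x \<le> \<Lambda>" "0 \<le> y" "y \<le> \<Lambda>"
  shows "\<bar>x ^ k - y ^ k\<bar> \<le> real k * \<Lambda> ^ (k - 1) * \<bar>x - y\<bar>"
proof (cases k)
  case (Suc j)
  have "x ^ k - y ^ k = (x - y) * (\<Sum>i<Suc j. x ^ i * y ^ (j - i))"
    unfolding Suc power_diff_sumr2[of x "Suc j" y] diff_Suc_Suc by (simp only: mult.commute)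
  then have "\<bar>x ^ k - y ^ k\<bar> = \<bar>x - y\<bar> * \<bar>\<Sum>i<Suc j. x ^ i * y ^ (j - i)\<bar>"
    by (simp only: abs_mult)
  also have "\<dots> \<le> \<bar>x - y\<bar> * (\<Sum>i<Suc j. \<Lambda> ^ j)"
  proof (rule mult_left_mono, rule order_trans[OF sum_abs], rule sum_mono)
    fix i assume "i \<in> {..<Suc j}"
    then have "\<Lambda> ^ j = \<Lambda> ^ i * \<Lambda> ^ (j - i)" by (simp flip: power_add)
    then show "\<bar>x ^ i * y ^ (j - i)\<bar> \<le> \<Lambda> ^ j"
      using assms by (auto simp: abs_mult intro!: mult_mono power_mono)
  qed simp
  finally show ?thesis by (simp add: Suc mult_ac)
qed simp

lemma cap_count_bounds:
  fixes n m Q L :: nat and q \<eta> :: real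
  defines "q \<equiv> real m / real (n + m)"
  assumes nm: "n \<le> m" and Q: "1 \<le> Q" "2 * Q\<^sup>2 \<le> n" and T: "T \<subseteq> {1..<n}"
    and TQ: "Suc (card T) * L * Suc L + L \<le> Q"
  defines "\<eta> \<equiv> 2 * (real Q)\<^sup>2 / n + 2 * n * q ^ L"
  shows "real (cap_count n m T) \<le> (1 + \<eta>) * weak_comps n m * cap_weight q L n T"
    and "(1 - \<eta>) * weak_comps n m * cap_weight q L n T \<le> real (cap_count n m T)"
proof -
  let ?I = "{j \<in> {1..n}. cap T j \<le> L}"
  have n0: "n > 0" using Q by (cases n) auto
  have q: "0 \<le> q" "q \<le> 1" unfolding q_def using n0 by auto
  have w: "cap_weight q L n T = (\<Prod>i\<in>?I. 1 - q ^ cap T i)"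
    unfolding cap_weight_def by (rule prod.inter_filter[symmetric]) simp
  have w0: "0 \<le> cap_weight q L n T"
    unfolding w by (rule prod_nonneg) (use q in \<open>simp add: power_le_one\<close>)
  have W0: "0 \<le> weak_comps n m" using weak_comps_pos[of n m] n0 by simp
  have c: "card ?I * Suc L + L \<le> Q"
    using mult_right_mono[OF card_small_caps_le[OF T, of L], of "Suc L"] TQ by linarith
  have cc: "cap_count n m T = sol_count (\<lambda>j. {..<cap T j}) {1..n} m"
    by (simp add: cap_count_def sol_count_def)
  note b = capped_solutions_bounds[OF nm Q refl c, folded q_def w cc]
  have e: "0 \<le> 2 * real n * q ^ L" "0 \<le> (real Q)\<^sup>2 / n" using q by auto
  have h: "0 \<le> weak_comps n m * cap_weight q L n T" using W0 w0 by simp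
  have "real (cap_count n m T) \<le> (1 + 2 * ((real Q)\<^sup>2 / n)) * (weak_comps n m * cap_weight q L n T)"
    using b(1) by (simp only: mult.assoc w)
  also have "\<dots> \<le> (1 + \<eta>) * (weak_comps n m * cap_weight q L n T)"
    by (rule mult_right_mono[OF _ h]) (use e in \<open>simp add: \<eta>_def\<close>)
  finally show "real (cap_count n m T) \<le> (1 + \<eta>) * weak_comps n m * cap_weight q L n T"
    by (simp only: mult.assoc)
  have "2 * (real Q)\<^sup>2 / n = 2 * ((real Q)\<^sup>2 / n)" by simp
  then have "1 - \<eta> \<le> 1 - ((real Q)\<^sup>2 / n + 2 * n * q ^ L)"
    using e(2) unfolding \<eta>_def by linarith
  then have "(1 - \<eta>) * (weak_comps n m * cap_weight q L n T) \<le> (1 - ((real Q)\<^sup>2 / n + 2 * n * q ^ L)) * (weak_comps n m * cap_weight q L n T)"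
    by (rule mult_right_mono[OF _ h])
  also have "\<dots> \<le> real (cap_count n m T)" using b(2) by (simp only: mult.assoc w)
  finally show "(1 - \<eta>) * weak_comps n m * cap_weight q L n T \<le> real (cap_count n m T)"
    by (simp only: mult.assoc)
qed

lemma ratio_one_plus_bounds:
  fixes \<eta> :: real
  assumes "0 \<le> \<eta>" "\<eta> \<le> 1 / 2"
  shows "(1 + \<eta>) / (1 - \<eta>) \<le> 1 + 4 * \<eta>" "1 - 2 * \<eta> \<le> (1 - \<eta>) / (1 + \<eta>)"
proof -
  have "\<eta> * \<eta> \<le> 1 / 2 * \<eta>" using assms by (intro mult_right_mono) auto
  then have "1 + \<eta> \<le> (1 + 4 * \<eta>) * (1 - \<eta>)" using assms by (simp add: algebra_simps)
  then show "(1 + \<eta>) / (1 - \<eta>) \<le> 1 + 4 * \<eta>" using assms by (simp add: pos_divide_le_eq)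
  have "(1 - 2 * \<eta>) * (1 + \<eta>) \<le> 1 - \<eta>" using assms by (simp add: algebra_simps)
  then show "1 - 2 * \<eta> \<le> (1 - \<eta>) / (1 + \<eta>)" using assms by (simp add: pos_le_divide_eq)
qed

text \<open>The moment is a quotient of capped counts in which \<open>weak_comps n m\<close>
  cancels. The positive lower bound for its denominator also shows that there are permutations with
  m inversions, so that the uniform law makes sense.\<close>

lemma factorial_moment_bounds:
  fixes n m Q L k :: nat and S q a \<eta> B :: real
  defines "q \<equiv> real m / real (n + m)"
  defines "a \<equiv> qpoch q L"
  defines "\<eta> \<equiv> 2 * (real Q)\<^sup>2 / n + 2 * n * q ^ L"
  defines "B \<equiv> measure_pmf.expectation (random_perm n m) (\<lambda>\<sigma>. real (card (cut_points n \<sigma>) choose k))"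
  assumes nm: "n \<le> m" and Q: "1 \<le> Q" "2 * Q\<^sup>2 \<le> n" and kQ: "Suc k * L * Suc L + L \<le> Q"
    and eta: "\<eta> \<le> 1 / 2" and S: "(\<Sum>g\<in>{1..L}. qpoch q g) \<le> S"
  shows "perms_with_inversions n m \<noteq> {}"
    and "(1 - 2 * \<eta>) * ((1 - real k ^ 2 / n) * ((real n * a) ^ k / fact k)) \<le> B"
    and "B \<le> (1 + 4 * \<eta>) * ((real n * a) ^ k / fact k
       + (\<Sum>r=1..k. real (Suc k choose r) * S ^ r * ((real n * a) ^ (k - r) / fact (k - r))))"
proof -
  have n0: "n > 0" using Q by (cases n) auto
  have q: "0 \<le> q" "q < 1" unfolding q_def using n0 by auto
  have e0: "0 \<le> \<eta>" unfolding \<eta>_def using q by auto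
  have W: "0 < weak_comps n m" using weak_comps_pos[of n m] n0 by simp
  have a: "0 < a" unfolding a_def by (rule qpoch_pos[OF q])
  have "Q * 1 \<le> Q * Q" using Q by (intro mult_left_mono) auto
  then have Qn: "Q < n" using Q unfolding power2_eq_square by linarith
  have "Suc k * L * 1 \<le> Suc k * L * Suc L" by (intro mult_left_mono) auto
  then have nL: "Suc k * L < n" using kQ Qn by linarith
  have "1 * L \<le> Suc k * L" by (rule mult_right_mono) auto
  then have Ln: "L \<le> n" using nL by linarith
  let ?T = "{T. T \<subseteq> {1..<n} \<and> card T = k}" and ?c = "\<lambda>T. real (cap_count n m T)"
  let ?w = "cap_weight q L n" and ?H = "weak_comps n m"
  have c: "?c T \<le> (1 + \<eta>) * ?H * ?w T" "(1 - \<eta>) * ?H * ?w T \<le> ?c T"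
    if "T \<subseteq> {1..<n}" "card T \<le> k" for T
  proof -
    have "Suc (card T) * L * Suc L \<le> Suc k * L * Suc L" using that by (intro mult_right_mono) auto
    then have "Suc (card T) * L * Suc L + L \<le> Q" using kQ by linarith
    from cap_count_bounds[OF nm Q that(1) this]
    show "?c T \<le> (1 + \<eta>) * ?H * ?w T" "(1 - \<eta>) * ?H * ?w T \<le> ?c T"
      unfolding \<eta>_def q_def by auto
  qed
  have w0: "?w {} = a"
  proof -
    have "{T. T \<subseteq> {1..<n} \<and> card T = 0} = {{}}" by (auto dest: finite_subset)
    then have "?w {} = cut_sum q L 0 n" by (simp add: cut_sum_def)
    then show ?thesis using Ln by (simp add: cut_sum_0 a_def min_absorb2)
  qed
  have c0: "?c {} \<le> (1 + \<eta>) * ?H * a" "(1 - \<eta>) * ?H * a \<le> ?c {}" using c[of "{}"] w0 by auto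
  have lo_pos: "0 < (1 - \<eta>) * ?H * a" using eta W a by simp
  then have cpos: "0 < ?c {}" using c0 by linarith
  show ne: "perms_with_inversions n m \<noteq> {}"
  proof
    assume "perms_with_inversions n m = {}"
    then have "cap_count n m {} = 0" using card_perms_with_cuts[of "{}" n m] by simp
    then show False using cpos by simp
  qed
  define Z where "Z = cut_sum q L k n"
  have Z: "Z = (\<Sum>T\<in>?T. ?w T)" by (simp add: Z_def cut_sum_def)
  have n1: "n \<ge> 1" using n0 by simp
  have Zb: "a ^ Suc k * real ((n - 1) choose k) \<le> Z"
    "Z \<le> a * ((real n * a) ^ k / fact k
       + (\<Sum>r=1..k. real (Suc k choose r) * S ^ r * ((real n * a) ^ (k - r) / fact (k - r))))"
    using cut_sum_bounds[OF q nL n1 S] unfolding Z_def a_def by auto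
  have Z0: "0 \<le> Z" by (rule order_trans[OF _ Zb(1)]) (use a in simp)
  have sum_up: "(\<Sum>T\<in>?T. ?c T) \<le> (1 + \<eta>) * ?H * Z"
    unfolding Z sum_distrib_left by (intro sum_mono c) auto
  have sum_lo: "(1 - \<eta>) * ?H * Z \<le> (\<Sum>T\<in>?T. ?c T)"
    unfolding Z sum_distrib_left by (intro sum_mono c) auto
  have B: "B = (\<Sum>T\<in>?T. ?c T) / ?c {}"
    unfolding B_def by (rule expectation_binomial_cut_points[OF ne])
  have Bup: "B \<le> (1 + 4 * \<eta>) * (Z / a)"
  proof -
    have "B \<le> ((1 + \<eta>) * ?H * Z) / ((1 - \<eta>) * ?H * a)"
      unfolding B using sum_up c0 lo_pos e0 W Z0 by (intro frac_le) auto
    also have "\<dots> = (1 + \<eta>) / (1 - \<eta>) * (Z / a)" using W by simp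
    also have "\<dots> \<le> (1 + 4 * \<eta>) * (Z / a)"
      using ratio_one_plus_bounds[OF e0 eta] Z0 a by (intro mult_right_mono) auto
    finally show ?thesis .
  qed
  have Blo: "(1 - 2 * \<eta>) * (Z / a) \<le> B"
  proof -
    have "(1 - 2 * \<eta>) * (Z / a) \<le> (1 - \<eta>) / (1 + \<eta>) * (Z / a)"
      using ratio_one_plus_bounds[OF e0 eta] Z0 a by (intro mult_right_mono) auto
    also have "\<dots> = ((1 - \<eta>) * ?H * Z) / ((1 + \<eta>) * ?H * a)" using W by simp
    also have "\<dots> \<le> B"
      unfolding B using sum_lo c0 cpos e0 W Z0 eta by (intro frac_le order_trans[OF _ sum_lo]) auto
    finally show ?thesis .
  qed
  have "(1 - real k ^ 2 / n) * ((real n * a) ^ k / fact k) = a ^ k * ((1 - real k ^ 2 / n) * (real n ^ k / fact k))"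
    by (simp add: power_mult_distrib)
  also have "\<dots> \<le> a ^ k * real ((n - 1) choose k)"
    using a by (intro mult_left_mono binomial_ge_power_fact n1) auto
  also have "\<dots> \<le> Z / a" using Zb(1) a by (simp add: pos_le_divide_eq mult_ac)
  finally have "(1 - 2 * \<eta>) * ((1 - real k ^ 2 / n) * ((real n * a) ^ k / fact k)) \<le> (1 - 2 * \<eta>) * (Z / a)"
    using eta by (intro mult_left_mono) auto
  then show "(1 - 2 * \<eta>) * ((1 - real k ^ 2 / n) * ((real n * a) ^ k / fact k)) \<le> B" using Blo by linarith
  have "Z / a \<le> (real n * a) ^ k / fact k
       + (\<Sum>r=1..k. real (Suc k choose r) * S ^ r * ((real n * a) ^ (k - r) / fact (k - r)))"
    using Zb(2) a by (simp add: pos_divide_le_eq mult.commute)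
  then have "(1 + 4 * \<eta>) * (Z / a) \<le> (1 + 4 * \<eta>) * ((real n * a) ^ k / fact k
       + (\<Sum>r=1..k. real (Suc k choose r) * S ^ r * ((real n * a) ^ (k - r) / fact (k - r))))"
    using e0 by (intro mult_left_mono) auto
  then show "B \<le> (1 + 4 * \<eta>) * ((real n * a) ^ k / fact k
       + (\<Sum>r=1..k. real (Suc k choose r) * S ^ r * ((real n * a) ^ (k - r) / fact (k - r))))"
    using Bup by linarith
qed

text \<open>The mean \<nu> is kept arbitrary so that one bound serves both Poisson laws in question.
  \<Lambda> dominates \<nu> as well as n a, so the powers of either can be compared.\<close>

lemma total_variation_quantitative:
  fixes n m Q L M :: nat and S \<nu> \<Lambda> q a \<eta> :: real
  defines "q \<equiv> real m / real (n + m)"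
  defines "a \<equiv> qpoch q L"
  defines "\<eta> \<equiv> 2 * (real Q)\<^sup>2 / n + 2 * n * q ^ L"
  assumes nm: "n \<le> m" and Q: "1 \<le> Q" "2 * Q\<^sup>2 \<le> n" and MQ: "Suc M * L * Suc L + L \<le> Q"
    and eta: "\<eta> \<le> 1 / 2" and S: "(\<Sum>g\<in>{1..L}. qpoch q g) \<le> S" "8 * S \<le> 1"
    and nu: "0 < \<nu>" "\<nu> \<le> \<Lambda>" "real n * a \<le> \<Lambda>"
  shows "total_variation (excess_components_pmf n m) (map_pmf int (poisson_pmf \<nu>))
     \<le> 200 * exp (5 * \<Lambda>) * (\<eta> + (real M)\<^sup>2 / n + S + \<bar>real n * a - \<nu>\<bar> + (1 / 2) ^ M)"
proof -
  have n0: "n > 0" using Q by (cases n) auto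
  have q: "0 \<le> q" "q < 1" unfolding q_def using n0 by auto
  have e0: "0 \<le> \<eta>" unfolding \<eta>_def using q by auto
  have a: "0 < a" unfolding a_def by (rule qpoch_pos[OF q])
  have "0 \<le> (\<Sum>g\<in>{1..L}. qpoch q g)" using qpoch_pos[OF q] by (intro sum_nonneg) (simp add: less_imp_le)
  then have S0: "0 \<le> S" using S(1) by linarith
  have \<Lambda>0: "0 < \<Lambda>" using nu by linarith
  define x where "x = real n * a"
  have x: "0 \<le> x" "x \<le> \<Lambda>" using a nu by (auto simp: x_def)
  define D where "D = \<bar>x - \<nu>\<bar>"
  define X where "X = map_pmf (\<lambda>\<sigma>. card (cut_points n \<sigma>)) (random_perm n m)"
  define B where "B k = measure_pmf.expectation X (\<lambda>w. real (w choose k))" for k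
  define G where "G y k = (\<Sum>r=1..k. real (Suc k choose r) * S ^ r * (y ^ (k - r) / fact (k - r)))" for y :: real and k
  define p where "p k = \<Lambda> ^ k / fact k" for k
  have kQ: "Suc k * L * Suc L + L \<le> Q" if "k \<le> M" for k
  proof -
    have "Suc k * L * Suc L \<le> Suc M * L * Suc L" using that by (intro mult_right_mono) auto
    then show ?thesis using MQ by linarith
  qed
  note fm = factorial_moment_bounds[OF nm Q kQ eta[unfolded \<eta>_def q_def] S(1)[unfolded q_def],
      folded q_def, folded a_def \<eta>_def, folded x_def G_def]
  have ne: "perms_with_inversions n m \<noteq> {}" using fm(1)[of 0] by simp
  have fin: "finite (set_pmf X)"
    using ne finite_perms_with_inversions by (simp add: X_def random_perm_def)
  have Beq: "B k = measure_pmf.expectation (random_perm n m) (\<lambda>\<sigma>. real (card (cut_points n \<sigma>) choose k))" for k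
    by (simp add: B_def X_def)
  have p0: "0 \<le> p k" for k using \<Lambda>0 by (simp add: p_def)
  have G0: "0 \<le> G \<Lambda> k" for k unfolding G_def using S0 \<Lambda>0 by (intro sum_nonneg) auto
  have Gm: "G x k \<le> G \<Lambda> k" for k
    unfolding G_def using S0 x by (intro sum_mono mult_left_mono divide_right_mono power_mono) auto
  have xp: "0 \<le> x ^ k / fact k" "x ^ k / fact k \<le> p k" for k
    unfolding p_def using x by (auto intro!: divide_right_mono power_mono)
  have delta: "\<bar>B k - \<nu> ^ k / fact k\<bar> \<le> (4 * \<eta> + (real M)\<^sup>2 / n) * p k + 3 * G \<Lambda> k + D * (real k * \<Lambda> ^ (k - 1) / fact k)"
    if k: "k \<le> M" for k
  proof -
    let ?y = "x ^ k / fact k"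
    have up: "B k \<le> (1 + 4 * \<eta>) * (?y + G x k)" and lo: "(1 - 2 * \<eta>) * ((1 - real k ^ 2 / n) * ?y) \<le> B k"
      using fm(2,3)[OF k] unfolding Beq by auto
    have "(1 + 4 * \<eta>) * (?y + G x k) \<le> (1 + 4 * \<eta>) * (?y + G \<Lambda> k)"
      using Gm e0 by (intro mult_left_mono) auto
    also have "\<dots> = ?y + 4 * \<eta> * ?y + (1 + 4 * \<eta>) * G \<Lambda> k" by (simp add: algebra_simps)
    also have "\<dots> \<le> ?y + 4 * \<eta> * p k + 3 * G \<Lambda> k"
      using eta e0 xp G0 by (intro add_mono mult_left_mono mult_right_mono order_refl) auto
    finally have up': "B k - ?y \<le> 4 * \<eta> * p k + 3 * G \<Lambda> k" using up by linarith
    have kM: "real k ^ 2 / n \<le> (real M)\<^sup>2 / n" using k by (intro divide_right_mono power_mono) auto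
    have "?y - (2 * \<eta> + (real M)\<^sup>2 / n) * p k \<le> ?y - (2 * \<eta> + real k ^ 2 / n) * ?y"
      using kM e0 xp by (intro diff_left_mono mult_mono) auto
    also have "\<dots> \<le> ?y - (2 * \<eta> + real k ^ 2 / n) * ?y + 2 * \<eta> * (real k ^ 2 / n) * ?y"
    proof -
      have "0 \<le> 2 * \<eta> * (real k ^ 2 / n) * ?y"
        using e0 xp(1)[of k] by (intro mult_nonneg_nonneg) auto
      then show ?thesis by linarith
    qed
    also have "\<dots> = (1 - 2 * \<eta>) * ((1 - real k ^ 2 / n) * ?y)" by (simp only: algebra_simps)
    finally have lo': "?y - B k \<le> (2 * \<eta> + (real M)\<^sup>2 / n) * p k" using lo by linarith
    have "\<bar>?y - \<nu> ^ k / fact k\<bar> = \<bar>x ^ k - \<nu> ^ k\<bar> / fact k" by (simp flip: diff_divide_distrib)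
    also have "\<dots> \<le> (real k * \<Lambda> ^ (k - 1) * D) / fact k"
      unfolding D_def using x nu by (intro divide_right_mono power_diff_le) auto
    finally have "\<bar>?y - \<nu> ^ k / fact k\<bar> \<le> D * (real k * \<Lambda> ^ (k - 1) / fact k)" by (simp add: mult_ac)
    moreover have "(2 * \<eta> + (real M)\<^sup>2 / n) * p k \<le> (4 * \<eta> + (real M)\<^sup>2 / n) * p k"
      "4 * \<eta> * p k \<le> (4 * \<eta> + (real M)\<^sup>2 / n) * p k"
      using e0 p0 by (intro mult_right_mono; simp)+
    ultimately show ?thesis using up' lo' G0[of k] by linarith
  qed
  have s1: "(\<Sum>k\<le>M. 2 ^ k * p k) \<le> exp (2 * \<Lambda>)"
    using sum_power_fact_le_exp[of "2 * \<Lambda>" M] \<Lambda>0 by (simp add: p_def power_mult_distrib)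
  have s2: "(\<Sum>k\<le>M. 2 ^ k * G \<Lambda> k) \<le> 16 * S * exp (4 * \<Lambda>)"
    unfolding G_def by (rule sum_short_gap_terms_le) (use S S0 \<Lambda>0 in auto)
  have s3: "(\<Sum>k\<le>M. 2 ^ k * (real k * \<Lambda> ^ (k - 1) / fact k)) \<le> 2 * exp (2 * \<Lambda>)"
  proof -
    have "(\<Sum>k\<le>M. 2 ^ k * (real k * \<Lambda> ^ (k - 1) / fact k)) = (\<Sum>k=1..M. 2 ^ k * (real k * \<Lambda> ^ (k - 1) / fact k))"
      by (rule sum.mono_neutral_right) (auto simp: Suc_le_eq)
    also have "\<dots> = (\<Sum>k<M. 2 ^ Suc k * (real (Suc k) * \<Lambda> ^ k / fact (Suc k)))"
      by (rule sum.reindex_bij_witness[of _ Suc "\<lambda>r. r - 1"]) auto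
    also have "\<dots> = (\<Sum>k<M. 2 * (2 ^ k * p k))"
    proof (intro sum.cong refl)
      fix k
      have "real (Suc k) * \<Lambda> ^ k / fact (Suc k) = p k" unfolding p_def fact_Suc
        by (simp del: of_nat_Suc)
      then show "2 ^ Suc k * (real (Suc k) * \<Lambda> ^ k / fact (Suc k)) = 2 * (2 ^ k * p k)" by simp
    qed
    also have "\<dots> = 2 * (\<Sum>k<M. 2 ^ k * p k)" by (simp only: sum_distrib_left)
    also have "(\<Sum>k<M. 2 ^ k * p k) \<le> (\<Sum>k\<le>M. 2 ^ k * p k)" using p0 by (intro sum_mono2) auto
    finally show ?thesis using s1 by linarith
  qed
  have "(\<Sum>k\<le>M. 2 ^ k * \<bar>B k - \<nu> ^ k / fact k\<bar>) \<le>
     (\<Sum>k\<le>M. 2 ^ k * ((4 * \<eta> + (real M)\<^sup>2 / n) * p k + 3 * G \<Lambda> k + D * (real k * \<Lambda> ^ (k - 1) / fact k)))"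
    by (intro sum_mono mult_left_mono delta) auto
  also have "\<dots> = (\<Sum>k\<le>M. (4 * \<eta> + (real M)\<^sup>2 / n) * (2 ^ k * p k) + 3 * (2 ^ k * G \<Lambda> k) + D * (2 ^ k * (real k * \<Lambda> ^ (k - 1) / fact k)))"
    by (intro sum.cong refl) (simp add: algebra_simps)
  also have "\<dots> = (4 * \<eta> + (real M)\<^sup>2 / n) * (\<Sum>k\<le>M. 2 ^ k * p k) + 3 * (\<Sum>k\<le>M. 2 ^ k * G \<Lambda> k)
      + D * (\<Sum>k\<le>M. 2 ^ k * (real k * \<Lambda> ^ (k - 1) / fact k))"
    by (simp only: sum.distrib sum_distrib_left)
  also have "\<dots> \<le> (4 * \<eta> + (real M)\<^sup>2 / n) * exp (2 * \<Lambda>) + 3 * (16 * S * exp (4 * \<Lambda>)) + D * (2 * exp (2 * \<Lambda>))"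
    using s1 s2 s3 e0 by (intro add_mono mult_left_mono) (auto simp: D_def)
  also have "\<dots> \<le> (4 * \<eta> + (real M)\<^sup>2 / n) * exp (5 * \<Lambda>) + 3 * (16 * S * exp (5 * \<Lambda>)) + D * (2 * exp (5 * \<Lambda>))"
    using e0 S0 \<Lambda>0 by (intro add_mono mult_left_mono) (auto simp: D_def)
  finally have main: "(\<Sum>k\<le>M. 2 ^ k * \<bar>B k - \<nu> ^ k / fact k\<bar>)
      \<le> (4 * \<eta> + (real M)\<^sup>2 / n) * exp (5 * \<Lambda>) + 3 * (16 * S * exp (5 * \<Lambda>)) + D * (2 * exp (5 * \<Lambda>))" .
  \<comment> \<open>Trading (2 \<Lambda>)^M for 2^(-M) (4 \<Lambda>)^M makes the remainder
    geometrically small in M without any relation between M and \<Lambda>.\<close>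
  have rem: "6 * exp \<nu> * ((2 * \<nu>) ^ M / fact M) \<le> 6 * exp (5 * \<Lambda>) * (1 / 2) ^ M"
  proof -
    have "(2 * \<nu>) ^ M / fact M \<le> (2 * \<Lambda>) ^ M / fact M"
      using nu by (intro divide_right_mono power_mono) auto
    also have "\<dots> = (1 / 2) ^ M * ((4 * \<Lambda>) ^ M / fact M)"
    proof -
      have "2 * \<Lambda> = (1 / 2) * (4 * \<Lambda>)" by simp
      then have "(2 * \<Lambda>) ^ M = (1 / 2) ^ M * (4 * \<Lambda>) ^ M" by (metis power_mult_distrib)
      then show ?thesis by simp
    qed
    also have "(4 * \<Lambda>) ^ M / fact M \<le> exp (4 * \<Lambda>)"
    proof -
      have "(\<Sum>k\<in>{M}. (4 * \<Lambda>) ^ k / fact k) \<le> (\<Sum>k\<le>M. (4 * \<Lambda>) ^ k / fact k)"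
        using \<Lambda>0 by (intro sum_mono2) auto
      then show ?thesis using sum_power_fact_le_exp[of "4 * \<Lambda>" M] \<Lambda>0 by simp
    qed
    finally have "(2 * \<nu>) ^ M / fact M \<le> (1 / 2) ^ M * exp (4 * \<Lambda>)" by simp
    then have "exp \<nu> * ((2 * \<nu>) ^ M / fact M) \<le> exp \<Lambda> * ((1 / 2) ^ M * exp (4 * \<Lambda>))"
      using nu by (intro mult_mono) auto
    also have "\<dots> = exp (5 * \<Lambda>) * (1 / 2) ^ M" by (simp flip: exp_add)
    finally show ?thesis by simp
  qed
  have "total_variation (excess_components_pmf n m) (map_pmf int (poisson_pmf \<nu>)) \<le>
     4 * (\<Sum>k\<le>M. 2 ^ k * \<bar>B k - \<nu> ^ k / fact k\<bar>) + 6 * exp \<nu> * ((2 * \<nu>) ^ M / fact M)"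
    using total_variation_poisson_factorial_moments[OF fin nu(1), of M] n0
    unfolding excess_components_eq_cut_points[OF ne Suc_leI[OF n0, folded One_nat_def]] X_def[symmetric] B_def by simp
  also have "\<dots> \<le> 4 * ((4 * \<eta> + (real M)\<^sup>2 / n) * exp (5 * \<Lambda>) + 3 * (16 * S * exp (5 * \<Lambda>)) + D * (2 * exp (5 * \<Lambda>)))
      + 6 * exp (5 * \<Lambda>) * (1 / 2) ^ M"
    by (intro add_mono mult_left_mono main rem) simp
  also have "\<dots> = exp (5 * \<Lambda>) * (16 * \<eta> + 4 * ((real M)\<^sup>2 / n) + 192 * S + 8 * D + 6 * (1 / 2) ^ M)"
    by (simp add: algebra_simps)
  also have "\<dots> \<le> exp (5 * \<Lambda>) * (200 * (\<eta> + (real M)\<^sup>2 / n + S + D + (1 / 2) ^ M))"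
  proof (rule mult_left_mono)
    have "16 * e + 4 * s + 192 * t + 8 * u + 6 * v \<le> 200 * (e + s + t + u + v)"
      if "0 \<le> e" "0 \<le> s" "0 \<le> t" "0 \<le> u" "0 \<le> v" for e s t u v :: real
      unfolding distrib_left using that by (intro add_mono mult_right_mono) auto
    then show "16 * \<eta> + 4 * ((real M)\<^sup>2 / n) + 192 * S + 8 * D + 6 * (1 / 2) ^ M
        \<le> 200 * (\<eta> + (real M)\<^sup>2 / n + S + D + (1 / 2) ^ M)"
      by this (use e0 S0 in \<open>simp_all add: D_def\<close>)
  qed simp
  finally show ?thesis by (simp only: D_def x_def mult_ac)
qed

section \<open>Truncation of the infinite product and the total weight of short gaps\<close>

lemma one_minus_sum_le_prod:
  fixes x :: "nat \<Rightarrow> real"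
  assumes "\<And>i. 0 \<le> x i" "\<And>i. x i \<le> 1"
  shows "1 - (\<Sum>i<N. x i) \<le> (\<Prod>i<N. 1 - x i)"
proof (induction N)
  case (Suc N)
  have "(\<Prod>i<N. 1 - x i) \<le> 1" by (rule prod_le_1) (use assms in auto)
  then have "(\<Prod>i<N. 1 - x i) * x N \<le> 1 * x N" using assms by (intro mult_right_mono) auto
  then show ?case using Suc by (simp add: algebra_simps)
qed simp

text \<open>The product of the factors beyond L is at least 1 minus the geometric tail of the q^i
  with i > L, so truncation costs a relative error of at most q^L / (1 - q).\<close>

lemma qpoch_truncation:
  fixes q :: real
  assumes q: "0 \<le> q" "q < 1"
  shows "(\<Prod>j. 1 - q ^ Suc j) \<le> qpoch q L"
    and "qpoch q L * (1 - q ^ L / (1 - q)) \<le> (\<Prod>j. 1 - q ^ Suc j)"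
proof -
  have lim: "(\<lambda>N. qpoch q N) \<longlonglongrightarrow> (\<Prod>j. 1 - q ^ Suc j)"
    unfolding qpoch_def by (rule qprod_LIMSEQ(1)[OF q])
  have q1: "q ^ i \<le> 1" for i using q by (simp add: power_le_one)
  have split: "qpoch q (L + N) = qpoch q L * (\<Prod>i<N. 1 - q ^ (L + Suc i))" for N
    by (induction N) (simp_all add: qpoch_Suc mult.assoc)
  show "(\<Prod>j. 1 - q ^ Suc j) \<le> qpoch q L"
    by (rule LIMSEQ_le_const2[OF lim]) (use qpoch_antimono[OF q] in blast)
  have "qpoch q L * (1 - q ^ L / (1 - q)) \<le> qpoch q (L + N)" for N
  proof -
    have "(\<Sum>i<N. q ^ (L + Suc i)) = q ^ Suc L * (\<Sum>i<N. q ^ i)"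
      by (simp add: sum_distrib_left power_add mult_ac)
    also have "\<dots> \<le> q ^ L * (1 / (1 - q))"
    proof (rule mult_mono)
      show "q ^ Suc L \<le> q ^ L" using q by (simp add: mult_left_le_one_le)
      have "(\<Sum>i<N. q ^ i) = (1 - q ^ N) / (1 - q)" using q by (simp add: sum_gp_strict)
      also have "\<dots> \<le> 1 / (1 - q)" using q by (intro divide_right_mono) auto
      finally show "(\<Sum>i<N. q ^ i) \<le> 1 / (1 - q)" .
    qed (use q in \<open>auto intro!: sum_nonneg\<close>)
    finally have "1 - q ^ L / (1 - q) \<le> 1 - (\<Sum>i<N. q ^ (L + Suc i))" by simp
    also have "\<dots> \<le> (\<Prod>i<N. 1 - q ^ (L + Suc i))"
      by (rule one_minus_sum_le_prod) (rule zero_le_power[OF q(1)], rule q1)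
    finally show ?thesis unfolding split using qpoch_pos[OF q, of L] by (intro mult_left_mono) auto
  qed
  then show "qpoch q L * (1 - q ^ L / (1 - q)) \<le> (\<Prod>j. 1 - q ^ Suc j)"
    by (intro LIMSEQ_le_const[OF LIMSEQ_ignore_initial_segment[OF lim, of L]]) (auto simp: add.commute)
qed

text \<open>Gaps up to four count at most \<open>1 - q\<close> each, longer ones at most \<open>qpoch q 5 \<le> 5! (1 - q)\<^sup>5\<close>.\<close>
lemma sum_qpoch_le:
  fixes q :: real
  assumes q: "0 \<le> q" "q < 1"
  shows "(\<Sum>g\<in>{1..L}. qpoch q g) \<le> 4 * (1 - q) + 120 * (1 - q) ^ 5 * real L"
proof -
  have f: "0 \<le> 1 - q ^ i \<and> 1 - q ^ i \<le> real i * (1 - q)" for i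
  proof -
    have "1 + real i * (q - 1) \<le> (1 + (q - 1)) ^ i" by (rule Bernoulli_inequality) (use q in auto)
    then show ?thesis using q by (simp add: power_le_one algebra_simps)
  qed
  have p1: "qpoch q 1 = 1 - q" by (simp add: qpoch_def)
  \<comment> \<open>The fifth power suits L of order (log n)^3 and 1 - q of order 1 / log n: then L
    (1 - q)^5 is of smaller order than 1 - q.\<close>
  have p5: "qpoch q 5 \<le> 120 * (1 - q) ^ 5"
  proof -
    have "qpoch q 5 \<le> (\<Prod>i\<in>{1..5::nat}. real i * (1 - q))"
      unfolding qpoch_def using f by (intro prod_mono) auto
    also have "\<dots> = (\<Prod>i\<in>{1..5::nat}. real i) * (1 - q) ^ 5" by (simp add: prod.distrib)
    also have "(\<Prod>i\<in>{1..5::nat}. real i) = 120" by (simp add: eval_nat_numeral prod.nat_ivl_Suc')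
    finally show ?thesis .
  qed
  have "(\<Sum>g\<in>{1..L}. qpoch q g) \<le> (\<Sum>g\<in>{1..L}. (if g \<le> 4 then 1 - q else 0) + 120 * (1 - q) ^ 5)"
  proof (rule sum_mono)
    fix g assume g: "g \<in> {1..L}"
    show "qpoch q g \<le> (if g \<le> 4 then 1 - q else 0) + 120 * (1 - q) ^ 5"
    proof (cases "g \<le> 4")
      case True
      then show ?thesis using qpoch_antimono[OF q, of 1 g] g p1 q by (simp add: add_increasing2)
    next
      case False
      then show ?thesis using qpoch_antimono[OF q, of 5 g] p5 by simp
    qed
  qed
  also have "\<dots> = (\<Sum>g\<in>{1..L}. if g \<le> 4 then 1 - q else 0) + 120 * (1 - q) ^ 5 * real L"
    by (simp add: sum.distrib)
  also have "(\<Sum>g\<in>{1..L}. if g \<le> 4 then 1 - q else 0) \<le> 4 * (1 - q)"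
  proof -
    have "(\<Sum>g\<in>{1..L}. if g \<le> 4 then 1 - q else 0) = (\<Sum>g\<in>{g \<in> {1..L}. g \<le> 4}. 1 - q)"
      by (rule sum.inter_filter[symmetric]) simp
    also have "\<dots> \<le> (\<Sum>g\<in>{1..4::nat}. 1 - q)" using q by (intro sum_mono2) auto
    finally show ?thesis by simp
  qed
  finally show ?thesis by simp
qed

text \<open>With x = log n one has 1 - q \<ge> 1 / (2 x), so L about x^3 yields q^L \<le> exp (- x^2
  / 2), which beats every power of n. M about x gives 2^(-M) \<le> 1 / x. The budget Q is then at
  most R, a polynomial in x, and all conditions in \<open>large\<close> hold for large n.\<close>

lemma total_variation_log_bound:
  fixes n m :: nat and \<alpha> \<nu> lam \<Lambda> x R :: real
  defines "x \<equiv> ln (real n)"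
  defines "R \<equiv> (x + 2) * (x ^ 3 + 1) * (x ^ 3 + 2) + (x ^ 3 + 1)"
  assumes \<alpha>: "\<alpha> = real m / real n" "x / 3 \<le> \<alpha>" "\<alpha> \<le> x"
    and lam: "lam = real n * (\<Prod>j. 1 - (\<alpha> / (\<alpha> + 1)) ^ Suc j)"
    and x: "208 \<le> x"
    and large: "4 * R\<^sup>2 * x \<le> real n" "8 * real n * x * exp (- (x\<^sup>2 / 2)) \<le> 1"
       "(x + 1)\<^sup>2 * x \<le> real n" "12 / x + 120 * (3 / x) ^ 5 * (x ^ 3 + 1) \<le> 13 / x"
    and \<Lambda>: "2 * lam \<le> \<Lambda>" and \<nu>: "0 < \<nu>" "\<nu> \<le> \<Lambda>"
  shows "total_variation (excess_components_pmf n m) (map_pmf int (poisson_pmf \<nu>))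
     \<le> 200 * exp (5 * \<Lambda>) * (16 / x + \<bar>lam - \<nu>\<bar> + 2 * \<Lambda> * x * exp (- (x\<^sup>2 / 2)))"
proof -
  define L where "L = nat \<lceil>x ^ 3\<rceil>"
  define M where "M = nat \<lceil>x\<rceil>"
  define Q where "Q = Suc M * L * Suc L + L"
  define q where "q = real m / real (n + m)"
  define a where "a = qpoch q L"
  define P where "P = (\<Prod>j. 1 - q ^ Suc j)"
  define T where "T = exp (- (x\<^sup>2 / 2))"
  have n0: "n > 0" using x unfolding x_def by (cases n) auto
  have \<alpha>1: "1 \<le> \<alpha>" using \<alpha>(2) x by linarith
  have q_eq: "q = \<alpha> / (\<alpha> + 1)" unfolding q_def \<alpha>(1) using n0 by (simp add: field_simps)
  have p_eq: "1 - q = 1 / (\<alpha> + 1)" unfolding q_eq using \<alpha>1 by (simp add: field_simps)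
  have q: "0 \<le> q" "q < 1" unfolding q_eq using \<alpha>1 by auto
  have p_hi: "1 - q \<le> 3 / x"
  proof -
    have "1 / (\<alpha> + 1) \<le> 1 / (x / 3)"
      using \<alpha>(2) \<alpha>1 x by (intro divide_left_mono mult_pos_pos) auto
    then show ?thesis unfolding p_eq by simp
  qed
  have p_lo: "1 / (2 * x) \<le> 1 - q"
    unfolding p_eq using \<alpha>(3) x \<alpha>1 by (intro divide_left_mono mult_pos_pos) auto
  have x3: "0 \<le> x ^ 3" using x by simp
  have L: "x ^ 3 \<le> real L" "real L \<le> x ^ 3 + 1"
    unfolding L_def using x3 by linarith+
  have M: "x \<le> real M" "real M \<le> x + 1"
    unfolding M_def using x by linarith+
  have qL: "q ^ L \<le> T"
  proof -
    have "q ^ L \<le> exp (- (1 - q)) ^ L"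
      using q exp_ge_add_one_self[of "- (1 - q)"] by (intro power_mono) auto
    also have "\<dots> = exp (- (real L * (1 - q)))" by (simp add: exp_of_nat_mult[symmetric] algebra_simps)
    also have "\<dots> \<le> T"
    proof -
      have "x ^ 3 * (1 / (2 * x)) \<le> real L * (1 - q)" using L p_lo x by (intro mult_mono) auto
      moreover have "x ^ 3 * (1 / (2 * x)) = x\<^sup>2 / 2" using x by (simp add: power3_eq_cube power2_eq_square)
      ultimately show ?thesis by (simp add: T_def)
    qed
    finally show ?thesis .
  qed
  have T0: "0 < T" by (simp add: T_def)
  have nT: "8 * real n * x * T \<le> 1" using large(2) by (simp add: T_def)
  have xT: "8 * x * T \<le> 1"
  proof -
    have "1 * (8 * x * T) \<le> real n * (8 * x * T)" using n0 x T0 by (intro mult_right_mono) auto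
    then show ?thesis using nT by (simp add: mult_ac)
  qed
  have QR: "real Q \<le> R"
  proof -
    have "real Q = (real M + 1) * real L * (real L + 1) + real L" by (simp add: Q_def algebra_simps)
    also have "\<dots> \<le> (x + 2) * (x ^ 3 + 1) * (x ^ 3 + 2) + (x ^ 3 + 1)"
      by (rule add_mono[OF mult_mono[OF mult_mono]]) (use L M x x3 in auto)
    finally show ?thesis by (simp add: R_def)
  qed
  have Q2: "4 * (real Q)\<^sup>2 * x \<le> real n"
  proof -
    have "4 * (real Q)\<^sup>2 * x \<le> 4 * R\<^sup>2 * x" using QR x by (intro mult_right_mono mult_left_mono power_mono) auto
    then show ?thesis using large(1) by linarith
  qed
  have "L \<ge> 1"
  proof -
    have "1 \<le> x ^ 3" using x by (intro one_le_power) auto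
    then show ?thesis using L by linarith
  qed
  then have Q1: "1 \<le> Q" by (simp add: Q_def)
  have "2 * (real Q)\<^sup>2 * 1 \<le> 2 * (real Q)\<^sup>2 * (2 * x)" using x by (intro mult_left_mono) auto
  then have "2 * (real Q)\<^sup>2 \<le> real n" using Q2 by linarith
  then have Q3: "2 * Q\<^sup>2 \<le> n" by (simp flip: of_nat_power of_nat_le_iff[where ?'a = real])
  have nm: "n \<le> m"
  proof -
    have "real n \<le> real m" using \<alpha>1 n0 unfolding \<alpha>(1) by (simp add: pos_le_divide_eq)
    then show ?thesis by simp
  qed
  have eta: "2 * (real Q)\<^sup>2 / n + 2 * n * q ^ L \<le> 1 / x"
  proof -
    have "2 * (real Q)\<^sup>2 / n \<le> 1 / (2 * x)" using Q2 n0 x by (simp add: field_simps)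
    moreover have "2 * n * q ^ L \<le> 1 / (4 * x)"
    proof -
      have "2 * n * q ^ L \<le> 2 * n * T" using qL by (intro mult_left_mono) auto
      also have "\<dots> \<le> 1 / (4 * x)" using nT x by (simp add: field_simps)
      finally show ?thesis .
    qed
    moreover have "1 / (2 * x) + 1 / (4 * x) \<le> 1 / x" using x by (simp add: field_simps)
    ultimately show ?thesis by linarith
  qed
  have "1 / x \<le> 1 / 2" using x by (intro divide_left_mono) auto
  then have eta2: "2 * (real Q)\<^sup>2 / n + 2 * n * q ^ L \<le> 1 / 2" using eta by linarith
  have S: "(\<Sum>g\<in>{1..L}. qpoch q g) \<le> 13 / x"
  proof -
    have "(\<Sum>g\<in>{1..L}. qpoch q g) \<le> 4 * (1 - q) + 120 * (1 - q) ^ 5 * real L" by (rule sum_qpoch_le[OF q])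
    also have "\<dots> \<le> 4 * (3 / x) + 120 * (3 / x) ^ 5 * (x ^ 3 + 1)"
      using p_hi L q x by (intro add_mono mult_mono mult_left_mono power_mono) auto
    also have "\<dots> \<le> 13 / x" using large(4) by simp
    finally show ?thesis .
  qed
  have S8: "8 * (13 / x) \<le> 1" using x by (simp add: field_simps)
  have a0: "0 < a" unfolding a_def by (rule qpoch_pos[OF q])
  have lamP: "lam = real n * P" unfolding lam P_def q_eq by simp
  have small: "q ^ L / (1 - q) \<le> 2 * x * T"
  proof -
    have "q ^ L / (1 - q) \<le> T / (1 / (2 * x))" using qL p_lo T0 x by (intro frac_le) auto
    then show ?thesis by (simp add: mult_ac)
  qed
  have Pa: "P \<le> a" "a * (1 - 2 * x * T) \<le> P"
  proof -
    show "P \<le> a" unfolding P_def a_def by (rule qpoch_truncation(1)[OF q])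
    have "a * (1 - 2 * x * T) \<le> a * (1 - q ^ L / (1 - q))" using small a0 by (intro mult_left_mono) auto
    also have "\<dots> \<le> P" unfolding P_def a_def by (rule qpoch_truncation(2)[OF q])
    finally show "a * (1 - 2 * x * T) \<le> P" .
  qed
  \<comment> \<open>This is why 2 \<open>lam\<close> is bounded by \<Lambda>: the latter must also
    dominate n a, which exceeds \<open>lam\<close> by a factor of at most 2.\<close>
  have "a * (2 * x * T) \<le> a * (1 / 2)" using xT a0 by (intro mult_left_mono) auto
  then have aP: "a \<le> 2 * P" using Pa(2) by (simp add: algebra_simps)
  then have "real n * a \<le> real n * (2 * P)" by (intro mult_left_mono) auto
  then have na: "real n * a \<le> \<Lambda>" using \<Lambda> unfolding lamP by simp
  have "\<bar>real n * a - lam\<bar> = real n * (a - P)"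
    using Pa(1) unfolding lamP by (simp add: abs_mult flip: right_diff_distrib)
  also have "\<dots> \<le> real n * (a * (2 * x * T))"
    using Pa(2) by (intro mult_left_mono) (auto simp: algebra_simps)
  also have "\<dots> = (real n * a) * (2 * x * T)" by simp
  also have "\<dots> \<le> \<Lambda> * (2 * x * T)" using na x T0 by (intro mult_right_mono) auto
  finally have D: "\<bar>real n * a - \<nu>\<bar> \<le> \<bar>lam - \<nu>\<bar> + 2 * \<Lambda> * x * T" by (simp add: mult_ac)
  have M2: "(real M)\<^sup>2 / n \<le> 1 / x"
  proof -
    have "(real M)\<^sup>2 * x \<le> (x + 1)\<^sup>2 * x" using M x by (intro mult_right_mono power_mono) auto
    then have "(real M)\<^sup>2 * x \<le> real n" using large(3) by linarith
    then show ?thesis using n0 x by (simp add: field_simps)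
  qed
  have half: "(1 / 2) ^ M \<le> 1 / x"
  proof -
    have "real M \<le> 2 ^ M" using less_exp[of M] by (metis less_imp_le of_nat_le_iff of_nat_numeral of_nat_power)
    then have "x \<le> 2 ^ M" using M(1) by linarith
    then have "1 / 2 ^ M \<le> 1 / x" using x by (intro divide_left_mono mult_pos_pos) auto
    then show ?thesis by (simp add: power_divide)
  qed
  have "total_variation (excess_components_pmf n m) (map_pmf int (poisson_pmf \<nu>))
     \<le> 200 * exp (5 * \<Lambda>) * ((2 * (real Q)\<^sup>2 / n + 2 * n * q ^ L) + (real M)\<^sup>2 / n + 13 / x + \<bar>real n * a - \<nu>\<bar> + (1 / 2) ^ M)"
    using total_variation_quantitative[OF nm Q1 Q3 eq_refl[OF Q_def[symmetric]] eta2[unfolded q_def] S[unfolded q_def] S8 \<nu> na[unfolded a_def q_def]]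
    unfolding q_def a_def .
  also have "\<dots> \<le> 200 * exp (5 * \<Lambda>) * (1 / x + 1 / x + 13 / x + (\<bar>lam - \<nu>\<bar> + 2 * \<Lambda> * x * T) + 1 / x)"
    by (intro mult_left_mono add_mono eta M2 D half order_refl) simp
  also have "1 / x + 1 / x + 13 / x + (\<bar>lam - \<nu>\<bar> + 2 * \<Lambda> * x * T) + 1 / x = 16 / x + \<bar>lam - \<nu>\<bar> + 2 * \<Lambda> * x * T"
    by (simp add: add_divide_distrib[symmetric] del: add_divide_distrib) 
  finally show ?thesis unfolding T_def .
qed

section \<open>The critical window\<close>

text \<open>With z = log (1 + 1 / \<alpha>) one has q = exp (- z) and 1 / z = \<alpha> + 1/2 + O(1 /
  \<alpha>). The 1/2 contributes - pi^2 / 12, which cancels the constant of the window, and log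
  \<alpha> / 2 cancels its log log term, so that only - \<mu> and errors remain.\<close>

lemma lam_expansion:
  fixes \<alpha> \<mu> :: "nat \<Rightarrow> real"
  defines "lam \<equiv> \<lambda>n. real n * (\<Prod>j. 1 - (\<alpha> n / (\<alpha> n + 1)) ^ Suc j)"
  assumes \<alpha>: "\<forall>\<^sub>F n in sequentially.
      \<alpha> n = 6 / pi\<^sup>2 * (ln (real n) + 1/2 * ln (ln (real n)) + 1/2 * ln (12 / pi) - pi\<^sup>2 / 12 + \<mu> n)"
    and mu: "\<mu> \<in> o(\<lambda>n. ln (ln (ln (real n))))"
    and lo: "\<forall>\<^sub>F n in sequentially. ln (real n) / 3 \<le> \<alpha> n"
  shows "(\<lambda>n. ln (lam n) + \<mu> n) \<in> O(\<lambda>n. ln (ln (real n)) / ln (real n))"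
    and "\<forall>\<^sub>F n in sequentially. 0 < lam n"
proof -
  let ?g = "\<lambda>n. ln (ln (real n)) / ln (real n)"
  let ?z = "\<lambda>x::real. ln (1 + 1 / x)"
  have top: "filterlim \<alpha> at_top sequentially"
    by (rule filterlim_at_top_mono[OF _ lo]) real_asymp
  have pos: "\<forall>\<^sub>F n in sequentially. 1 \<le> \<alpha> n" using top by (simp add: filterlim_at_top)
  have inv: "(\<lambda>n. 1 / \<alpha> n) \<in> O(?g)"
  proof -
    have "(\<lambda>n. 1 / \<alpha> n) \<in> O(\<lambda>n. 1 / ln (real n))"
    proof (rule bigoI[where c = 3])
      have "\<forall>\<^sub>F n in sequentially. 1 \<le> ln (real n)" by real_asymp
      then show "\<forall>\<^sub>F n in sequentially. norm (1 / \<alpha> n) \<le> 3 * norm (1 / ln (real n))"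
        using lo pos by eventually_elim (simp add: field_simps)
    qed
    also have "(\<lambda>n. 1 / ln (real n)) \<in> O(?g)" by real_asymp
    finally show ?thesis .
  qed
  have comp: "(\<lambda>n. f (\<alpha> n)) \<in> O(?g)" if "f \<in> O[at_top](\<lambda>x. 1 / x)" for f :: "real \<Rightarrow> real"
    using landau_o.big.compose[OF that top] inv by (rule landau_o.big_trans)
  define e1 where "e1 n = ln (\<Prod>j. 1 - (\<alpha> n / (\<alpha> n + 1)) ^ Suc j) - (- pi\<^sup>2 / (6 * ?z (\<alpha> n)) + ln (2 * pi / ?z (\<alpha> n)) / 2)" for n
  have qz: "\<alpha> n / (\<alpha> n + 1) = exp (- ?z (\<alpha> n)) \<and> 0 < ?z (\<alpha> n)" if "1 \<le> \<alpha> n" for n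
  proof -
    have "exp (- ?z (\<alpha> n)) = 1 / (1 + 1 / \<alpha> n)" using that by (simp add: exp_minus inverse_eq_divide add_pos_pos)
    also have "\<dots> = \<alpha> n / (\<alpha> n + 1)" using that by (simp add: field_simps)
    finally show ?thesis using that by (simp add: ln_gt_zero)
  qed
  have e1: "e1 \<in> O(?g)"
  proof -
    have "e1 \<in> O(\<lambda>n. ?z (\<alpha> n))"
    proof (rule bigoI[where c = 2])
      show "\<forall>\<^sub>F n in sequentially. norm (e1 n) \<le> 2 * norm (?z (\<alpha> n))"
        using pos
      proof eventually_elim
        case (elim n)
        then show ?case using ln_qprod_asymp[of "?z (\<alpha> n)"] qz[OF elim] by (simp add: e1_def)
      qed
    qed
    also have "(\<lambda>n. ?z (\<alpha> n)) \<in> O(?g)" by (rule comp) real_asymp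
    finally show ?thesis .
  qed
  define e2 where "e2 x = 1 / ?z x - x - 1 / 2" for x
  define e3 where "e3 x = ln (1 / ?z x) - ln x" for x
  have e2: "(\<lambda>n. e2 (\<alpha> n)) \<in> O(?g)" unfolding e2_def by (rule comp) real_asymp
  have e3: "(\<lambda>n. e3 (\<alpha> n)) \<in> O(?g)" unfolding e3_def by (rule comp) real_asymp
  \<comment> \<open>The relative deviation of pi^2 \<alpha> / 6 from log n. Its size, log log n /
    log n, dominates the other errors, which are O(1 / \<alpha>).\<close>
  define \<rho> where "\<rho> n = (1/2 * ln (ln (real n)) + 1/2 * ln (12 / pi) - pi\<^sup>2 / 12 + \<mu> n) / ln (real n)" for n
  have \<rho>: "\<rho> \<in> O(?g)"
  proof -
    have "\<mu> \<in> O(\<lambda>n. ln (ln (ln (real n))))" using mu by (rule landau_o.small_imp_big)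
    also have "(\<lambda>n. ln (ln (ln (real n)))) \<in> O(\<lambda>n. ln (ln (real n)))" by real_asymp
    finally have "\<mu> \<in> O(\<lambda>n. ln (ln (real n)))" .
    moreover have "(\<lambda>n. 1/2 * ln (ln (real n)) + 1/2 * ln (12 / pi) - pi\<^sup>2 / 12) \<in> O(\<lambda>n. ln (ln (real n)))"
      by real_asymp
    ultimately have "(\<lambda>n. 1/2 * ln (ln (real n)) + 1/2 * ln (12 / pi) - pi\<^sup>2 / 12 + \<mu> n) \<in> O(\<lambda>n. ln (ln (real n)))"
      by (rule sum_in_bigo(1)[rotated])
    moreover have "\<forall>\<^sub>F n in sequentially. 0 < ln (real n)" by real_asymp
    then have "\<forall>\<^sub>F n in sequentially. ln (real n) \<noteq> 0" by (rule eventually_mono) simp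
    ultimately show ?thesis unfolding \<rho>_def by (rule landau_o.big.divide_right[rotated])
  qed
  have \<rho>0: "\<rho> \<longlonglongrightarrow> 0"
  proof -
    have "?g \<in> o(\<lambda>_. 1)" by real_asymp
    then have "\<rho> \<in> o(\<lambda>_. 1)" using \<rho> by (rule landau_o.big_small_trans[rotated])
    from smalloD_tendsto[OF this] show ?thesis by simp
  qed
  have e4: "(\<lambda>n. ln (1 + \<rho> n)) \<in> O(?g)"
  proof -
    have "(\<lambda>x::real. ln (1 + x)) \<in> O[nhds 0](\<lambda>x. x)"
    proof (rule bigoI[where c = 2])
      have "\<forall>\<^sub>F x::real in nhds 0. x \<in> {-1/2<..<1/2}" by (rule eventually_nhds_in_open) auto
      then show "\<forall>\<^sub>F x::real in nhds 0. norm (ln (1 + x)) \<le> 2 * norm x"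
      proof eventually_elim
        case (elim x)
        then have "\<bar>ln (1 + x) - x\<bar> \<le> 2 * x\<^sup>2" by (intro abs_ln_one_plus_x_minus_x_bound) auto
        moreover have "2 * x\<^sup>2 \<le> \<bar>x\<bar>"
        proof -
          have "\<bar>x\<bar> * \<bar>x\<bar> \<le> 1 / 2 * \<bar>x\<bar>" using elim by (intro mult_right_mono) auto
          then show ?thesis by (simp add: power2_eq_square)
        qed
        ultimately show ?case by (auto simp: abs_le_iff)
      qed
    qed
    from landau_o.big.compose[OF this \<rho>0] \<rho> show ?thesis by (rule landau_o.big_trans)
  qed
  have tot: "(\<lambda>n. e1 n - pi\<^sup>2 / 6 * e2 (\<alpha> n) + 1 / 2 * e3 (\<alpha> n) + 1 / 2 * ln (1 + \<rho> n)) \<in> O(?g)"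
    using e1 e2 e3 e4 by (intro sum_in_bigo) auto
  have ln1: "\<forall>\<^sub>F n in sequentially. 1 \<le> ln (real n)" by real_asymp
  have P: "0 < (\<Prod>j. 1 - (\<alpha> n / (\<alpha> n + 1)) ^ Suc j)" if "1 \<le> \<alpha> n" for n
    by (rule qprod_LIMSEQ(2)) (use that in auto)
  show "\<forall>\<^sub>F n in sequentially. 0 < lam n"
    using pos eventually_gt_at_top[of 0]
    by eventually_elim (unfold lam_def, intro mult_pos_pos P, simp_all)
  have "\<forall>\<^sub>F n in sequentially. ln (lam n) + \<mu> n =
      e1 n - pi\<^sup>2 / 6 * e2 (\<alpha> n) + 1 / 2 * e3 (\<alpha> n) + 1 / 2 * ln (1 + \<rho> n)"
    using pos ln1 \<alpha> eventually_gt_at_top[of 0]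
  proof eventually_elim
    case (elim n)
    let ?l = "ln (real n)" and ?Z = "?z (\<alpha> n)"
    have Z: "0 < ?Z" using qz[OF elim(1)] by simp
    have l0: "0 < ?l" using elim(2) by simp
    have "\<alpha> n = 6 / pi\<^sup>2 * (?l * (1 + \<rho> n))"
    proof -
      have "?l * \<rho> n = 1/2 * ln ?l + 1/2 * ln (12 / pi) - pi\<^sup>2 / 12 + \<mu> n"
        unfolding \<rho>_def using l0 by simp
      then have "?l * (1 + \<rho> n) = ?l + 1/2 * ln ?l + 1/2 * ln (12 / pi) - pi\<^sup>2 / 12 + \<mu> n"
        by (simp add: distrib_left)
      then show ?thesis unfolding elim(3) by (simp only:)
    qed
    moreover from this have r: "0 < 1 + \<rho> n" using elim(1) l0
      by (smt (verit) divide_pos_pos mult_nonneg_nonpos pi_gt_zero zero_less_power)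
    moreover have "ln (6 / pi\<^sup>2 * (?l * (1 + \<rho> n))) = ln (6 / pi\<^sup>2) + ln (?l * (1 + \<rho> n))"
      by (rule ln_mult_pos) (use l0 r in simp_all)
    moreover have "ln (?l * (1 + \<rho> n)) = ln ?l + ln (1 + \<rho> n)"
      by (rule ln_mult_pos) (use l0 r in simp_all)
    ultimately have ln\<alpha>: "ln (\<alpha> n) = ln (6 / pi\<^sup>2) + (ln ?l + ln (1 + \<rho> n))"
      by (simp only:)
    \<comment> \<open>The origin of 12 / pi in the window: it is the 2 pi of the product formula
      times the 6 / pi^2 of \<alpha>.\<close>
    have c: "ln (6 / pi\<^sup>2) = ln (12 / pi) - ln (2 * pi)"
    proof -
      have "12 / pi = 6 / pi\<^sup>2 * (2 * pi)" by (simp add: power2_eq_square)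
      moreover have "ln (6 / pi\<^sup>2 * (2 * pi)) = ln (6 / pi\<^sup>2) + ln (2 * pi)"
        by (rule ln_mult_pos) auto
      ultimately show ?thesis by (simp only: add_diff_cancel)
    qed
    have lnZ: "ln (2 * pi / ?Z) = ln (2 * pi) + ln (1 / ?Z)" using Z by (simp add: ln_div)
    have z: "pi\<^sup>2 / 6 * (1 / ?Z) = pi\<^sup>2 / (6 * ?Z)" by simp
    have main: "pi\<^sup>2 / 6 * \<alpha> n = ?l + 1/2 * ln ?l + 1/2 * ln (12 / pi) - pi\<^sup>2 / 12 + \<mu> n"
      unfolding elim(3) by simp
    have "ln (lam n) = ?l + ln (\<Prod>j. 1 - (\<alpha> n / (\<alpha> n + 1)) ^ Suc j)"
      unfolding lam_def using P[OF elim(1)] elim(4) by (simp add: ln_mult)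
    also have "\<dots> = ?l + e1 n + (- pi\<^sup>2 / (6 * ?Z) + ln (2 * pi / ?Z) / 2)"
      by (simp add: e1_def)
    finally have "ln (lam n) = ?l + e1 n - pi\<^sup>2 / 6 * (1 / ?Z) + (ln (2 * pi) + ln (1 / ?Z)) / 2"
      unfolding lnZ z by simp
    moreover have "pi\<^sup>2 / 6 * e2 (\<alpha> n) = pi\<^sup>2 / 6 * (1 / ?Z) - pi\<^sup>2 / 6 * \<alpha> n - pi\<^sup>2 / 12"
      by (simp add: e2_def right_diff_distrib)
    ultimately show ?case using main ln\<alpha> c unfolding e3_def by (simp add: field_simps)
  qed
  then show "(\<lambda>n. ln (lam n) + \<mu> n) \<in> O(?g)"
    using tot by (subst landau_o.big.in_cong) auto
qed

text \<open>From 3 < pi < 4 the factor 6 / pi^2 lies between 3/8 and 2/3. The bracket lies between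
  8/9 and 3/2 times log n, fractions chosen so that the products are 1/3 and 1.\<close>

lemma alpha_range:
  fixes \<alpha> \<mu> :: "nat \<Rightarrow> real"
  assumes \<alpha>: "\<forall>\<^sub>F n in sequentially.
      \<alpha> n = 6 / pi\<^sup>2 * (ln (real n) + 1/2 * ln (ln (real n)) + 1/2 * ln (12 / pi) - pi\<^sup>2 / 12 + \<mu> n)"
    and mu: "\<mu> \<in> o(\<lambda>n. ln (ln (ln (real n))))"
  shows "\<forall>\<^sub>F n in sequentially. ln (real n) / 3 \<le> \<alpha> n \<and> \<alpha> n \<le> ln (real n)"
proof -
  have m1: "\<forall>\<^sub>F n in sequentially. \<bar>\<mu> n\<bar> \<le> \<bar>ln (ln (ln (real n)))\<bar>"
    using landau_o.smallD[OF mu, of 1] by simp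
  have a: "\<forall>\<^sub>F n in sequentially. 8 / 9 * ln (real n) + \<bar>ln (ln (ln (real n)))\<bar> \<le>
     ln (real n) + 1/2 * ln (ln (real n)) + 1/2 * ln (12 / pi) - pi\<^sup>2 / 12"
    by real_asymp
  have b: "\<forall>\<^sub>F n in sequentially.
     ln (real n) + 1/2 * ln (ln (real n)) + 1/2 * ln (12 / pi) - pi\<^sup>2 / 12 + \<bar>ln (ln (ln (real n)))\<bar> \<le> 3 / 2 * ln (real n)"
    by real_asymp
  have l: "\<forall>\<^sub>F n in sequentially. 1 \<le> ln (real n)" by real_asymp
  have "pi\<^sup>2 \<le> 16" using pi_less_4 power_mono[of pi 4 2] by simp
  then have c1: "3 / 8 \<le> 6 / pi\<^sup>2" by (simp add: field_simps)
  have "9 \<le> pi\<^sup>2" using pi_gt3 power_mono[of 3 pi 2] by simp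
  then have c2: "6 / pi\<^sup>2 \<le> 2 / 3" by (simp add: field_simps)
  show ?thesis using m1 a b l \<alpha>
  proof eventually_elim
    case (elim n)
    let ?b = "ln (real n) + 1/2 * ln (ln (real n)) + 1/2 * ln (12 / pi) - pi\<^sup>2 / 12 + \<mu> n"
    have b: "8 / 9 * ln (real n) \<le> ?b" "?b \<le> 3 / 2 * ln (real n)" using elim(1-3) by linarith+
    have "3 / 8 * (8 / 9 * ln (real n)) \<le> 6 / pi\<^sup>2 * ?b"
      using b(1) c1 elim(4) by (intro mult_mono) auto
    moreover have "6 / pi\<^sup>2 * ?b \<le> 2 / 3 * (3 / 2 * ln (real n))"
      using b c2 elim(4) by (intro mult_mono) auto
    ultimately show ?case unfolding elim(5) by simp
  qed
qed

lemma total_variation_nonneg: "0 \<le> total_variation p q"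
proof -
  have "\<bar>measure_pmf.prob p A - measure_pmf.prob q A\<bar> \<le> 1" for A
    using measure_pmf.prob_le_1[of p A] measure_pmf.prob_le_1[of q A]
      measure_nonneg[of "measure_pmf p" A] measure_nonneg[of "measure_pmf q" A] by linarith
  then have "bdd_above (range (\<lambda>A. \<bar>measure_pmf.prob p A - measure_pmf.prob q A\<bar>))"
    by (intro bdd_aboveI[of _ 1]) auto
  then have "\<bar>measure_pmf.prob p UNIV - measure_pmf.prob q UNIV\<bar> \<le> total_variation p q"
    unfolding total_variation_def by (intro cSUP_upper) auto
  then show ?thesis by simp
qed

lemma abs_exp_minus_one_le:
  fixes e :: real
  assumes "\<bar>e\<bar> \<le> 1"
  shows "\<bar>exp e - 1\<bar> \<le> 2 * \<bar>e\<bar>"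
proof (cases "0 \<le> e")
  case True
  have "exp e \<le> 1 + e + e\<^sup>2" using exp_bound[of e] True assms by simp
  moreover have "e * e \<le> 1 * e" using True assms by (intro mult_right_mono) auto
  moreover have "1 \<le> exp e" using True by simp
  ultimately show ?thesis using True by (simp add: power2_eq_square)
next
  case False
  have "1 + e \<le> exp e" by (rule exp_ge_add_one_self)
  moreover have "exp e \<le> 1" using False by simp
  ultimately show ?thesis using False by linarith
qed

text \<open>Since the mean exp (- \<mu>) varies with n, being asymptotically Poisson is expressed by
  a total variation distance that tends to 0.\<close>

theorem theorem3p1:
  fixes m :: "nat \<Rightarrow> nat" and \<alpha> \<mu> lam :: "nat \<Rightarrow> real"
  assumes alpha_def: "\<And>n. \<alpha> n = real (m n) / real n"
    and alpha_eq: "\<forall>\<^sub>F n in sequentially.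
      \<alpha> n = 6 / pi\<^sup>2 * (ln (real n) + 1/2 * ln (ln (real n)) + 1/2 * ln (12 / pi) - pi\<^sup>2 / 12 + \<mu> n)"
    and mu: "(\<lambda>n. \<bar>\<mu> n\<bar>) \<in> o(\<lambda>n. ln (ln (ln (real n))))"
    and lam_def: "\<And>n. lam n = real n * (\<Prod>j. 1 - \<alpha> n ^ Suc j / (\<alpha> n + 1) ^ Suc j)"
  shows "(\<lambda>n. total_variation (excess_components_pmf n (m n))
             (map_pmf int (poisson_pmf (exp (- \<mu> n))))) \<longlonglongrightarrow> 0
    \<and> (\<forall>\<epsilon>>0. \<forall>\<^sub>F n in sequentially.
          total_variation (excess_components_pmf n (m n)) (map_pmf int (poisson_pmf (lam n)))
            \<le> ln (real n) powr (- 1 + \<epsilon>))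
    \<and> (\<exists>e \<in> O(\<lambda>n. ln (ln (real n)) / ln (real n)). \<forall>\<^sub>F n in sequentially.
          lam n = exp (- \<mu> n + e n))"
proof -
  let ?TV = "\<lambda>n \<nu>. total_variation (excess_components_pmf n (m n)) (map_pmf int (poisson_pmf \<nu>))"
  let ?g = "\<lambda>n. ln (ln (real n)) / ln (real n)"
  have mu': "\<mu> \<in> o(\<lambda>n. ln (ln (ln (real n))))" using mu by simp
  have lam: "lam n = real n * (\<Prod>j. 1 - (\<alpha> n / (\<alpha> n + 1)) ^ Suc j)" for n
    by (simp only: lam_def power_divide)
  note range = alpha_range[OF alpha_eq mu']
  have lo: "\<forall>\<^sub>F n in sequentially. ln (real n) / 3 \<le> \<alpha> n"
    using range by (rule eventually_mono) simp
  note expn = lam_expansion[OF alpha_eq mu' lo, folded lam]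
  define e where "e n = ln (lam n) + \<mu> n" for n
  have eO: "e \<in> O(?g)" using expn(1) by (simp add: e_def[abs_def])
  have lam_e: "\<forall>\<^sub>F n in sequentially. lam n = exp (- \<mu> n + e n)"
    using expn(2) by eventually_elim (simp add: e_def)
  obtain C where C: "C > 0" "\<forall>\<^sub>F n in sequentially. norm (e n) \<le> C * norm (?g n)"
    using landau_o.bigE[OF eO] by blast
  \<comment> \<open>Eventually exp (- \<mu>) is at most \<open>s\<close>, because |\<mu>| is at most
    half of log log log n. Any fraction below 1 in place of one half would keep exp (30 s) below all
    powers of log n.\<close>
  define s where "s n = sqrt (ln (ln (real n)))" for n :: nat
  have e_bound: "\<forall>\<^sub>F n in sequentially. \<bar>e n\<bar> \<le> C * ?g n \<and> \<bar>e n\<bar> \<le> 1"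
  proof -
    have "\<forall>\<^sub>F n in sequentially. C * ?g n \<le> 1" using C(1) by real_asymp
    moreover have "\<forall>\<^sub>F n in sequentially. 0 \<le> ?g n" by real_asymp
    ultimately show ?thesis using C(2)
    proof eventually_elim
      case (elim n)
      have "norm (?g n) = ?g n" unfolding real_norm_def by (rule abs_of_nonneg[OF elim(2)])
      then have "\<bar>e n\<bar> \<le> C * ?g n" using elim(3) unfolding real_norm_def by simp
      then show ?case using elim(1) by linarith
    qed
  qed
  have mu_bound: "\<forall>\<^sub>F n in sequentially. exp (- \<mu> n) \<le> s n"
  proof -
    have "\<forall>\<^sub>F n in sequentially. \<bar>\<mu> n\<bar> \<le> 1 / 2 * \<bar>ln (ln (ln (real n)))\<bar>"
      using landau_o.smallD[OF mu', of "1 / 2"] by simp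
    moreover have "\<forall>\<^sub>F n in sequentially. 1 \<le> ln (ln (ln (real n)))" by real_asymp
    moreover have "\<forall>\<^sub>F n in sequentially. 1 \<le> ln (ln (real n))" by real_asymp
    ultimately show ?thesis
    proof eventually_elim
      case (elim n)
      have "exp (- \<mu> n) \<le> exp (ln (ln (ln (real n))) / 2)" using elim(1,2) by simp
      also have "\<dots> = s n" unfolding s_def using elim(3)
        by (simp flip: ln_sqrt)
      finally show ?case .
    qed
  qed
  have lam_bound: "\<forall>\<^sub>F n in sequentially. 0 < lam n \<and> lam n \<le> 3 * s n"
    using lam_e e_bound mu_bound
  proof eventually_elim
    case (elim n)
    have s: "0 \<le> s n" using elim(3) exp_ge_zero[of "- \<mu> n"] by linarith
    have "exp (e n) \<le> exp 1" using abs_le_D1[OF conjunct2[OF elim(2)]] by simp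
    also have "exp 1 \<le> (3 :: real)" by (rule exp_le)
    finally have "exp (- \<mu> n) * exp (e n) \<le> s n * 3" using elim(3) s by (intro mult_mono) auto
    moreover have "lam n = exp (- \<mu> n) * exp (e n)" using elim(1) by (simp only: exp_add)
    ultimately show ?case by simp
  qed
  \<comment> \<open>From here on \<Lambda> is 6 \<open>s\<close>: twice the bound 3 \<open>s\<close>
    on \<open>lam\<close>, where 3 bounds exp 1. Hence 12 = 2 * 6 here and 30 = 5 * 6 in the
    exponential.\<close>
  let ?err = "\<lambda>n. 12 * s n * ln (real n) * exp (- ((ln (real n))\<^sup>2 / 2))"
  let ?R = "\<lambda>x. (x + 2) * (x ^ 3 + 1) * (x ^ 3 + 2) + (x ^ 3 + 1 :: real)"
  have TV: "\<forall>\<^sub>F n in sequentially. \<forall>\<nu>. 0 < \<nu> \<longrightarrow> \<nu> \<le> 6 * s n \<longrightarrow>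
     ?TV n \<nu> \<le> 200 * exp (30 * s n) * (16 / ln (real n) + \<bar>lam n - \<nu>\<bar> + ?err n)"
  proof -
    have 1: "\<forall>\<^sub>F n in sequentially. 4 * (?R (ln (real n)))\<^sup>2 * ln (real n) \<le> real n" by real_asymp
    have 2: "\<forall>\<^sub>F n in sequentially. 8 * real n * ln (real n) * exp (- ((ln (real n))\<^sup>2 / 2)) \<le> 1" by real_asymp
    have 3: "\<forall>\<^sub>F n in sequentially. (ln (real n) + 1)\<^sup>2 * ln (real n) \<le> real n" by real_asymp
    have 4: "\<forall>\<^sub>F n in sequentially. 12 / ln (real n) + 120 * (3 / ln (real n)) ^ 5 * ((ln (real n)) ^ 3 + 1) \<le> 13 / ln (real n)"
      by real_asymp
    have 5: "\<forall>\<^sub>F n in sequentially. 208 \<le> ln (real n)" by real_asymp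
    show ?thesis using 1 2 3 4 5 range lam_bound
    proof eventually_elim
      case (elim n)
      have L: "2 * lam n \<le> 6 * s n" using elim(7) by simp
      show ?case
        using total_variation_log_bound[OF alpha_def conjunct1[OF elim(6)] conjunct2[OF elim(6)] lam elim(5,1,2,3,4) L]
        by simp
    qed
  qed
  have "(\<lambda>n. ?TV n (exp (- \<mu> n))) \<longlonglongrightarrow> 0"
  proof (rule tendsto_sandwich)
    show "\<forall>\<^sub>F n in sequentially. 0 \<le> ?TV n (exp (- \<mu> n))"
      by (intro always_eventually allI total_variation_nonneg)
    show "(\<lambda>n. 0) \<longlonglongrightarrow> (0 :: real)" by simp
    \<comment> \<open>The middle term bounds |lam - exp (- \<mu>)| = exp (- \<mu>) |exp e - 1|. It
      is of order (log log n)^(3/2) / log n, still small enough to absorb exp (30 s).\<close>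
    let ?b = "\<lambda>n. 200 * exp (30 * s n) * (16 / ln (real n) + 2 * C * s n * ?g n + ?err n)"
    show "?b \<longlonglongrightarrow> 0" unfolding s_def using C(1) by real_asymp
    show "\<forall>\<^sub>F n in sequentially. ?TV n (exp (- \<mu> n)) \<le> ?b n"
      using TV lam_e e_bound mu_bound
    proof eventually_elim
      case (elim n)
      have "0 < exp (- \<mu> n)" by simp
      then have s0: "0 \<le> s n" using elim(4) by linarith
      have "lam n - exp (- \<mu> n) = exp (- \<mu> n) * (exp (e n) - 1)"
        unfolding elim(2) exp_add by (simp add: right_diff_distrib)
      then have "\<bar>lam n - exp (- \<mu> n)\<bar> = exp (- \<mu> n) * \<bar>exp (e n) - 1\<bar>"
        by (simp add: abs_mult)
      also have "\<dots> \<le> s n * (2 * (C * ?g n))"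
        using abs_exp_minus_one_le[of "e n"] elim(3,4) s0 by (intro mult_mono) auto
      finally have d: "\<bar>lam n - exp (- \<mu> n)\<bar> \<le> 2 * C * s n * ?g n" by (simp add: mult_ac)
      have "?TV n (exp (- \<mu> n)) \<le> 200 * exp (30 * s n) * (16 / ln (real n) + \<bar>lam n - exp (- \<mu> n)\<bar> + ?err n)"
        using elim(1,4) s0 by simp
      also have "\<dots> \<le> ?b n" by (intro mult_left_mono add_mono d order_refl) simp
      finally show ?case .
    qed
  qed
  moreover have "\<forall>\<^sub>F n in sequentially. ?TV n (lam n) \<le> ln (real n) powr (- 1 + \<epsilon>)"
    if \<epsilon>: "\<epsilon> > 0" for \<epsilon> :: real
  proof -
    have "\<forall>\<^sub>F n in sequentially. 200 * exp (30 * s n) * (16 / ln (real n) + ?err n) \<le> ln (real n) powr (- 1 + \<epsilon>)"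
      unfolding s_def using \<epsilon> by real_asymp
    with TV lam_bound show ?thesis
    proof eventually_elim
      case (elim n)
      have "0 < lam n" "lam n \<le> 6 * s n" using elim(2) by auto
      then have "?TV n (lam n) \<le> 200 * exp (30 * s n) * (16 / ln (real n) + \<bar>lam n - lam n\<bar> + ?err n)"
        using elim(1) by blast
      then show ?case using elim(3) by simp
    qed
  qed
  ultimately show ?thesis using eO lam_e by blast
qed

end
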